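(* 1. Up to isomorphism there are exactly four extensible graphs $(\Lambda,Y)$ with parameter $t=1$; their parameters $(t,s,\bar s)$ are $(1,1,0)$, $(1,2,2)$, $(1,3,4)$, $(1,5,8)$ (one graph for each). 2. For each of them let $\Gamma$ be a simple graph on $X=Y\cup\{x\}$ ($x\notin Y$) with $\Gamma^x=\Lambda$, and for a vertex $y\in Y$ let $(\Lambda_2,Y_2)$ be the graph induced by $\Lambda$ on $Y_2=\Lambda(y,2)$. Then: (a) If $(t,s,\bar s)=(1,1,0)$: $|Y|=3$, $|X|=4$, $\Lambda$ is a triangle, $\mathrm{Aut}(\Lambda)\cong\mathcal{S}_3$ and $G(\Gamma)\cong\mathcal{S}_4$. (b) If $(t,s,\bar s)=(1,2,2)$: $|Y|=9$, $|X|=10$; $\mathrm{Aut}(\Lambda_2,Y_2)$ is permutation-isomorphic to the symmetry group of a square acting on its vertices (order $8$); $\mathrm{Aut}(\Lambda,Y)$ is transitive on $Y$ and has order $72$; $G(\Gamma)$ is doubly transitive on $X$ and has order $720$. (c) If $(t,s,\bar s)=(1,3,4)$: $|Y|=15$, $|X|=16$; $\mathrm{Aut}(\Lambda_2,Y_2)$ is permutation-isomorphic to the symmetry group of a cube acting on its vertices (order $48$); $\mathrm{Aut}(\Lambda,Y)$ is transitive on $Y$ and has order $720$; $G(\Gamma)$ is doubly transitive on $X$ and has order $11520$. (d) If $(t,s,\bar s)=(1,5,8)$: $|Y|=27$, $|X|=28$; $\mathrm{Aut}(\Lambda_2,Y_2)$ is permutation-isomorphic to the automorphism group of the graph formed by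 the $4$-dimensional hypercube together with its main diagonals, of order $2^4\cdot 5!=1920$; $\mathrm{Aut}(\Lambda,Y)$ is transitive on $Y$ and has order $51840$; $G(\Gamma)$ is doubly transitive on $X$, has order $1451520$, and is permutation-isomorphic to the degree-$28$ doubly transitive representation of the simple group $S_6(2)=PSp_6(2)$.
   Context: A finite simple graph $(\Lambda,Y)$ is called extensible with parameters $(t,s,\bar s)$ (nonnegative integers) if: (1) $\Lambda$ has diameter at most $2$; (2) for every $y\in Y$, writing $\Lambda(y,d)$ for the set of vertices at distance $d$ from $y$: (a) $|\Lambda(y,1)|=2s$; (b) $|\Lambda(y,2)|=2\bar s$; (c) every $z\in\Lambda(y,1)$ is adjacent to exactly $\bar s$ points of $\Lambda(y,2)$ and to exactly $t=2s-\bar s-1$ points of $\Lambda(y,1)$; (d) every $z\in\Lambda(y,2)$ is adjacent to exactly $s$ points of $\Lambda(y,2)$ and to exactly $s$ points of $\Lambda(y,1)$; (3) every edge lies in exactly $t$ triangles; (4) $|Y|=1+2s+2\bar s$. For a simple graph $\Gamma$ on a finite set $X$, its matrix $\mathcal{E}=(\varepsilon_{i,j})$ has $\varepsilon_{i,j}=-1$ if $i\ne j$ are adjacent, $1$ otherwise. Graphs on $X$ with matrices $\mathcal{E},\mathcal{E}'$ are associated if $\varepsilon'_{i,j}=\nu_i\nu_j\varepsilon_{i,j}$ for some $\nu_i\in\{\pm1\}$. $G(\Gamma)$ is the group of permutations $\sigma$ of $X$ such that $\Gamma$ and its image ${}^\sigma\Gamma$ are associated. ${}^x\Gamma$ is the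 unique graph associated to $\Gamma$ in which $x$ is isolated; $\Gamma^x$ is the graph induced by ${}^x\Gamma$ on $X\setminus\{x\}$. *)

theory Defs
  imports "HOL-Algebra.Sym_Groups"
begin

definition graph_on :: "'a set \<Rightarrow> ('a \<Rightarrow> 'a \<Rightarrow> bool) \<Rightarrow> bool" where
  "graph_on V E \<longleftrightarrow> finite V \<and> (\<forall>u v. E u v \<longrightarrow> u \<in> V \<and> v \<in> V \<and> u \<noteq> v \<and> E v u)"

definition nbhd1 :: "'a set \<Rightarrow> ('a \<Rightarrow> 'a \<Rightarrow> bool) \<Rightarrow> 'a \<Rightarrow> 'a set" where
  "nbhd1 V E y = {z \<in> V. E y z}"

definition nbhd2 :: "'a set \<Rightarrow> ('a \<Rightarrow> 'a \<Rightarrow> bool) \<Rightarrow> 'a \<Rightarrow> 'a set" where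
  "nbhd2 V E y = {z \<in> V. z \<noteq> y \<and> \<not> E y z \<and> (\<exists>w \<in> V. E y w \<and> E w z)}"

definition diam_le2 :: "'a set \<Rightarrow> ('a \<Rightarrow> 'a \<Rightarrow> bool) \<Rightarrow> bool" where
  "diam_le2 V E \<longleftrightarrow> (\<forall>u \<in> V. \<forall>v \<in> V. u = v \<or> E u v \<or> (\<exists>w \<in> V. E u w \<and> E w v))"

definition extensible :: "'a set \<Rightarrow> ('a \<Rightarrow> 'a \<Rightarrow> bool) \<Rightarrow> nat \<Rightarrow> nat \<Rightarrow> nat \<Rightarrow> bool" where
  "extensible V E t s sb \<longleftrightarrow>
     graph_on V E \<and> int t = 2 * int s - int sb - 1 \<and>
     diam_le2 V E \<and>
     (\<forall>y \<in> V.
        card (nbhd1 V E y) = 2 * s \<and>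
        card (nbhd2 V E y) = 2 * sb \<and>
        (\<forall>z \<in> nbhd1 V E y. card (nbhd1 V E z \<inter> nbhd2 V E y) = sb \<and>
                             card (nbhd1 V E z \<inter> nbhd1 V E y) = t) \<and>
        (\<forall>z \<in> nbhd2 V E y. card (nbhd1 V E z \<inter> nbhd2 V E y) = s \<and>
                             card (nbhd1 V E z \<inter> nbhd1 V E y) = s)) \<and>
     (\<forall>u \<in> V. \<forall>v \<in> V. E u v \<longrightarrow> card {w \<in> V. E u w \<and> E v w} = t) \<and>
     card V = 1 + 2 * s + 2 * sb"

definition graph_iso :: "'a set \<Rightarrow> ('a \<Rightarrow> 'a \<Rightarrow> bool) \<Rightarrow> 'b set \<Rightarrow> ('b \<Rightarrow> 'b \<Rightarrow> bool) \<Rightarrow> bool" where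
  "graph_iso V E W F \<longleftrightarrow> (\<exists>f. bij_betw f V W \<and> (\<forall>u \<in> V. \<forall>v \<in> V. F (f u) (f v) = E u v))"

definition induced :: "'a set \<Rightarrow> ('a \<Rightarrow> 'a \<Rightarrow> bool) \<Rightarrow> 'a \<Rightarrow> 'a \<Rightarrow> bool" where
  "induced S E u v \<longleftrightarrow> u \<in> S \<and> v \<in> S \<and> E u v"

definition Aut :: "'a set \<Rightarrow> ('a \<Rightarrow> 'a \<Rightarrow> bool) \<Rightarrow> ('a \<Rightarrow> 'a) set" where
  "Aut V E = {\<sigma>. \<sigma> permutes V \<and> (\<forall>u \<in> V. \<forall>v \<in> V. E (\<sigma> u) (\<sigma> v) = E u v)}"

definition seidel :: "('a \<Rightarrow> 'a \<Rightarrow> bool) \<Rightarrow> 'a \<Rightarrow> 'a \<Rightarrow> int" where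
  "seidel E i j = (if i \<noteq> j \<and> E i j then -1 else 1)"

definition associated :: "'a set \<Rightarrow> ('a \<Rightarrow> 'a \<Rightarrow> bool) \<Rightarrow> ('a \<Rightarrow> 'a \<Rightarrow> bool) \<Rightarrow> bool" where
  "associated X E E' \<longleftrightarrow> (\<exists>\<nu> :: 'a \<Rightarrow> int. (\<forall>i \<in> X. \<nu> i = 1 \<or> \<nu> i = -1) \<and>
      (\<forall>i \<in> X. \<forall>j \<in> X. seidel E' i j = \<nu> i * \<nu> j * seidel E i j))"

definition img_graph :: "('a \<Rightarrow> 'a) \<Rightarrow> ('a \<Rightarrow> 'a \<Rightarrow> bool) \<Rightarrow> 'a \<Rightarrow> 'a \<Rightarrow> bool" where
  "img_graph \<sigma> E u v \<longleftrightarrow> (\<exists>i j. u = \<sigma> i \<and> v = \<sigma> j \<and> E i j)"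

definition Ggrp :: "'a set \<Rightarrow> ('a \<Rightarrow> 'a \<Rightarrow> bool) \<Rightarrow> ('a \<Rightarrow> 'a) set" where
  "Ggrp X E = {\<sigma>. \<sigma> permutes X \<and> associated X E (img_graph \<sigma> E)}"

definition isolate :: "'a set \<Rightarrow> ('a \<Rightarrow> 'a \<Rightarrow> bool) \<Rightarrow> 'a \<Rightarrow> 'a \<Rightarrow> 'a \<Rightarrow> bool" where
  "isolate X E x = (THE E'. graph_on X E' \<and> associated X E E' \<and> (\<forall>v. \<not> E' x v))"

definition derived :: "'a set \<Rightarrow> ('a \<Rightarrow> 'a \<Rightarrow> bool) \<Rightarrow> 'a \<Rightarrow> 'a \<Rightarrow> 'a \<Rightarrow> bool" where
  "derived X E x = induced (X - {x}) (isolate X E x)"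

definition perm_grp :: "('a \<Rightarrow> 'a) set \<Rightarrow> ('a \<Rightarrow> 'a) monoid" where
  "perm_grp S = \<lparr> carrier = S, mult = (\<circ>), one = id \<rparr>"

definition perm_iso :: "'a set \<Rightarrow> ('a \<Rightarrow> 'a) set \<Rightarrow> 'b set \<Rightarrow> ('b \<Rightarrow> 'b) set \<Rightarrow> bool" where
  "perm_iso X A Z B \<longleftrightarrow> (\<exists>f. bij_betw f X Z \<and>
      B = (\<lambda>a. \<lambda>z. if z \<in> Z then f (a (inv_into X f z)) else z) ` A)"

definition transitive_on :: "'a set \<Rightarrow> ('a \<Rightarrow> 'a) set \<Rightarrow> bool" where
  "transitive_on X A \<longleftrightarrow> (\<forall>u \<in> X. \<forall>v \<in> X. \<exists>g \<in> A. g u = v)"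

definition doubly_transitive_on :: "'a set \<Rightarrow> ('a \<Rightarrow> 'a) set \<Rightarrow> bool" where
  "doubly_transitive_on X A \<longleftrightarrow> (\<forall>u1 \<in> X. \<forall>u2 \<in> X. \<forall>v1 \<in> X. \<forall>v2 \<in> X.
      u1 \<noteq> u2 \<longrightarrow> v1 \<noteq> v2 \<longrightarrow> (\<exists>g \<in> A. g u1 = v1 \<and> g u2 = v2))"

definition cube_verts :: "nat \<Rightarrow> (nat \<Rightarrow> nat) set" where
  "cube_verts n = {v. (\<forall>i < n. v i < 2) \<and> (\<forall>i \<ge> n. v i = 0)}"

definition sqdist :: "nat \<Rightarrow> (nat \<Rightarrow> nat) \<Rightarrow> (nat \<Rightarrow> nat) \<Rightarrow> int" where
  "sqdist n v w = (\<Sum>i<n. (int (v i) - int (w i))^2)"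

definition cube_sym :: "nat \<Rightarrow> ((nat \<Rightarrow> nat) \<Rightarrow> (nat \<Rightarrow> nat)) set" where
  "cube_sym n = {\<sigma>. \<sigma> permutes cube_verts n \<and>
     (\<forall>v \<in> cube_verts n. \<forall>w \<in> cube_verts n. sqdist n (\<sigma> v) (\<sigma> w) = sqdist n v w)}"

definition cube4_diag :: "(nat \<Rightarrow> nat) \<Rightarrow> (nat \<Rightarrow> nat) \<Rightarrow> bool" where
  "cube4_diag v w \<longleftrightarrow> v \<in> cube_verts 4 \<and> w \<in> cube_verts 4 \<and>
      (sqdist 4 v w = 1 \<or> sqdist 4 v w = 4)"

definition F2_6 :: "(nat \<Rightarrow> nat) set" where
  "F2_6 = cube_verts 6"

definition vadd :: "(nat \<Rightarrow> nat) \<Rightarrow> (nat \<Rightarrow> nat) \<Rightarrow> nat \<Rightarrow> nat" where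
  "vadd u v = (\<lambda>i. (u i + v i) mod 2)"

definition symp :: "(nat \<Rightarrow> nat) \<Rightarrow> (nat \<Rightarrow> nat) \<Rightarrow> nat" where
  "symp u v = (\<Sum>i<3. u (2*i) * v (2*i+1) + u (2*i+1) * v (2*i)) mod 2"

definition Sp6_2 :: "((nat \<Rightarrow> nat) \<Rightarrow> (nat \<Rightarrow> nat)) set" where
  "Sp6_2 = {g. bij_betw g F2_6 F2_6 \<and>
     (\<forall>u \<in> F2_6. \<forall>v \<in> F2_6. g (vadd u v) = vadd (g u) (g v) \<and> symp (g u) (g v) = symp u v)}"

text \<open>Quadratic forms polarising to symp (extended by 0 outside F_2^6), and those of
minus (elliptic) type, i.e. with exactly 28 zeros.\<close>

definition qforms :: "((nat \<Rightarrow> nat) \<Rightarrow> nat) set" where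
  "qforms = {Q. (\<forall>v \<in> F2_6. Q v < 2) \<and> (\<forall>v. v \<notin> F2_6 \<longrightarrow> Q v = 0) \<and>
     (\<forall>u \<in> F2_6. \<forall>v \<in> F2_6. Q (vadd u v) = (Q u + Q v + symp u v) mod 2)}"

definition ell_forms :: "((nat \<Rightarrow> nat) \<Rightarrow> nat) set" where
  "ell_forms = {Q \<in> qforms. card {v \<in> F2_6. Q v = 0} = 28}"

definition qact :: "((nat \<Rightarrow> nat) \<Rightarrow> (nat \<Rightarrow> nat)) \<Rightarrow> ((nat \<Rightarrow> nat) \<Rightarrow> nat) \<Rightarrow> (nat \<Rightarrow> nat) \<Rightarrow> nat" where
  "qact g Q = (\<lambda>v. if v \<in> F2_6 then Q (inv_into F2_6 g v) else 0)"

definition S62_deg28 :: "(((nat \<Rightarrow> nat) \<Rightarrow> nat) \<Rightarrow> ((nat \<Rightarrow> nat) \<Rightarrow> nat)) set" where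
  "S62_deg28 = (\<lambda>g Q. if Q \<in> ell_forms then qact g Q else Q) ` Sp6_2"

end

theory Submission
  imports Defs "HOL-Combinatorics.Multiset_Permutations" "HOL-Number_Theory.Cong" "HOL-Library.Countable"
begin

text \<open>An extensible graph with \<open>t = 1\<close> is the collinearity graph of a generalised quadrangle with
  three points on each line and \<open>s\<close> lines through each point. Fix non-adjacent \<open>y\<close> and \<open>z\<close>. Each
  of the \<open>s\<close> lines \<open>i\<close> through \<open>y\<close> meets a unique line through a given point \<open>w\<close> far from \<open>y\<close>; moving
  from \<open>w\<close> to the third point of the latter defines commuting involutions \<open>step i\<close>. A group \<open>2^s\<close> thus acts on
  the \<open>4s - 4\<close> points far from \<open>y\<close>, the stabiliser of a point being trivial or generated by the
  product of all the steps. Hence \<open>s\<close> is 1, 2, 3 or 5, and the far points form a square, a cube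
  or a folded 5-cube, that is, a 4-cube with its main diagonals. The graph is reconstructed
  from \<open>y\<close>, \<open>z\<close> and an ordering of their common neighbours, so its automorphism group acts
  regularly on these frames.

  The stabiliser of \<open>x\<close> in the switching group is the automorphism group of the graph, and for
  each \<open>u\<close> an analogue of a transvection swaps \<open>x\<close> and \<open>u\<close>; this gives double transitivity and the orders.
  For \<open>s = 5\<close> the graph consists of the singular points of an elliptic form \<open>Q\<close>, the point
  \<open>c\<close> corresponds to the elliptic form \<open>Q + symp c\<close>, and these transvections become
  symplectic ones.\<close>


section \<open>Strongly regular graphs with lambda = 1\<close>

text \<open>The comparison of 2^n with 4 s - 4 decides everything. The signs telling which point of
  each line is met determine a subset of the lines up to complement, and complements can collide
  only for odd s. For s = 4 all 16 subsets would be distinct among 12 far points; for s >= 6 the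
  2^(s-1) subsets avoiding one line are already too many. At s = 3 collisions need a separate
  exclusion, at s = 5 the 32 subsets fall together in pairs. For s = 1 there is no far point, hence
  no frame, and the triangle is handled apart. In degree 28 the vertex x gets the zero vector as
  label. The elements of the switching group then act on labels by affine maps d -> c + g d with Q0
  c = 0, and not by linear ones: the translation c records the form to which g moves
  \<open>Q0\<close>, so that on the level of forms only the natural action of g remains. Equality of
  the two permutation groups is obtained from two explicit inclusions.\<close>

locale srg =
  fixes Y :: "'a set" and E :: "'a \<Rightarrow> 'a \<Rightarrow> bool" and s :: nat
  assumes finite_Y: "finite Y"
    and E_in: "E u v \<Longrightarrow> u \<in> Y \<and> v \<in> Y"
    and E_irrefl: "\<not> E u u"
    and E_sym: "E u v \<Longrightarrow> E v u"
    and degree: "u \<in> Y \<Longrightarrow> card {w. E u w} = 2 * s"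
    and lambda: "E u v \<Longrightarrow> card {w. E u w \<and> E v w} = 1"
    and mu: "\<lbrakk>u \<in> Y; v \<in> Y; u \<noteq> v; \<not> E u v\<rbrakk> \<Longrightarrow> card {w. E u w \<and> E v w} = s"
    and card_Y: "card Y = 6 * s - 3"
    and s_pos: "0 < s"
begin

definition third :: "'a \<Rightarrow> 'a \<Rightarrow> 'a" where
  "third u v = (THE w. E u w \<and> E v w)"

definition far :: "'a \<Rightarrow> 'a set" where
  "far y = {z \<in> Y. z \<noteq> y \<and> \<not> E y z}"

lemma finite_nbrs: "finite {w. E u w \<and> Q w}"
  by (rule finite_subset[OF _ finite_Y]) (auto dest: E_in)

lemma finite_nbrs': "finite {w. E u w}"
  by (rule finite_subset[OF _ finite_Y]) (auto dest: E_in)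

lemma third_adj: assumes "E u v" shows "E u (third u v)" "E v (third u v)"
proof -
  obtain w where w: "{w. E u w \<and> E v w} = {w}"
    using lambda[OF assms] by (auto simp: card_Suc_eq)
  have "third u v = w"
    unfolding third_def using w by (intro the_equality) blast+
  then show "E u (third u v)" "E v (third u v)" using w by blast+
qed

lemma third_eq: assumes "E u v" "E u w" "E v w" shows "third u v = w"
proof -
  obtain x where x: "{w. E u w \<and> E v w} = {x}"
    using lambda[OF assms(1)] by (auto simp: card_Suc_eq)
  then show ?thesis using third_adj[OF assms(1)] assms by (metis (mono_tags, lifting) mem_Collect_eq singletonD)
qed

lemma third_third: "E u v \<Longrightarrow> third u (third u v) = v"
  using third_adj[of u v] third_eq E_sym by blast

lemma farD: "z \<in> far y \<Longrightarrow> z \<in> Y \<and> z \<noteq> y \<and> \<not> E y z \<and> \<not> E z y"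
  unfolding far_def using E_sym by auto

lemma far_sym: "y \<in> Y \<Longrightarrow> z \<in> far y \<Longrightarrow> y \<in> far z"
  unfolding far_def using E_sym by auto

lemma far_subset: "far y \<subseteq> Y" unfolding far_def by auto

lemma finite_far: "finite (far y)" using far_subset finite_Y finite_subset by blast

lemma card_far: assumes "y \<in> Y" shows "card (far y) = 4 * s - 4"
proof -
  have eq: "far y = Y - insert y {w. E y w}" unfolding far_def by auto
  have "card (insert y {w. E y w}) = 2 * s + 1"
    using finite_nbrs' degree[OF assms] E_irrefl by simp
  then show ?thesis unfolding eq using assms E_in
    by (subst card_Diff_subset) (auto simp: finite_nbrs' card_Y)
qed

text \<open>The generalised quadrangle axiom. It is forced by counting: at most one point of each of
  the \<open>s\<close> lines through \<open>y\<close> is adjacent to \<open>z\<close>, and \<open>y\<close> and \<open>z\<close> have \<open>s\<close> common neighbours.\<close>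

lemma far_line: assumes y: "y \<in> Y" and z: "z \<in> far y" and a: "E y a"
  shows "E z (third y a) \<longleftrightarrow> \<not> E z a"
proof -
  let ?C = "{w. E y w \<and> E z w}"
  have yz: "z \<in> Y" "z \<noteq> y" "\<not> E y z" using farD[OF z] by auto
  have fin: "finite ?C" by (rule finite_nbrs)
  have cC: "card ?C = s" using mu[of y z] y yz by auto
  \<comment> \<open>If z were adjacent to both w and \<open>third y w\<close>, the edge between
    these two would have both y and z as its third point.\<close>
  have one: False if "E y w" "E z w" "E z (third y w)" for w
    using third_adj[OF that(1)] third_eq[of w "third y w" y] third_eq[of w "third y w" z] that E_sym yz
    by metis
  have inj: "inj_on (third y) ?C" by (rule inj_on_inverseI[of _ "third y"]) (simp add: third_third)
  have "card (?C \<union> third y ` ?C) = 2 * s"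
    using fin one cC card_image[OF inj] by (subst card_Un_disjoint) auto
  moreover have "?C \<union> third y ` ?C \<subseteq> {w. E y w}" using third_adj by auto
  ultimately have "?C \<union> third y ` ?C = {w. E y w}"
    using degree[OF y] finite_nbrs' by (intro card_subset_eq) auto
  then have "a \<in> ?C \<or> (\<exists>w\<in>?C. a = third y w)" using a by blast
  then show ?thesis using one third_third a by auto
qed

end

text \<open>With t = 1 the parameter equation gives sb = 2 s - 2, hence 6 s - 3 vertices. Diameter
  at most 2 identifies the second neighbourhood of y with all vertices that are neither y nor
  adjacent to it, so the count of common neighbours becomes \<open>mu\<close>.\<close>

lemma extensible_imp_srg:
  assumes "extensible Y E 1 s sb" shows "srg Y E s" "sb = 2 * s - 2" "\<And>y. y \<in> Y \<Longrightarrow> srg.far Y E y = nbhd2 Y E y"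
proof -
  have g: "graph_on Y E" and t: "1 = 2 * int s - int sb - 1" and d: "diam_le2 Y E"
    and n1: "\<And>y. y \<in> Y \<Longrightarrow> card (nbhd1 Y E y) = 2 * s"
    and n2: "\<And>y z. \<lbrakk>y \<in> Y; z \<in> nbhd2 Y E y\<rbrakk> \<Longrightarrow> card (nbhd1 Y E z \<inter> nbhd1 Y E y) = s"
    and tr: "\<And>u v. \<lbrakk>u \<in> Y; v \<in> Y; E u v\<rbrakk> \<Longrightarrow> card {w \<in> Y. E u w \<and> E v w} = 1"
    and c: "card Y = 1 + 2 * s + 2 * sb"
    using assms unfolding extensible_def by auto
  have sp: "0 < s" and sb: "sb = 2 * s - 2" using t by linarith+
  have ein: "u \<in> Y \<and> v \<in> Y \<and> u \<noteq> v \<and> E v u" if "E u v" for u v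
    using g that unfolding graph_on_def by auto
  have m: "card {w. E u w \<and> E v w} = s" if "u \<in> Y" "v \<in> Y" "u \<noteq> v" "\<not> E u v" for u v
  proof -
    have "v \<in> nbhd2 Y E u" using d that unfolding nbhd2_def diam_le2_def by auto
    from n2[OF that(1) this] show ?thesis
      unfolding nbhd1_def by (rule arg_cong[where f=card, THEN trans, rotated]) (auto dest: ein)
  qed
  show srg: "srg Y E s"
  proof
    show "card {w. E u w} = 2 * s" if "u \<in> Y" for u
      using n1[OF that] unfolding nbhd1_def by (rule arg_cong[where f=card, THEN trans, rotated]) (auto dest: ein)
    show "card {w. E u w \<and> E v w} = 1" if "E u v" for u v
      using tr[OF _ _ that] ein[OF that] by (smt (verit) Collect_cong ein)
    show "card Y = 6 * s - 3" using c sb sp by simp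
  qed (use g sp m in \<open>auto simp: graph_on_def\<close>)
  show "sb = 2 * s - 2" by fact
  show "srg.far Y E y = nbhd2 Y E y" if "y \<in> Y" for y
    using d that unfolding srg.far_def[OF srg] nbhd2_def diam_le2_def by auto
qed

lemma srg_imp_extensible:
  assumes "srg Y E s" shows "extensible Y E 1 s (2 * s - 2)"
proof -
  interpret srg Y E s by fact
  have n1: "nbhd1 Y E y = {w. E y w}" for y unfolding nbhd1_def by (auto dest: E_in)
  have com: "\<exists>w\<in>Y. E u w \<and> E w v" if "u \<in> Y" "v \<in> Y" "u \<noteq> v" "\<not> E u v" for u v
  proof -
    have "{w. E u w \<and> E v w} \<noteq> {}" using mu[OF that] s_pos by (metis card.empty less_irrefl)
    then show ?thesis using E_sym E_in by blast
  qed
  have n2: "nbhd2 Y E y = far y" if "y \<in> Y" for y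
    using com that unfolding nbhd2_def far_def by auto
  \<comment> \<open>A neighbour of z is far from y, adjacent to y, or y itself. The counts towards
    far points therefore follow from the degree 2 s by subtraction.\<close>
  have split: "card {w. E z w} = card ({w. E z w} \<inter> far y) + card ({w. E z w} \<inter> {w. E y w}) + (if E z y then 1 else 0)" for y z
  proof -
    have eq: "{w. E z w} = (({w. E z w} \<inter> far y) \<union> ({w. E z w} \<inter> {w. E y w})) \<union> (if E z y then {y} else {})"
      unfolding far_def by (auto dest: E_in)
    have "card {w. E z w} = card (({w. E z w} \<inter> far y) \<union> ({w. E z w} \<inter> {w. E y w})) + card (if E z y then {y} else {})"
      by (subst eq, rule card_Un_disjoint) (auto simp: finite_nbrs' finite_far E_irrefl far_def)
    also have "card (({w. E z w} \<inter> far y) \<union> ({w. E z w} \<inter> {w. E y w})) = card ({w. E z w} \<inter> far y) + card ({w. E z w} \<inter> {w. E y w})"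
      by (rule card_Un_disjoint) (auto simp: finite_nbrs' far_def)
    finally show ?thesis by simp
  qed
  have c1: "card ({w. E z w} \<inter> {w. E y w}) = 1" if "E y z" for y z
    using lambda[OF that] by (simp add: Collect_conj_eq Int_commute)
  have c2: "card ({w. E z w} \<inter> {w. E y w}) = s" if "y \<in> Y" "z \<in> far y" for y z
    using mu[of y z] that farD[OF that(2)] by (auto simp: Collect_conj_eq Int_commute)
  show ?thesis
    unfolding extensible_def n1
  proof (intro conjI ballI)
    show "graph_on Y E" unfolding graph_on_def using finite_Y E_in E_sym E_irrefl by blast
    show "diam_le2 Y E" unfolding diam_le2_def using com by blast
    show "card Y = 1 + 2 * s + 2 * (2 * s - 2)" using card_Y s_pos by simp
    show "int 1 = 2 * int s - int (2 * s - 2) - 1" using s_pos by auto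
  next
    fix y assume y: "y \<in> Y"
    show "card {w. E y w} = 2 * s" by (rule degree[OF y])
    show "card (nbhd2 Y E y) = 2 * (2 * s - 2)" using card_far[OF y] n2[OF y] by simp
    fix z
    show "card ({w. E z w} \<inter> nbhd2 Y E y) = 2 * s - 2" if "z \<in> {w. E y w}"
      using split[of z y] c1[of y z] that degree[of z] E_in[of y z] E_sym[of y z] n2[OF y] by simp
    show "card ({w. E z w} \<inter> {w. E y w}) = 1" if "z \<in> {w. E y w}" using c1 that by blast
    assume "z \<in> nbhd2 Y E y"
    then have z: "z \<in> far y" using n2[OF y] by simp
    show "card ({w. E z w} \<inter> {w. E y w}) = s" using c2[OF y z] .
    show "card ({w. E z w} \<inter> nbhd2 Y E y) = s"
      using split[of z y] c2[OF y z] degree[of z] farD[OF z] n2[OF y] by simp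
  next
    fix u v assume "u \<in> Y" "v \<in> Y"
    show "E u v \<longrightarrow> card {w \<in> Y. E u w \<and> E v w} = 1"
      using lambda[of u v] by (smt (verit) Collect_cong E_in)
  qed
qed


section \<open>Coordinates with respect to a frame\<close>

definition tog :: "'i \<Rightarrow> 'i set \<Rightarrow> 'i set" where
  "tog i I = (if i \<in> I then I - {i} else insert i I)"

text \<open>The point z is the origin of the coordinates, and a selects on each line through y the
  point that is to carry the sign False.\<close>

locale frame = srg +
  fixes y z :: 'a and a :: "nat \<Rightarrow> 'a"
  assumes y_in: "y \<in> Y" and z_far: "z \<in> far y"
    and bij_a: "bij_betw a {..<s} {w. E y w \<and> E z w}"
begin

definition b :: "nat \<Rightarrow> 'a" where "b i = third y (a i)"

definition sg :: "nat \<Rightarrow> 'a \<Rightarrow> bool" where "sg i w = E w (b i)"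

definition c :: "nat \<Rightarrow> 'a \<Rightarrow> 'a" where "c i w = (if sg i w then b i else a i)"

text \<open>The default value w makes the steps commute as total functions, which folding them over
  a set of lines requires.\<close>

definition step :: "nat \<Rightarrow> 'a \<Rightarrow> 'a" where
  "step i w = (if i < s \<and> w \<in> far y then third w (c i w) else w)"

definition P :: "nat set \<Rightarrow> 'a" where "P I = Finite_Set.fold step z I"

lemma a_adj: assumes "i < s" shows "E y (a i)" "E z (a i)"
  using bij_betw_apply[OF bij_a, of i] assms by auto

lemma a_eq_iff: "i < s \<Longrightarrow> j < s \<Longrightarrow> a i = a j \<longleftrightarrow> i = j"
  using bij_a unfolding bij_betw_def inj_on_def by auto

lemma b_adj: assumes "i < s" shows "E y (b i)" "E (a i) (b i)" "\<not> E z (b i)"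
  using third_adj[OF a_adj(1)[OF assms]] far_line[OF y_in z_far a_adj(1)[OF assms]] a_adj(2)[OF assms]
  unfolding b_def by auto

lemma third_y_b: "i < s \<Longrightarrow> third y (b i) = a i"
  unfolding b_def using third_third a_adj by auto

lemma b_eq_iff: "i < s \<Longrightarrow> j < s \<Longrightarrow> b i = b j \<longleftrightarrow> i = j"
  using third_y_b a_eq_iff by metis

lemma a_neq_b: "i < s \<Longrightarrow> j < s \<Longrightarrow> a i \<noteq> b j"
  using a_adj b_adj by metis

lemma nbr_cases: assumes "E y u" obtains i where "i < s" "u = a i" | i where "i < s" "u = b i"
proof -
  have im: "a ` {..<s} = {w. E y w \<and> E z w}" using bij_a by (rule bij_betw_imp_surj_on)
  show thesis
  proof (cases "E z u")
    case True
    then show thesis using im assms that by auto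
  next
    case False
    then have "E z (third y u)" using far_line[OF y_in z_far assms] by simp
    then have "third y u \<in> a ` {..<s}" using im third_adj[OF assms] by auto
    then show thesis using that third_third[OF assms] unfolding b_def by auto
  qed
qed

lemma far_a: "w \<in> far y \<Longrightarrow> i < s \<Longrightarrow> E w (a i) \<longleftrightarrow> \<not> sg i w"
  using far_line[OF y_in _ a_adj(1)] unfolding sg_def b_def by blast

lemma c_adj: assumes "w \<in> far y" "i < s" shows "E w (c i w)" "E y (c i w)"
  using assms far_a a_adj b_adj unfolding c_def sg_def by auto

lemma c_inj: "c i w = c j v \<Longrightarrow> i < s \<Longrightarrow> j < s \<Longrightarrow> i = j"
  using a_eq_iff b_eq_iff a_neq_b unfolding c_def by metis

lemma c_eq_iff: "i < s \<Longrightarrow> c i w = c i v \<longleftrightarrow> sg i w = sg i v"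
  using a_neq_b unfolding c_def by metis

lemma common_nbr_y: assumes "E y t" "E w t" "w \<in> far y" obtains i where "i < s" "t = c i w"
  using nbr_cases[OF assms(1)] far_a[OF assms(3)] assms(2) that unfolding c_def sg_def by metis

text \<open>Let u be the third point on the line through w and \<open>c i w\<close>. If u were
  adjacent to y, then w would be adjacent to both points of the line y, \<open>c i w\<close>, u
  other than y. On line i the point u keeps the meeting point of w; on any other line a common
  meeting point would be a second third point of the edge from w to u. Hence exactly the other signs
  flip.\<close>

lemma step: assumes w: "w \<in> far y" and i: "i < s"
  shows step_far: "step i w \<in> far y" and step_adj: "E w (step i w)"
    and sg_step: "j < s \<Longrightarrow> sg j (step i w) \<longleftrightarrow> (if j = i then sg j w else \<not> sg j w)"
    and step_step: "step i (step i w) = w"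
proof -
  define u where "u = third w (c i w)"
  have su: "step i w = u" unfolding step_def u_def using w i by simp
  note ca = c_adj[OF w i]
  have wu: "E w u" "E (c i w) u" unfolding u_def using third_adj[OF ca(1)] by auto
  have "\<not> E y u"
  proof
    assume "E y u"
    then have "u = third y (c i w)" using third_eq[OF ca(2)] wu by auto
    then show False using far_line[OF y_in w ca(2)] wu ca by auto
  qed
  then have uf: "u \<in> far y" using wu E_in farD[OF w] E_sym unfolding far_def by blast
  have ci: "c i u = c i w"
    using wu(2) ca(2) uf far_a[OF uf i] i E_sym unfolding c_def sg_def by (metis far_a sg_def uf)
  show "step i w \<in> far y" "E w (step i w)" using su uf wu by auto
  show "sg j (step i w) \<longleftrightarrow> (if j = i then sg j w else \<not> sg j w)" if j: "j < s"
  proof (cases "j = i")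
    case True then show ?thesis using ci su c_eq_iff i by auto
  next
    case False
    have "sg j u \<noteq> sg j w"
    proof
      assume "sg j u = sg j w"
      then have "c j u = c j w" using c_eq_iff j by simp
      then have "E u (c j w)" "E w (c j w)" using c_adj[OF uf j] c_adj[OF w j] by auto
      then have "c j w = c i w" using third_eq[of w u] wu ca E_sym by metis
      then show False using c_inj False i j by metis
    qed
    then show ?thesis using False su by auto
  qed
  have "third u (c i u) = w" unfolding ci using wu ca E_sym by (intro third_eq) auto
  then show "step i (step i w) = w" unfolding su unfolding step_def using uf i by simp
qed

text \<open>The quadrangle axiom is applied with base w: as y is far from w, exactly one of u and
  \<open>third w u\<close> is adjacent to y, and u is not. So every edge between far points comes
  from a step.\<close>

lemma far_adj_cases: assumes "w \<in> far y" "u \<in> far y" "E w u" obtains i where "i < s" "u = step i w"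
proof -
  have "E y (third w u)"
    using far_line[of w y u] far_sym[OF y_in assms(1)] assms farD by blast
  then obtain i where i: "i < s" "third w u = c i w"
    using common_nbr_y[of "third w u" w] third_adj[OF assms(3)] assms(1) by auto
  then have "u = step i w" unfolding step_def using assms third_third by metis
  then show thesis using that i by auto
qed

lemma step_inj: "w \<in> far y \<Longrightarrow> i < s \<Longrightarrow> j < s \<Longrightarrow> step i w = step j w \<Longrightarrow> i = j"
  using sg_step by metis

text \<open>A triangle would arise whose third point over the edge from w to \<open>step i w\<close>
  is \<open>c i w\<close>, a neighbour of y, whereas a step stays far from y.\<close>

lemma step_step_not_adj: assumes "w \<in> far y" "i < s" "j < s" "i \<noteq> j"
  shows "\<not> E w (step j (step i w))"
proof
  assume h: "E w (step j (step i w))"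
  let ?u = "step i w"
  have u: "?u \<in> far y" "E w ?u" using step_far step_adj assms by auto
  have v: "step j ?u \<in> far y" "E ?u (step j ?u)" using step_far step_adj assms u by auto
  have "c i ?u = c i w" using c_eq_iff sg_step assms by auto
  then have "E ?u (c i w)" "E w (c i w)" "E y (c i w)" using c_adj[OF u(1) assms(2)] c_adj[OF assms(1,2)] by auto
  then have "step j ?u = c i w" using third_eq[OF u(2)] h v by metis
  then show False using v farD \<open>E y (c i w)\<close> by auto
qed

lemma step_neq_step_step: "w \<in> far y \<Longrightarrow> i < s \<Longrightarrow> j < s \<Longrightarrow> k < s \<Longrightarrow> i \<noteq> j \<Longrightarrow> step k w \<noteq> step j (step i w)"
  using step_step_not_adj step_adj by metis

text \<open>The points \<open>w\<close> and \<open>step j (step i w)\<close> have \<open>s - 2\<close> common neighbours on the lines through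
  \<open>y\<close>, hence exactly two others, which can only be \<open>step i w\<close> and \<open>step j w\<close>.\<close>

lemma step_commute: assumes w: "w \<in> far y" and i: "i < s" and j: "j < s"
  shows "step i (step j w) = step j (step i w)"
proof (cases "i = j")
  case ij: False
  define v where "v = step j (step i w)"
  have u: "step i w \<in> far y" "E w (step i w)" and u': "step j w \<in> far y" "E w (step j w)"
    using step_far step_adj w i j by auto
  have v: "v \<in> far y" unfolding v_def using step_far u j by auto
  have sgv: "sg k v \<longleftrightarrow> (if k = i \<or> k = j then \<not> sg k w else sg k w)" if "k < s" for k
    unfolding v_def using sg_step[OF u(1) j that] sg_step[OF w i that] ij by auto
  have vw: "v \<noteq> w" using sgv[OF i] by auto
  have nadj: "\<not> E w v" unfolding v_def using step_step_not_adj w i j ij by auto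
  define K where "K = {t. E w t \<and> E v t}"
  have finK: "finite K" unfolding K_def by (rule finite_nbrs)
  have cK: "card K = s" unfolding K_def using mu[of w v] farD w v vw nadj by blast
  \<comment> \<open>The signs of w and v differ exactly at i and j, so w and v meet the remaining s
    - 2 lines in the same points.\<close>
  have Ky: "K \<inter> {t. E y t} = (\<lambda>k. c k w) ` ({..<s} - {i,j})"
  proof (intro equalityI subsetI)
    fix t assume t: "t \<in> K \<inter> {t. E y t}"
    then obtain k where k: "k < s" "t = c k w" using common_nbr_y[of t w] w unfolding K_def by auto
    obtain l where l: "l < s" "t = c l v" using common_nbr_y[of t v] v t unfolding K_def by auto
    have "k = l" using c_inj k l by metis
    then have "k \<notin> {i,j}" using sgv c_eq_iff k l by auto
    then show "t \<in> (\<lambda>k. c k w) ` ({..<s} - {i,j})" using k by auto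
  next
    fix t assume "t \<in> (\<lambda>k. c k w) ` ({..<s} - {i,j})"
    then obtain k where k: "k < s" "k \<noteq> i" "k \<noteq> j" "t = c k w" by auto
    then have "c k v = c k w" using sgv c_eq_iff by auto
    then show "t \<in> K \<inter> {t. E y t}" using c_adj[OF w k(1)] c_adj[OF v k(1)] k(4) unfolding K_def by auto
  qed
  have "card (K \<inter> {t. E y t}) = s - 2"
    unfolding Ky using c_inj i j ij by (subst card_image) (auto simp: inj_on_def card_Diff_subset)
  moreover have "2 \<le> s" using i j ij by linarith
  ultimately have c2: "card (K - {t. E y t}) = 2" using cK card_Diff_subset_Int[of K "{t. E y t}"] finK by simp
  have sub: "K - {t. E y t} \<subseteq> {step i w, step j w}"
  proof
    fix t assume t: "t \<in> K - {t. E y t}"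
    then have tf: "t \<in> far y" using farD[OF w] E_in unfolding K_def far_def by auto
    obtain k where k: "k < s" "t = step k w" using far_adj_cases[OF w tf] t unfolding K_def by auto
    obtain l where l: "l < s" "v = step l t" using far_adj_cases[OF tf v] t E_sym unfolding K_def by auto
    have "l \<noteq> k" using k l vw step_step[OF w] by auto
    \<comment> \<open>The first step keeps the k-th sign and the second one flips it, so k is one of
      the two lines on which w and v differ.\<close>
    then have "sg k v \<longleftrightarrow> \<not> sg k w" using k l sg_step[OF tf l(1) k(1)] sg_step[OF w k(1) k(1)] by auto
    then show "t \<in> {step i w, step j w}" using sgv[OF k(1)] k by (auto split: if_splits)
  qed
  have "step i w \<noteq> step j w" using step_inj[OF w i j] ij by blast
  then have "K - {t. E y t} = {step i w, step j w}"
    using sub c2 by (intro card_subset_eq) simp_all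
  then have "E v (step j w)" unfolding K_def by auto
  then obtain l where l: "l < s" "v = step l (step j w)"
    using far_adj_cases[OF u'(1) v] E_sym by auto
  \<comment> \<open>The point \<open>step j w\<close> already has the i-th sign of v, so the last
    step must be the one that keeps this sign.\<close>
  have "l = i"
    using sgv[OF i] sg_step[OF u'(1) l(1) i] sg_step[OF w j i] ij l by (auto split: if_splits)
  then show ?thesis using l v_def by simp
qed auto

text \<open>Three vertices of a square in the far graph determine the fourth. Along the path through
  \<open>step j w\<close> the j-th sign flips exactly once, and the path through
  \<open>step i w\<close> agrees only if its last step is the j-th one. Automorphisms of the far
  graph are propagated this way.\<close>

lemma common_far_nbr: assumes w: "w \<in> far y" and "i < s" "j < s" "i \<noteq> j"
  and t: "t \<in> far y" "E (step i w) t" "E (step j w) t" "t \<noteq> w"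
  shows "t = step i (step j w)"
proof -
  have u: "step i w \<in> far y" "step j w \<in> far y" using step_far assms by auto
  obtain k where k: "k < s" "t = step k (step i w)" using far_adj_cases[OF u(1) t(1,2)] .
  obtain l where l: "l < s" "t = step l (step j w)" using far_adj_cases[OF u(2) t(1,3)] .
  have "k \<noteq> i" "l \<noteq> j" using k l t step_step[OF w] assms by auto
  then have "k = j"
    using sg_step[OF u(1) k(1), of j] sg_step[OF u(2) l(1), of j] sg_step[OF w assms(2), of j]
      sg_step[OF w assms(3), of j] assms k l by (auto split: if_splits)
  then show ?thesis using k step_commute[OF w] assms by auto
qed

section \<open>Sets of lines as coordinates of the far points\<close>

lemma step_comp_fun_commute: "comp_fun_commute_on {..<s} step"
proof
  fix i j assume "i \<in> {..<s}" "j \<in> {..<s}"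
  moreover have "step j (step i w) = step i (step j w)" if "w \<notin> far y" for w
    using that unfolding step_def by auto
  ultimately show "step j \<circ> step i = step i \<circ> step j"
    using step_commute by (auto simp: fun_eq_iff)
qed

lemma P_empty: "P {} = z" unfolding P_def by simp

lemma P_insert: "\<lbrakk>I \<subseteq> {..<s}; i < s; i \<notin> I\<rbrakk> \<Longrightarrow> P (insert i I) = step i (P I)"
  unfolding P_def
  by (rule comp_fun_commute_on.fold_insert[OF step_comp_fun_commute]) (auto intro: finite_subset)

text \<open>The parity arises because a step on line \<open>i\<close> changes the point met on every line except the \<open>i\<close>-th.\<close>

lemma P_far_sg: assumes "I \<subseteq> {..<s}"
  shows P_far: "P I \<in> far y" and sg_P: "j < s \<Longrightarrow> sg j (P I) \<longleftrightarrow> (j \<in> I) \<noteq> odd (card I)"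
proof -
  have "finite I" using assms finite_subset by blast
  then have "P I \<in> far y \<and> (\<forall>j<s. sg j (P I) \<longleftrightarrow> (j \<in> I) \<noteq> odd (card I))" using assms
  proof (induction I rule: finite_induct)
    case empty
    then show ?case using P_empty z_far b_adj unfolding sg_def by auto
  next
    case (insert i I)
    then show ?case using P_insert[of I i] step_far[of "P I" i] sg_step[of "P I" i] by auto
  qed
  then show "P I \<in> far y" "j < s \<Longrightarrow> sg j (P I) \<longleftrightarrow> (j \<in> I) \<noteq> odd (card I)" by auto
qed

lemma step_P: assumes "I \<subseteq> {..<s}" "i < s" shows "step i (P I) = P (tog i I)"
proof (cases "i \<in> I")
  case True
  then have "P I = step i (P (I - {i}))" using P_insert[of "I - {i}" i] assms by (auto simp: insert_absorb)
  moreover have "P (I - {i}) \<in> far y" using P_far[of "I - {i}"] assms by auto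
  ultimately show ?thesis using step_step[of "P (I - {i})" i] assms True unfolding tog_def by auto
qed (use P_insert assms in \<open>auto simp: tog_def\<close>)

text \<open>The signs determine the set once the parity of its size is known, and a change of parity
  replaces it by its complement. Complementary sets with sizes of different parity exist only for
  odd s.\<close>

lemma P_eq_cases: assumes "I \<subseteq> {..<s}" "J \<subseteq> {..<s}" "P I = P J"
  shows "I = J \<or> J = {..<s} - I \<and> odd s"
proof (cases "odd (card I) = odd (card J)")
  case True
  have "j \<in> I \<longleftrightarrow> j \<in> J" if "j < s" for j
    using sg_P[OF assms(1) that] sg_P[OF assms(2) that] assms(3) True by metis
  then have "I = J" using assms by auto
  then show ?thesis by simp
next
  case False
  have "j \<in> I \<longleftrightarrow> j \<notin> J" if "j < s" for j
    using sg_P[OF assms(1) that] sg_P[OF assms(2) that] assms(3) False by metis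
  then have J: "J = {..<s} - I" using assms by auto
  have fin: "finite I" using assms finite_subset by blast
  have "card J = s - card I" "card I \<le> s"
    using J assms fin card_mono[OF _ assms(1)] by (auto simp: card_Diff_subset)
  then have "odd s" using False by auto
  then show ?thesis using J by simp
qed

lemma P_image_far: "n \<le> s \<Longrightarrow> P ` Pow {..<n} \<subseteq> far y" using P_far by (auto dest!: order_trans[of _ "{..<n}" "{..<s}"])

text \<open>Under either condition no colliding complementary pair is possible: some index below s
  is missing from both sets, or s is even.\<close>

lemma inj_P: assumes "n < s \<or> (n = s \<and> even s)" shows "inj_on P (Pow {..<n})"
proof (rule inj_onI)
  fix I J assume IJ: "I \<in> Pow {..<n}" "J \<in> Pow {..<n}" "P I = P J"
  then have "I \<subseteq> {..<s}" "J \<subseteq> {..<s}" using assms by force+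
  from P_eq_cases[OF this IJ(3)] show "I = J"
  proof
    assume "J = {..<s} - I \<and> odd s"
    then have "n < s" "n \<in> I \<or> n \<in> J" using assms by auto
    then show ?thesis using IJ by auto
  qed
qed

lemma two_power_le: assumes "n < s \<or> (n = s \<and> even s)" shows "2 ^ n \<le> 4 * s - 4"
proof -
  have "n \<le> s" using assms by auto
  then have "card (P ` Pow {..<n}) \<le> card (far y)" by (intro card_mono finite_far P_image_far)
  then show ?thesis using card_image[OF inj_P[OF assms]] card_far[OF y_in] by (simp add: card_Pow)
qed

text \<open>For s = 1 there is no far point to serve as z; s = 4 would put 16 distinct points among
  12; from s = 6 on, 2^(s-1) exceeds 4 s - 4.\<close>

lemma s_cases: "s \<in> {2, 3, 5}"
proof -
  have far: "far y \<noteq> {}" using z_far by auto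
  then have "s \<noteq> 1" using card_far[OF y_in] finite_far[of y] by auto
  moreover have "s \<noteq> 4" using two_power_le[of 4] by auto
  moreover have "s < 6"
  proof (rule ccontr)
    assume "\<not> s < 6"
    then obtain k where k: "s = k + 6" by (metis add.commute le_Suc_ex not_less)
    have "4 * k + 20 < 2 ^ (k + 5)" by (induction k) (auto simp: power_add)
    then show False using two_power_le[of "k + 5"] k by auto
  qed
  ultimately show ?thesis using s_pos by auto
qed

text \<open>Chosen so that 2^n = 4 s - 4 for s = 2, 3, 5.\<close>

definition n :: nat where "n = (if s = 5 then 4 else s)"

lemma n_le_s: "n \<le> s" unfolding n_def using s_cases by auto

text \<open>Only s = 3 is left open by \<open>inj_P\<close>: all lines are used and their number is
  odd. A collision of {i} with {j, k} would make a point two steps away from z adjacent to z, and a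
  collision of the empty with the full set reduces to this case by one more step.\<close>

lemma inj_P_n: "inj_on P (Pow {..<n})"
proof (cases "s = 3")
  case True
  have neq: "P {i} \<noteq> P {j, k}" if "j \<noteq> k" "i < 3" "j < 3" "k < 3" for i j k
    using P_insert[of "{}" i] P_insert[of "{k}" j] P_insert[of "{}" k] that True P_empty
      step_neq_step_step[OF z_far, of k j i] by auto
  have neq0: "P {} \<noteq> P {0,1,2}"
  proof
    assume "P {} = P {0,1,2}"
    then have "step 0 (P {}) = step 0 (P {0,1,2})" by simp
    then have "P {0} = P {1,2}" using step_P[of "{}" 0] step_P[of "{0,1,2}" 0] True by (simp add: tog_def)
    then show False using neq[of 1 2 0] by simp
  qed
  have three: "{..<s} = {0,1,2}" using True by auto
  show ?thesis
  proof (rule inj_onI)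
    fix I J assume IJ: "I \<in> Pow {..<n}" "J \<in> Pow {..<n}" "P I = P J"
    then have sub: "I \<subseteq> {..<s}" "J \<subseteq> {..<s}" using n_le_s by force+
    have "J = {0,1,2} - I \<Longrightarrow> False"
    proof -
      assume J: "J = {0,1,2} - I"
      have "I \<in> Pow {0,1,2}" using sub three by simp
      then have "I \<in> {{}, {0}, {1}, {2}, {0,1}, {0,2}, {1,2}, {0,1,2}}" by (simp add: Pow_insert) blast
      then show False using IJ(3) J neq0 neq[of 0 1 2] neq[of 0 2 1] neq[of 1 2 0]
        neq0[symmetric] neq[of 0 1 2, symmetric] neq[of 0 2 1, symmetric] neq[of 1 2 0, symmetric]
        by (elim insertE) (auto simp: insert_Diff_if)
    qed
    then show "I = J" using P_eq_cases[OF sub IJ(3)] three by auto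
  qed
next
  case False
  then show ?thesis using s_cases by (intro inj_P) (auto simp: n_def)
qed

lemma P_image: "P ` Pow {..<n} = far y"
  using card_image[OF inj_P_n] card_far[OF y_in] s_cases
  by (intro card_subset_eq finite_far P_image_far n_le_s) (auto simp: card_Pow n_def)

text \<open>Subsets of the first four lines already reach every far point, so the point of a set
  containing 4 has a second name without 4, which can only be the complement. The fifth step is thus
  the antipodal map of the 4-cube, and its edges are the main diagonals.\<close>

lemma P_fold5: assumes "s = 5" "I \<subseteq> {..<4}" shows "P (insert 4 I) = P ({..<4} - I)"
proof -
  have I: "insert 4 I \<subseteq> {..<s}" using assms by auto
  then have "P (insert 4 I) \<in> P ` Pow {..<n}" unfolding P_image by (rule P_far)
  then obtain J where J: "J \<subseteq> {..<4}" "P (insert 4 I) = P J" using assms unfolding n_def by auto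
  moreover have "J \<subseteq> {..<s}" using J assms by force
  ultimately have "insert 4 I = J \<or> J = {..<s} - insert 4 I" using P_eq_cases[OF I] by blast
  moreover have "insert 4 I \<noteq> J" using J by auto
  moreover have "{..<s} - insert 4 I = {..<4} - I" using assms by auto
  ultimately show ?thesis using J by auto
qed

lemma P_adj: assumes "I \<subseteq> {..<n}" "J \<subseteq> {..<n}"
  shows "E (P I) (P J) \<longleftrightarrow> (\<exists>i<n. J = tog i I) \<or> (s = 5 \<and> J = {..<4} - I)"
proof -
  have sub: "I \<subseteq> {..<s}" "J \<subseteq> {..<s}" using assms n_le_s by force+
  note Pf = P_far[OF sub(1)] P_far[OF sub(2)]
  have tg: "tog i I \<subseteq> {..<n}" if "i < n" for i using assms(1) that unfolding tog_def by auto
  have eqP: "P J = P K \<longleftrightarrow> J = K" if "K \<subseteq> {..<n}" for K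
    using inj_P_n assms that unfolding inj_on_def by auto
  have "E (P I) (P J) \<longleftrightarrow> (\<exists>i<s. P J = step i (P I))"
    using far_adj_cases[OF Pf] step_adj[OF Pf(1)] by metis
  also have "\<dots> \<longleftrightarrow> (\<exists>i<s. P J = P (tog i I))" using step_P[OF sub(1)] by auto
  also have "\<dots> \<longleftrightarrow> (\<exists>i<n. P J = P (tog i I)) \<or> (s = 5 \<and> P J = P (tog 4 I))"
  proof (cases "s = 5")
    case True
    then show ?thesis unfolding n_def by (auto simp: less_Suc_eq numeral_eq_Suc)
  qed (auto simp: n_def)
  also have "\<dots> \<longleftrightarrow> (\<exists>i<n. J = tog i I) \<or> (s = 5 \<and> J = {..<4} - I)"
  proof -
    have "s = 5 \<Longrightarrow> P (tog 4 I) = P ({..<4} - I)" using P_fold5 assms(1) unfolding n_def tog_def by auto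
    moreover have "s = 5 \<Longrightarrow> {..<4} - I \<subseteq> {..<n}" unfolding n_def by auto
    ultimately show ?thesis using eqP tg by metis
  qed
  finally show ?thesis .
qed

end


section \<open>Rigidity of frames\<close>

text \<open>\<open>Top\<close> stands for y, \<open>Pt False i\<close> and \<open>Pt True i\<close>
  for the points \<open>a i\<close> and \<open>b i\<close>, and \<open>Sub I\<close> for
  \<open>P I\<close>. The model adjacency depends on s alone, so frames in different graphs can be
  compared through it.\<close>

datatype mvert = Top | Pt bool nat | Sub "nat set"

fun madj :: "nat \<Rightarrow> mvert \<Rightarrow> mvert \<Rightarrow> bool" where
  "madj s Top (Pt \<beta> i) = True"
| "madj s (Pt \<beta> i) Top = True"
| "madj s (Pt \<beta> i) (Pt \<gamma> j) = (i = j \<and> \<beta> \<noteq> \<gamma>)"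
| "madj s (Pt \<beta> i) (Sub I) = (\<beta> = ((i \<in> I) \<noteq> odd (card I)))"
| "madj s (Sub I) (Pt \<beta> i) = (\<beta> = ((i \<in> I) \<noteq> odd (card I)))"
| "madj s (Sub I) (Sub J) = ((\<exists>i < (if s = 5 then 4 else s). J = tog i I) \<or> (s = 5 \<and> J = {..<4} - I))"
| "madj s _ _ = False"

definition mverts :: "nat \<Rightarrow> mvert set" where
  "mverts s = {Top} \<union> case_prod Pt ` (UNIV \<times> {..<s}) \<union> Sub ` Pow {..<(if s = 5 then 4 else s)}"

context frame begin

fun \<Phi> :: "mvert \<Rightarrow> 'a" where
  "\<Phi> Top = y"
| "\<Phi> (Pt \<beta> i) = (if \<beta> then b i else a i)"
| "\<Phi> (Sub I) = P I"

lemma mverts_n: "mverts s = {Top} \<union> case_prod Pt ` (UNIV \<times> {..<s}) \<union> Sub ` Pow {..<n}"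
  unfolding mverts_def n_def ..

lemma lines_not_adj: assumes "i < s" "j < s" "i \<noteq> j"
  shows "\<not> E (if \<beta> then b i else a i) (if \<gamma> then b j else a j)"
proof
  let ?u = "if \<beta> then b i else a i" and ?v = "if \<gamma> then b j else a j"
  assume "E ?u ?v"
  then have "third y ?u = ?v" using a_adj b_adj assms by (intro third_eq) auto
  moreover have "third y ?u = (if \<beta> then a i else b i)" using assms third_y_b unfolding b_def by auto
  ultimately show False using a_eq_iff b_eq_iff a_neq_b assms by (auto split: if_splits) metis+
qed

lemma P_sub: "I \<subseteq> {..<n} \<Longrightarrow> I \<subseteq> {..<s}" using n_le_s by force

lemma \<Phi>_adj: assumes "p \<in> mverts s" "q \<in> mverts s" shows "E (\<Phi> p) (\<Phi> q) \<longleftrightarrow> madj s p q"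
proof -
  have PS: "E (P I) (if \<beta> then b i else a i) \<longleftrightarrow> (\<beta> = ((i \<in> I) \<noteq> odd (card I)))" if "I \<subseteq> {..<n}" "i < s" for \<beta> i I
    using sg_P[OF P_sub[OF that(1)] that(2)] far_a[OF P_far[OF P_sub[OF that(1)]] that(2)] unfolding sg_def by auto
  have PS': "E (if \<beta> then b i else a i) (P I) \<longleftrightarrow> (\<beta> = ((i \<in> I) \<noteq> odd (card I)))" if "I \<subseteq> {..<n}" "i < s" for \<beta> i I
    using PS[OF that] E_sym by blast
  have yP: "\<not> E y (P I)" "\<not> E (P I) y" if "I \<subseteq> {..<n}" for I
    using farD[OF P_far[OF P_sub[OF that]]] by auto
  have ab: "E (if \<beta> then b i else a i) (if \<gamma> then b j else a j) \<longleftrightarrow> i = j \<and> \<beta> \<noteq> \<gamma>" if "i < s" "j < s" for i j \<beta> \<gamma>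
    using lines_not_adj[OF that] b_adj(2)[OF that(1)] E_sym[OF b_adj(2)[OF that(1)]] E_irrefl by (cases "i = j") auto
  have ya: "E y (if \<beta> then b i else a i)" "E (if \<beta> then b i else a i) y" if "i < s" for i \<beta>
    using a_adj(1)[OF that] b_adj(1)[OF that] E_sym[OF a_adj(1)[OF that]] E_sym[OF b_adj(1)[OF that]] by auto
  have PP: "E (P I) (P J) \<longleftrightarrow> madj s (Sub I) (Sub J)" if "I \<subseteq> {..<n}" "J \<subseteq> {..<n}" for I J
    using P_adj[OF that] unfolding n_def by simp
  have c: "p' = Top \<or> (\<exists>\<beta> i. p' = Pt \<beta> i \<and> i < s) \<or> (\<exists>I. p' = Sub I \<and> I \<subseteq> {..<n})" if "p' \<in> mverts s" for p'
    using that unfolding mverts_n by auto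
  from c[OF assms(1)] show ?thesis
  proof (elim disjE exE conjE)
    assume p: "p = Top"
    from c[OF assms(2)] show ?thesis
      by (elim disjE exE conjE) (simp_all add: p ya yP E_irrefl del: if_split)
  next
    fix \<beta> i assume p: "p = Pt \<beta> i" "i < s"
    from c[OF assms(2)] show ?thesis
      by (elim disjE exE conjE) (simp_all add: p ya PS' ab del: if_split)
  next
    fix I assume p: "p = Sub I" "I \<subseteq> {..<n}"
    from c[OF assms(2)] show ?thesis
      by (elim disjE exE conjE) (simp_all add: p yP PS PP del: if_split madj.simps(6))
  qed
qed

lemma bij_\<Phi>: "bij_betw \<Phi> (mverts s) Y"
  unfolding bij_betw_def
proof
  show "\<Phi> ` mverts s = Y"
  proof (intro equalityI subsetI)
    fix u assume "u \<in> \<Phi> ` mverts s"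
    then obtain p where p: "p \<in> mverts s" "u = \<Phi> p" by blast
    have "E y (\<Phi> (Pt \<beta> i))" if "i < s" for \<beta> i using a_adj(1)[OF that] b_adj(1)[OF that] by simp
    moreover have "P I \<in> Y" if "I \<subseteq> {..<n}" for I using P_far[OF P_sub[OF that]] farD by blast
    moreover have "p = Top \<or> (\<exists>\<beta> i. p = Pt \<beta> i \<and> i < s) \<or> (\<exists>I. p = Sub I \<and> I \<subseteq> {..<n})"
      using p(1) unfolding mverts_n by auto
    ultimately show "u \<in> Y" using p(2) y_in E_in \<Phi>.simps(1,3) by metis
  next
    fix u assume u: "u \<in> Y"
    consider "u = y" | "E y u" | "u \<in> far y" using u unfolding far_def by auto
    then show "u \<in> \<Phi> ` mverts s"
    proof cases
      case 1 then show ?thesis unfolding mverts_n by force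
    next
      case 2
      then obtain \<beta> i where "i < s" "u = \<Phi> (Pt \<beta> i)" using nbr_cases by (metis \<Phi>.simps(2))
      then show ?thesis unfolding mverts_n by blast
    next
      case 3
      then obtain I where "I \<subseteq> {..<n}" "u = \<Phi> (Sub I)" using P_image by auto
      then show ?thesis unfolding mverts_n by blast
    qed
  qed
  have "card (case_prod Pt ` ((UNIV :: bool set) \<times> {..<s})) = 2 * s"
    by (subst card_image) (auto simp: inj_on_def card_cartesian_product)
  moreover have "card (Sub ` Pow {..<n}) = 2 ^ n" by (subst card_image) (auto simp: inj_on_def card_Pow)
  ultimately have "card (mverts s) = 1 + 2 * s + 2 ^ n"
    unfolding mverts_n by (subst card_Un_disjoint; (subst card_Un_disjoint)?) auto
  \<comment> \<open>The sum is 9, 15, 27 for s = 2, 3, 5. Equal cardinalities turn surjectivity into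
    injectivity.\<close>
  also have "\<dots> = card Y" unfolding card_Y n_def using s_cases by auto
  finally show "inj_on \<Phi> (mverts s)"
    using \<open>\<Phi> ` mverts s = Y\<close> finite_Y s_pos by (intro eq_card_imp_inj_on) (auto simp: mverts_n)
qed

end

text \<open>Passing through the common model matches the two frames, because their points are the
  images of \<open>Top\<close>, \<open>Sub {}\<close> and \<open>Pt False i\<close>.\<close>

lemma frame_iso:
  assumes "frame Y E s y z a" "frame Y' E' s y' z' a'"
  obtains \<phi> where "bij_betw \<phi> Y Y'" "\<And>u v. u \<in> Y \<Longrightarrow> v \<in> Y \<Longrightarrow> E' (\<phi> u) (\<phi> v) = E u v"
    "\<phi> y = y'" "\<phi> z = z'" "\<And>i. i < s \<Longrightarrow> \<phi> (a i) = a' i"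
proof -
  interpret F: frame Y E s y z a by fact
  interpret G: frame Y' E' s y' z' a' by fact
  define \<phi> where "\<phi> = G.\<Phi> \<circ> inv_into (mverts s) F.\<Phi>"
  have ap: "\<phi> (F.\<Phi> p) = G.\<Phi> p" if "p \<in> mverts s" for p
    unfolding \<phi>_def using that F.bij_\<Phi> by (simp add: bij_betw_def)
  have bij: "bij_betw \<phi> Y Y'"
    unfolding \<phi>_def using bij_betw_trans[OF bij_betw_inv_into[OF F.bij_\<Phi>] G.bij_\<Phi>] .
  have adj: "E' (\<phi> u) (\<phi> v) = E u v" if uv: "u \<in> Y" "v \<in> Y" for u v
  proof -
    have "u \<in> F.\<Phi> ` mverts s" "v \<in> F.\<Phi> ` mverts s" using F.bij_\<Phi> uv by (auto simp: bij_betw_def)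
    then obtain p q where pq: "p \<in> mverts s" "u = F.\<Phi> p" "q \<in> mverts s" "v = F.\<Phi> q" by blast
    then show ?thesis using ap F.\<Phi>_adj[of p q] G.\<Phi>_adj[of p q] by simp
  qed
  have mem: "Top \<in> mverts s" "Sub {} \<in> mverts s" "\<And>i. i < s \<Longrightarrow> Pt False i \<in> mverts s"
    unfolding mverts_def by force+
  show thesis
  proof (rule that[OF bij adj])
    show "\<phi> y = y'" using ap[OF mem(1)] by simp
    show "\<phi> z = z'" using ap[OF mem(2)] F.P_empty G.P_empty by simp
    show "\<phi> (a i) = a' i" if "i < s" for i using ap[OF mem(3)[OF that]] by simp
  qed
qed

section \<open>Adjacency-preserving maps and frames\<close>

context srg begin

lemma hom_third: assumes "srg Y' E' s'" "\<And>u v. E u v \<Longrightarrow> E' (\<phi> u) (\<phi> v)" "E u v"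
  shows "\<phi> (third u v) = srg.third E' (\<phi> u) (\<phi> v)"
  using srg.third_eq[OF assms(1), of "\<phi> u" "\<phi> v"] third_adj[OF assms(3)] assms by metis

lemma card_common: "y \<in> Y \<Longrightarrow> z \<in> far y \<Longrightarrow> card {w. E y w \<and> E z w} = s"
  using mu farD by metis

lemma frame_of: assumes "y \<in> Y" "z \<in> far y" "l \<in> permutations_of_set {w. E y w \<and> E z w}"
  shows "frame Y E s y z ((!) l)"
proof
  have l: "distinct l" "set l = {w. E y w \<and> E z w}" using assms unfolding permutations_of_set_def by auto
  then have "length l = s" using card_common[OF assms(1,2)] distinct_card[of l] by simp
  then show "bij_betw ((!) l) {..<s} {w. E y w \<and> E z w}" using l by (intro bij_betw_nth) auto
qed fact+

lemma ex_frame: assumes "y \<in> Y" "z \<in> far y" obtains a where "frame Y E s y z a"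
proof -
  have "permutations_of_set {w. E y w \<and> E z w} \<noteq> {}" using finite_nbrs by simp
  then show thesis using frame_of[OF assms] that by blast
qed

end

context frame begin

text \<open>Every point arises from the frame by taking third points repeatedly, and
  adjacency-preserving maps respect third points. The target is a second graph of the same kind, so
  the lemma serves both for automorphisms and for comparing a linear map with an automorphism on the
  quadric.\<close>

lemma rigid: assumes "srg Y' E' s'"
    and \<phi>: "\<And>u v. E u v \<Longrightarrow> E' (\<phi> u) (\<phi> v)" and \<psi>: "\<And>u v. E u v \<Longrightarrow> E' (\<psi> u) (\<psi> v)"
    and eq: "\<phi> y = \<psi> y" "\<phi> z = \<psi> z" "\<And>i. i < s \<Longrightarrow> \<phi> (a i) = \<psi> (a i)" and "u \<in> Y"
  shows "\<phi> u = \<psi> u"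
proof -
  have t: "\<phi> (third v w) = \<psi> (third v w)" if "E v w" "\<phi> v = \<psi> v" "\<phi> w = \<psi> w" for v w
    using hom_third[where \<phi>=\<phi>, OF assms(1) \<phi> that(1)] hom_third[where \<phi>=\<psi>, OF assms(1) \<psi> that(1)] that by simp
  have bb: "\<phi> (b i) = \<psi> (b i)" if "i < s" for i unfolding b_def using t a_adj(1) eq that by auto
  have st: "\<phi> (step i w) = \<psi> (step i w)" if "w \<in> far y" "i < s" "\<phi> w = \<psi> w" for i w
    using that bb eq t c_adj(1)[OF that(1,2)] unfolding step_def c_def by auto
  have PP: "\<phi> (P I) = \<psi> (P I)" if "I \<subseteq> {..<s}" for I
  proof -
    have "finite I" using that finite_subset by blast
    then show ?thesis using that
      by (induction I rule: finite_induct) (auto simp: P_empty eq P_insert intro!: st P_far)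
  qed
  consider "u = y" | "E y u" | "u \<in> far y" using \<open>u \<in> Y\<close> unfolding far_def by auto
  then show ?thesis
  proof cases
    case 2 then show ?thesis using nbr_cases bb eq by metis
  next
    case 3
    then obtain I where "I \<subseteq> {..<n}" "u = P I" using P_image by auto
    then show ?thesis using PP[OF P_sub] by auto
  qed (use eq in auto)
qed

end

section \<open>The automorphism group\<close>

lemma AutI: assumes "bij_betw \<phi> V V" "\<And>u v. u \<in> V \<Longrightarrow> v \<in> V \<Longrightarrow> E (\<phi> u) (\<phi> v) = E u v"
  shows "(\<lambda>u. if u \<in> V then \<phi> u else u) \<in> Aut V E"
proof -
  have "(\<lambda>u. if u \<in> V then \<phi> u else u) permutes V"
    using assms(1) by (intro bij_imp_permutes) (auto cong: bij_betw_cong)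
  then show ?thesis unfolding Aut_def using assms by auto
qed

lemma AutD: assumes "\<phi> \<in> Aut V E"
  shows "\<phi> permutes V" "u \<in> V \<Longrightarrow> v \<in> V \<Longrightarrow> E (\<phi> u) (\<phi> v) = E u v" "u \<in> V \<Longrightarrow> \<phi> u \<in> V"
    "inj \<phi>" "\<phi> ` V = V"
  using assms permutes_in_image[of \<phi> V] permutes_inj[of \<phi> V] permutes_image[of \<phi> V] unfolding Aut_def by auto

context srg begin

lemma Aut_adj: "\<phi> \<in> Aut Y E \<Longrightarrow> E u v \<Longrightarrow> E (\<phi> u) (\<phi> v)"
  using E_in[of u v] AutD(2)[of \<phi> Y E u v] by simp

lemma card_perms_common: assumes "y \<in> Y"
  shows "card (SIGMA z:far y. permutations_of_set {w. E y w \<and> E z w}) = (4 * s - 4) * fact s"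
  by (subst card_SigmaI) (auto simp: finite_far finite_nbrs card_common[OF assms] card_far[OF assms])

end

context frame begin

definition frames :: "('a \<times> 'a \<times> 'a list) set" where
  "frames = (SIGMA y:Y. SIGMA z:far y. permutations_of_set {w. E y w \<and> E z w})"

lemma card_frames: "card frames = card Y * ((4 * s - 4) * fact s)"
proof -
  have fin: "finite (SIGMA z:far y. permutations_of_set {w. E y w \<and> E z w})" for y
    by (intro finite_SigmaI finite_far finite_permutations_of_set)
  have "card frames = (\<Sum>y\<in>Y. card (SIGMA z:far y. permutations_of_set {w. E y w \<and> E z w}))"
    unfolding frames_def using finite_Y fin by (intro card_SigmaI) blast+
  also have "\<dots> = (\<Sum>y\<in>Y. (4 * s - 4) * fact s)" by (intro sum.cong refl card_perms_common)
  finally show ?thesis by simp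
qed

lemma ex_Aut_frame: assumes "y' \<in> Y" "z' \<in> far y'" "l \<in> permutations_of_set {w. E y' w \<and> E z' w}"
  obtains \<phi> where "\<phi> \<in> Aut Y E" "\<phi> y = y'" "\<phi> z = z'" "\<And>i. i < s \<Longrightarrow> \<phi> (a i) = l ! i"
proof -
  obtain \<phi> where \<phi>: "bij_betw \<phi> Y Y" "\<And>u v. u \<in> Y \<Longrightarrow> v \<in> Y \<Longrightarrow> E (\<phi> u) (\<phi> v) = E u v"
    "\<phi> y = y'" "\<phi> z = z'" "\<And>i. i < s \<Longrightarrow> \<phi> (a i) = l ! i"
    using frame_iso[OF frame_axioms frame_of[OF assms]] by blast
  have "(\<lambda>u. if u \<in> Y then \<phi> u else u) \<in> Aut Y E" by (rule AutI) (use \<phi> in auto)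
  then show thesis
    by (rule that) (simp_all add: \<phi>(3-5) y_in farD[OF z_far] E_in[OF a_adj(1)])
qed

text \<open>Injectivity is rigidity and surjectivity is \<open>ex_Aut_frame\<close>. Recording the
  images of the points \<open>a i\<close> as a list turns the order of the group into the number of
  frames.\<close>

lemma Aut_frame_bij: "bij_betw (\<lambda>\<phi>. (\<phi> y, \<phi> z, map (\<lambda>i. \<phi> (a i)) [0..<s])) (Aut Y E) frames"
  unfolding bij_betw_def
proof (intro conjI equalityI subsetI)
  show "inj_on (\<lambda>\<phi>. (\<phi> y, \<phi> z, map (\<lambda>i. \<phi> (a i)) [0..<s])) (Aut Y E)"
  proof (rule inj_onI, rule ext)
    fix \<phi> \<psi> u assume h: "\<phi> \<in> Aut Y E" "\<psi> \<in> Aut Y E"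
      "(\<phi> y, \<phi> z, map (\<lambda>i. \<phi> (a i)) [0..<s]) = (\<psi> y, \<psi> z, map (\<lambda>i. \<psi> (a i)) [0..<s])"
    show "\<phi> u = \<psi> u"
    proof (cases "u \<in> Y")
      case True
      show ?thesis by (rule rigid[OF srg_axioms, of \<phi> \<psi>]) (use h True Aut_adj[OF h(1)] Aut_adj[OF h(2)] in simp_all)
    next
      case False
      then show ?thesis using AutD(1)[OF h(1)] AutD(1)[OF h(2)] by (simp add: permutes_not_in)
    qed
  qed
next
  fix x assume "x \<in> (\<lambda>\<phi>. (\<phi> y, \<phi> z, map (\<lambda>i. \<phi> (a i)) [0..<s])) ` Aut Y E"
  then obtain \<phi> where \<phi>: "\<phi> \<in> Aut Y E" and x: "x = (\<phi> y, \<phi> z, map (\<lambda>i. \<phi> (a i)) [0..<s])" by blast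
  note D = AutD[OF \<phi>]
  have z: "z \<in> Y" "z \<noteq> y" "\<not> E y z" using farD[OF z_far] by auto
  have ze: "\<phi> z \<in> far (\<phi> y)" unfolding far_def using D z y_in by (auto simp: inj_eq)
  have "set (map (\<lambda>i. \<phi> (a i)) [0..<s]) = \<phi> ` a ` {..<s}" by auto
  also have "\<dots> = \<phi> ` {w. E y w \<and> E z w}" using bij_a by (simp add: bij_betw_def)
  also have "\<dots> = {w. E (\<phi> y) w \<and> E (\<phi> z) w}"
  proof (intro equalityI subsetI)
    fix w assume w: "w \<in> {w. E (\<phi> y) w \<and> E (\<phi> z) w}"
    then obtain v where v: "v \<in> Y" "w = \<phi> v" using E_in D(5) by blast
    then have "E y v" "E z v" using w D(2)[of y v] D(2)[of z v] y_in z by auto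
    then show "w \<in> \<phi> ` {w. E y w \<and> E z w}" using v by auto
  next
    fix w assume "w \<in> \<phi> ` {w. E y w \<and> E z w}"
    then obtain v where v: "E y v" "E z v" "w = \<phi> v" by auto
    show "w \<in> {w. E (\<phi> y) w \<and> E (\<phi> z) w}" using Aut_adj[OF \<phi> v(1)] Aut_adj[OF \<phi> v(2)] v(3) by simp
  qed
  finally have "set (map (\<lambda>i. \<phi> (a i)) [0..<s]) = {w. E (\<phi> y) w \<and> E (\<phi> z) w}" .
  moreover have "inj_on (\<lambda>i. \<phi> (a i)) {0..<s}"
  proof (rule inj_onI)
    fix i j assume "i \<in> {0..<s}" "j \<in> {0..<s}" "\<phi> (a i) = \<phi> (a j)"
    then show "i = j" using injD[OF D(4), of "a i" "a j"] a_eq_iff[of i j] by simp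
  qed
  then have "distinct (map (\<lambda>i. \<phi> (a i)) [0..<s])" by (simp add: distinct_map)
  ultimately show "x \<in> frames" unfolding frames_def x permutations_of_set_def using D(3)[OF y_in] ze by simp
next
  fix x assume "x \<in> frames"
  then obtain y' z' l where x: "x = (y', z', l)" and f: "y' \<in> Y" "z' \<in> far y'" "l \<in> permutations_of_set {w. E y' w \<and> E z' w}"
    unfolding frames_def by auto
  obtain \<phi> where \<phi>: "\<phi> \<in> Aut Y E" "\<phi> y = y'" "\<phi> z = z'" "\<And>i. i < s \<Longrightarrow> \<phi> (a i) = l ! i"
    using ex_Aut_frame[OF f] by blast
  have "length l = s" using f card_common[OF f(1,2)] distinct_card[of l] unfolding permutations_of_set_def by auto
  then have "l = map (\<lambda>i. \<phi> (a i)) [0..<s]" using \<phi>(4) by (intro nth_equalityI) auto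
  then show "x \<in> (\<lambda>\<phi>. (\<phi> y, \<phi> z, map (\<lambda>i. \<phi> (a i)) [0..<s])) ` Aut Y E" using \<phi> x by blast
qed

lemma card_Aut: "card (Aut Y E) = card Y * ((4 * s - 4) * fact s)"
  using bij_betw_same_card[OF Aut_frame_bij] card_frames by simp

lemma far_nonempty: "y' \<in> Y \<Longrightarrow> far y' \<noteq> {}"
  using card_far[of y'] s_cases by auto

lemma transitive_Aut: "transitive_on Y (Aut Y E)"
proof -
  have ex: "\<exists>g\<in>Aut Y E. g u = v" if uv: "u \<in> Y" "v \<in> Y" for u v
  proof -
    obtain z1 z2 where z: "z1 \<in> far u" "z2 \<in> far v" using far_nonempty uv by blast
    obtain a1 where "frame Y E s u z1 a1" using ex_frame[OF uv(1) z(1)] .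
    then interpret F: frame Y E s u z1 a1 .
    have "permutations_of_set {w. E v w \<and> E z2 w} \<noteq> {}" using finite_nbrs by simp
    then show ?thesis using F.ex_Aut_frame[OF uv(2) z(2)] by (metis ex_in_conv)
  qed
  then show ?thesis unfolding transitive_on_def by blast
qed

end


section \<open>Cubes and the second neighbourhood\<close>

lemma perm_iso_Aut: assumes bij: "bij_betw f V W" and adj: "\<And>u v. u \<in> V \<Longrightarrow> v \<in> V \<Longrightarrow> F (f u) (f v) = E u v"
  shows "perm_iso V (Aut V E) W (Aut W F)"
proof -
  let ?g = "inv_into V f"
  let ?c = "\<lambda>a z. if z \<in> W then f (a (?g z)) else z"
  have g: "bij_betw ?g W V" using bij by (rule bij_betw_inv_into)
  have fg: "f (?g w) = w" if "w \<in> W" for w using bij that by (simp add: bij_betw_inv_into_right)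
  have gf: "?g (f v) = v" if "v \<in> V" for v using bij that by (simp add: bij_betw_inv_into_left)
  have fW: "f v \<in> W" if "v \<in> V" for v using bij that bij_betwE by blast
  have gV: "?g w \<in> V" if "w \<in> W" for w using g that bij_betwE by blast
  have "Aut W F = ?c ` Aut V E"
  proof (intro equalityI subsetI)
    fix \<psi> assume \<psi>: "\<psi> \<in> Aut W F"
    note D = AutD[OF \<psi>]
    define \<phi> where "\<phi> = (\<lambda>v. if v \<in> V then ?g (\<psi> (f v)) else v)"
    have b: "bij_betw (\<lambda>v. ?g (\<psi> (f v))) V V"
      using bij_betw_trans[OF bij_betw_trans[OF bij permutes_imp_bij[OF D(1)]] g] by (simp add: comp_def)
    have "\<phi> \<in> Aut V E" unfolding \<phi>_def
      by (rule AutI[OF b]) (use adj fg gV fW D in \<open>metis (no_types, lifting)\<close>)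
    moreover have "\<psi> = ?c \<phi>"
      unfolding \<phi>_def using fg gV fW D(3) permutes_not_in[OF D(1)] by (auto simp: fun_eq_iff)
    ultimately show "\<psi> \<in> ?c ` Aut V E" by blast
  next
    fix \<psi> assume "\<psi> \<in> ?c ` Aut V E"
    then obtain \<phi> where \<phi>: "\<phi> \<in> Aut V E" "\<psi> = ?c \<phi>" by blast
    note D = AutD[OF \<phi>(1)]
    have b: "bij_betw (\<lambda>w. f (\<phi> (?g w))) W W"
      using bij_betw_trans[OF bij_betw_trans[OF g permutes_imp_bij[OF D(1)]] bij] by (simp add: comp_def)
    show "\<psi> \<in> Aut W F" unfolding \<phi>(2)
      by (rule AutI[OF b]) (use adj fg gV fW D in \<open>metis (no_types, lifting)\<close>)
  qed
  then show ?thesis unfolding perm_iso_def using bij by blast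
qed

section \<open>Automorphisms of the far graph\<close>

context frame begin

lemma far_third: assumes "u \<in> far y" "v \<in> far y" "E u v" shows "E y (third u v)"
  using far_line[of u y v] far_sym[OF y_in assms(1)] assms farD by blast

lemma third_step: "w \<in> far y \<Longrightarrow> i < s \<Longrightarrow> third w (step i w) = c i w"
  unfolding step_def using third_third c_adj by auto

lemma c_z: "i < s \<Longrightarrow> c i z = a i" unfolding c_def sg_def using b_adj by auto

abbreviation "farAut \<equiv> Aut (far y) (induced (far y) E)"

lemma farAutD: assumes "\<psi> \<in> farAut" shows "u \<in> far y \<Longrightarrow> \<psi> u \<in> far y" "inj \<psi>"
    "u \<in> far y \<Longrightarrow> v \<in> far y \<Longrightarrow> E (\<psi> u) (\<psi> v) = E u v" "u \<notin> far y \<Longrightarrow> \<psi> u = u"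
  using AutD[OF assms] permutes_not_in[OF AutD(1)[OF assms]] unfolding induced_def by auto

text \<open>An automorphism of the far graph is not yet known to extend to Y, so
  \<open>rigid\<close> does not apply. Agreement is propagated inside the far graph instead:
  \<open>G\<close> collects the points where both maps agree together with all far neighbours, and
  it is closed under steps because squares can be completed uniquely in the image.\<close>

lemma farAut_rigid:
  assumes \<phi>: "\<phi> \<in> farAut" and \<psi>: "\<psi> \<in> farAut" and eq: "\<phi> z = \<psi> z" "\<And>i. i < s \<Longrightarrow> \<phi> (step i z) = \<psi> (step i z)"
  shows "\<phi> = \<psi>"
proof -
  note D = farAutD[OF \<phi>] and D' = farAutD[OF \<psi>]
  define G where "G = {w \<in> far y. \<phi> w = \<psi> w \<and> (\<forall>i<s. \<phi> (step i w) = \<psi> (step i w))}"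
  have G: "step i w \<in> G" if w: "w \<in> G" and i: "i < s" for i w
  proof -
    have wf: "w \<in> far y" and ww: "\<phi> w = \<psi> w" "\<And>j. j < s \<Longrightarrow> \<phi> (step j w) = \<psi> (step j w)"
      using w unfolding G_def by auto
    note u = step_far[OF wf i] step_adj[OF wf i]
    have "\<phi> (step j (step i w)) = \<psi> (step j (step i w))" if j: "j < s" for j
    proof (cases "j = i")
      case True then show ?thesis using step_step[OF wf i] ww by simp
    next
      case False
      note v = step_far[OF wf j] step_adj[OF wf j]
      let ?t = "step j (step i w)"
      have t: "?t \<in> far y" "E (step i w) ?t" using step_far[OF u(1) j] step_adj[OF u(1) j] by auto
      have t': "E (step j w) ?t" using step_adj[OF v(1) i] step_commute[OF wf j i] by simp
      have tw: "?t \<noteq> w" using sg_step[OF wf i i] sg_step[OF u(1) j i] False by auto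
      obtain k where k: "k < s" "\<phi> (step i w) = step k (\<phi> w)"
        using far_adj_cases[of "\<phi> w" "\<phi> (step i w)"] D wf u by metis
      obtain l where l: "l < s" "\<phi> (step j w) = step l (\<phi> w)"
        using far_adj_cases[of "\<phi> w" "\<phi> (step j w)"] D wf v by metis
      have kl: "k \<noteq> l" using k l D(2) False step_inj[OF wf i j] by (metis injD)
      have f: "\<phi> w \<in> far y" using D wf by auto
      have k': "step k (\<psi> w) = \<psi> (step i w)" and l': "step l (\<psi> w) = \<psi> (step j w)"
        using k l ww i j by auto
      have "\<phi> ?t = step k (step l (\<phi> w))"
        by (rule common_far_nbr[OF f k(1) l(1) kl])
          (use k l D t t' u v wf tw in \<open>auto simp: inj_eq simp flip: k(2) l(2)\<close>)
      moreover have "\<psi> ?t = step k (step l (\<phi> w))"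
        by (rule common_far_nbr[OF f k(1) l(1) kl])
          (use D' t t' u v wf tw in \<open>auto simp: inj_eq k' l' ww(1)\<close>)
      ultimately show ?thesis by simp
    qed
    then show ?thesis unfolding G_def using u ww i by auto
  qed
  have PG: "P I \<in> G" if "I \<subseteq> {..<s}" for I
  proof -
    have "finite I" using that finite_subset by blast
    then show ?thesis using that
    proof (induction I rule: finite_induct)
      case empty then show ?case unfolding P_empty G_def using z_far eq by auto
    next
      case (insert i I)
      then show ?case using P_insert[of I i] G[of "P I" i] by auto
    qed
  qed
  show ?thesis
  proof
    fix u
    show "\<phi> u = \<psi> u"
    proof (cases "u \<in> far y")
      case True
      then obtain I where "I \<subseteq> {..<n}" "u = P I" using P_image by auto
      then show ?thesis using PG[OF P_sub] unfolding G_def by auto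
    qed (use D(4) D'(4) in auto)
  qed
qed

text \<open>Each line joining \<open>\<psi> z\<close> to some \<open>\<psi> (step i z)\<close> has
  its third point adjacent to y, so a far automorphism yields a frame with base y. Conversely, the
  automorphism of the whole graph leading to a prescribed frame fixes y and restricts to the far
  points. In particular every far automorphism extends.\<close>

lemma farAut_bij: "bij_betw (\<lambda>\<psi>. (\<psi> z, map (\<lambda>i. third (\<psi> z) (\<psi> (step i z))) [0..<s])) farAut
   (SIGMA z:far y. permutations_of_set {w. E y w \<and> E z w})" (is "bij_betw ?f _ ?S")
  unfolding bij_betw_def
proof (intro conjI equalityI subsetI)
  show "inj_on ?f farAut"
  proof (rule inj_onI)
    fix \<phi> \<psi> assume h: "\<phi> \<in> farAut" "\<psi> \<in> farAut" "?f \<phi> = ?f \<psi>"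
    note D = farAutD[OF h(1)] and D' = farAutD[OF h(2)]
    show "\<phi> = \<psi>"
    proof (rule farAut_rigid[OF h(1,2)])
      show z: "\<phi> z = \<psi> z" using h(3) by simp
      fix i assume i: "i < s"
      then have "third (\<phi> z) (\<phi> (step i z)) = third (\<psi> z) (\<psi> (step i z))"
        using h(3) by auto
      then show "\<phi> (step i z) = \<psi> (step i z)"
        using third_third[of "\<phi> z" "\<phi> (step i z)"] third_third[of "\<psi> z" "\<psi> (step i z)"]
          D(3) D'(3) z_far step_far[OF z_far i] step_adj[OF z_far i] z by metis
    qed
  qed
next
  fix x assume "x \<in> ?f ` farAut"
  then obtain \<psi> where \<psi>: "\<psi> \<in> farAut" and x: "x = ?f \<psi>" by blast
  note D = farAutD[OF \<psi>]
  let ?t = "\<lambda>i. third (\<psi> z) (\<psi> (step i z))"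
  have adj: "E (\<psi> z) (\<psi> (step i z))" if "i < s" for i using D z_far step_far[OF z_far that] step_adj[OF z_far that] by auto
  have inj: "inj_on ?t {..<s}"
  proof (rule inj_onI)
    fix i j assume ij: "i \<in> {..<s}" "j \<in> {..<s}" "?t i = ?t j"
    then have "\<psi> (step i z) = \<psi> (step j z)" using adj third_third by (metis lessThan_iff)
    then show "i = j" using D(2) step_inj[OF z_far] ij by (auto simp: inj_eq)
  qed
  have "?t ` {..<s} = {w. E y w \<and> E (\<psi> z) w}"
  proof (rule card_subset_eq)
    show "?t ` {..<s} \<subseteq> {w. E y w \<and> E (\<psi> z) w}"
      using third_adj[OF adj] far_third[OF D(1)[OF z_far] D(1)[OF step_far[OF z_far]] adj] by auto
    show "card (?t ` {..<s}) = card {w. E y w \<and> E (\<psi> z) w}"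
      using card_image[OF inj] card_common[OF y_in D(1)[OF z_far]] by simp
  qed (rule finite_nbrs)
  moreover have "distinct (map ?t [0..<s])" using inj by (simp add: distinct_map atLeast0LessThan)
  ultimately show "x \<in> ?S" unfolding x permutations_of_set_def using D(1)[OF z_far] by (auto simp: atLeast0LessThan)
next
  fix x assume "x \<in> ?S"
  then obtain z' l where x: "x = (z', l)" and f: "z' \<in> far y" "l \<in> permutations_of_set {w. E y w \<and> E z' w}" by auto
  obtain \<phi> where \<phi>: "\<phi> \<in> Aut Y E" "\<phi> y = y" "\<phi> z = z'" "\<And>i. i < s \<Longrightarrow> \<phi> (a i) = l ! i"
    using ex_Aut_frame[OF y_in f] by blast
  note D = AutD[OF \<phi>(1)]
  define \<psi> where "\<psi> = (\<lambda>u. if u \<in> far y then \<phi> u else u)"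
  have ff: "\<phi> u \<in> far y \<longleftrightarrow> u \<in> far y" if "u \<in> Y" for u
    using D(2)[OF y_in that] D(3)[OF that] inj_eq[OF D(4), of u y] that \<phi>(2) unfolding far_def by auto
  have "\<psi> \<in> farAut" unfolding \<psi>_def
  proof (rule AutI)
    have "\<phi> ` far y = far y"
    proof (intro equalityI subsetI)
      fix u assume "u \<in> far y"
      then obtain v where "v \<in> Y" "u = \<phi> v" using D(5) far_subset by blast
      then show "u \<in> \<phi> ` far y" using ff \<open>u \<in> far y\<close> by blast
    qed (use ff far_subset in blast)
    then show "bij_betw \<phi> (far y) (far y)" using inj_on_subset[OF D(4)] by (simp add: bij_betw_def)
    show "induced (far y) E (\<phi> u) (\<phi> v) = induced (far y) E u v" if "u \<in> far y" "v \<in> far y" for u v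
      unfolding induced_def using that ff D(2) farD by metis
  qed
  have len: "length l = s" using f card_common[OF y_in f(1)] distinct_card[of l] unfolding permutations_of_set_def by auto
  have th: "third (\<psi> z) (\<psi> (step i z)) = l ! i" if i: "i < s" for i
  proof -
    have "\<phi> (third z (step i z)) = third (\<phi> z) (\<phi> (step i z))"
      by (rule hom_third[OF srg_axioms]) (use Aut_adj[OF \<phi>(1)] step_adj[OF z_far i] in auto)
    then show ?thesis unfolding \<psi>_def using z_far step_far[OF z_far i] third_step[OF z_far i] c_z[OF i] \<phi>(4)[OF i] by simp
  qed
  have "map (\<lambda>i. third (\<psi> z) (\<psi> (step i z))) [0..<s] = l"
    by (rule nth_equalityI) (simp_all add: len th)
  moreover have "\<psi> z = z'" by (simp add: \<psi>_def z_far \<phi>(3))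
  ultimately have "x = ?f \<psi>" using x by simp
  then show "x \<in> ?f ` farAut" using \<open>\<psi> \<in> farAut\<close> by (rule image_eqI)
qed

lemma card_farAut: "card farAut = (4 * s - 4) * fact s"
  using bij_betw_same_card[OF farAut_bij] card_perms_common[OF y_in] by simp

end

section \<open>Cube vertices as sets, distance as size of the symmetric difference\<close>

definition indvec :: "nat set \<Rightarrow> nat \<Rightarrow> nat" where
  "indvec I = (\<lambda>i. if i \<in> I then 1 else 0)"

lemma bij_indvec: "bij_betw indvec (Pow {..<n}) (cube_verts n)"
  unfolding bij_betw_def
proof
  show "inj_on indvec (Pow {..<n})"
    by (rule inj_onI) (auto simp: indvec_def fun_eq_iff split: if_splits)
  show "indvec ` Pow {..<n} = cube_verts n"
  proof (intro equalityI subsetI)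
    fix v assume v: "v \<in> cube_verts n"
    have "v = indvec {i. v i = 1}"
    proof
      fix i show "v i = indvec {i. v i = 1} i"
        using v unfolding cube_verts_def indvec_def by (cases "i < n") (auto dest!: spec[of _ i] simp: less_2_cases_iff)
    qed
    moreover have "{i. v i = 1} \<in> Pow {..<n}" using v unfolding cube_verts_def by (auto simp: not_le[symmetric])
    ultimately show "v \<in> indvec ` Pow {..<n}" by blast
  qed (auto simp: cube_verts_def indvec_def subset_iff)
qed

lemma sqdist_indvec: assumes "I \<subseteq> {..<n}" "J \<subseteq> {..<n}"
  shows "sqdist n (indvec I) (indvec J) = int (card (sym_diff I J))"
proof -
  have "sqdist n (indvec I) (indvec J) = (\<Sum>i<n. if i \<in> sym_diff I J then 1 else 0)"
    unfolding sqdist_def indvec_def by (intro sum.cong) auto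
  also have "\<dots> = int (card ({..<n} \<inter> sym_diff I J))" by (simp add: sum.inter_restrict[symmetric] del: Un_iff Diff_iff)
  also have "{..<n} \<inter> sym_diff I J = sym_diff I J" using assms by auto
  finally show ?thesis .
qed

lemma mem_tog: "x \<in> tog i I \<longleftrightarrow> (if x = i then x \<notin> I else x \<in> I)"
  unfolding tog_def by auto

lemma mem_sym_diff: "x \<in> sym_diff I J \<longleftrightarrow> (x \<in> I) \<noteq> (x \<in> J)"
  by blast

lemma card_sym_diff_1: "card (sym_diff I J) = 1 \<longleftrightarrow> (\<exists>i. J = tog i I)"
proof
  assume "card (sym_diff I J) = 1"
  then obtain i where i: "sym_diff I J = {i}" by (auto simp: card_1_singleton_iff)
  have "x \<in> J \<longleftrightarrow> x \<in> tog i I" for x using mem_sym_diff[of x I J] unfolding i mem_tog by auto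
  then have "J = tog i I" by blast
  then show "\<exists>i. J = tog i I" by blast
next
  assume "\<exists>i. J = tog i I"
  then obtain i where "J = tog i I" by blast
  then have "x \<in> sym_diff I J \<longleftrightarrow> x \<in> {i}" for x unfolding mem_sym_diff by (simp add: mem_tog)
  then have "sym_diff I J = {i}" by blast
  then show "card (sym_diff I J) = 1" by simp
qed

lemma sqdist_1: assumes "I \<subseteq> {..<n}" "J \<subseteq> {..<n}"
  shows "sqdist n (indvec I) (indvec J) = 1 \<longleftrightarrow> (\<exists>i<n. J = tog i I)"
proof -
  have "J = tog i I \<Longrightarrow> i < n" for i using assms mem_tog[of i i I] by (cases "i \<in> I") auto
  then show ?thesis using sqdist_indvec[OF assms] card_sym_diff_1[of I J] by auto
qed

lemma sqdist_full: assumes "I \<subseteq> {..<n}" "J \<subseteq> {..<n}"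
  shows "sqdist n (indvec I) (indvec J) = int n \<longleftrightarrow> J = {..<n} - I"
proof -
  have sub: "sym_diff I J \<subseteq> {..<n}" using assms by auto
  have "card (sym_diff I J) = n \<longleftrightarrow> sym_diff I J = {..<n}"
    using card_subset_eq[OF finite_lessThan sub] by (metis card_lessThan)
  also have "\<dots> \<longleftrightarrow> J = {..<n} - I" using assms by blast
  finally show ?thesis using sqdist_indvec[OF assms] by simp
qed

text \<open>The distance \<open>2\<close> is recognised as distinctness together with a common neighbour, so for
  \<open>n \<le> 3\<close> the adjacency of the cube graph determines all distances.\<close>

lemma cube_sym_eq_Aut: assumes "n \<le> 3"
  shows "cube_sym n = Aut (cube_verts n) (\<lambda>v w. sqdist n v w = 1)"
proof -
  let ?d = "\<lambda>v w. sqdist n v w" and ?C = "cube_verts n"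
  have rep: "\<exists>I\<subseteq>{..<n}. v = indvec I" if "v \<in> ?C" for v
    using bij_indvec[of n] that unfolding bij_betw_def by auto
  have sub: "v \<in> ?C" if "v = indvec I" "I \<subseteq> {..<n}" for v I
    using bij_indvec[of n] that unfolding bij_betw_def by auto
  have rng: "?d v w \<in> {0,1,2,3}" if vw: "v \<in> ?C" "w \<in> ?C" for v w
  proof -
    obtain I J where IJ: "I \<subseteq> {..<n}" "v = indvec I" "J \<subseteq> {..<n}" "w = indvec J"
      using rep[OF vw(1)] rep[OF vw(2)] by blast
    have "card (sym_diff I J) \<le> card {..<n}" using IJ by (intro card_mono) auto
    then show ?thesis using sqdist_indvec[of I n J] IJ assms by auto
  qed
  have d0: "?d v w = 0 \<longleftrightarrow> v = w" if vw: "v \<in> ?C" "w \<in> ?C" for v w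
  proof -
    obtain I J where IJ: "I \<subseteq> {..<n}" "v = indvec I" "J \<subseteq> {..<n}" "w = indvec J"
      using rep[OF vw(1)] rep[OF vw(2)] by blast
    have "finite (sym_diff I J)" using IJ by (meson finite_Diff finite_Un finite_lessThan finite_subset)
    then have "?d v w = 0 \<longleftrightarrow> sym_diff I J = {}" using sqdist_indvec[of I n J] IJ card_eq_0_iff[of "sym_diff I J"] by simp
    also have "\<dots> \<longleftrightarrow> I = J" by blast
    also have "\<dots> \<longleftrightarrow> v = w" using inj_onD[OF bij_betw_imp_inj_on[OF bij_indvec[of n]], of I J] IJ by auto
    finally show ?thesis .
  qed
  have d2: "?d v w = 2 \<longleftrightarrow> v \<noteq> w \<and> (\<exists>x\<in>?C. ?d v x = 1 \<and> ?d x w = 1)" if vw: "v \<in> ?C" "w \<in> ?C" for v w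
  proof
    obtain I J where IJ: "I \<subseteq> {..<n}" "v = indvec I" "J \<subseteq> {..<n}" "w = indvec J"
      using rep[OF vw(1)] rep[OF vw(2)] by blast
    {
      assume h: "?d v w = 2"
      then have "card (sym_diff I J) = 2" using sqdist_indvec[of I n J] IJ by simp
      then obtain i j where ij: "sym_diff I J = {i, j}" "i \<noteq> j" by (auto simp: card_2_iff)
      define K where "K = tog i I"
      have "i \<in> sym_diff I J" using ij by simp
      then have "i < n" using IJ by blast
      then have K: "K \<subseteq> {..<n}" unfolding K_def tog_def using IJ by auto
      have "x \<in> J \<longleftrightarrow> x \<in> tog j K" for x
        using mem_sym_diff[of x I J] ij(2) unfolding ij(1) K_def mem_tog by auto
      then have "J = tog j K" by blast
      then have "card (sym_diff I K) = 1" "card (sym_diff K J) = 1" using card_sym_diff_1 K_def by blast+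
      then have "?d v (indvec K) = 1" "?d (indvec K) w = 1" using sqdist_indvec K IJ by simp_all
      then show "v \<noteq> w \<and> (\<exists>x\<in>?C. ?d v x = 1 \<and> ?d x w = 1)" using d0[OF vw] h sub[OF refl K] by auto
    next
      assume "v \<noteq> w \<and> (\<exists>x\<in>?C. ?d v x = 1 \<and> ?d x w = 1)"
      then obtain x where vw': "v \<noteq> w" and x: "x \<in> ?C" "?d v x = 1" "?d x w = 1" by blast
      obtain K where K: "K \<subseteq> {..<n}" "x = indvec K" using rep[OF x(1)] by blast
      obtain i j where ij: "K = tog i I" "J = tog j K"
        using x sqdist_1[of I n K] sqdist_1[of K n J] K IJ by auto
      have "tog i (tog i I) = I" unfolding tog_def by auto
      then have "i \<noteq> j" using ij vw' IJ by auto
      then have "x \<in> sym_diff I J \<longleftrightarrow> x \<in> {i, j}" for x unfolding mem_sym_diff ij by (auto simp: mem_tog)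
      then have "sym_diff I J = {i, j}" by blast
      then show "?d v w = 2" using sqdist_indvec[of I n J] IJ \<open>i \<noteq> j\<close> by simp
    }
  qed
  have "?d (\<sigma> v) (\<sigma> w) = ?d v w" if \<sigma>: "\<sigma> \<in> Aut ?C (\<lambda>v w. ?d v w = 1)" and vw: "v \<in> ?C" "w \<in> ?C" for \<sigma> v w
  proof -
    note D = AutD[OF \<sigma>]
    have S: "\<sigma> v \<in> ?C" "\<sigma> w \<in> ?C" using D vw by auto
    have e0: "?d (\<sigma> v) (\<sigma> w) = 0 \<longleftrightarrow> ?d v w = 0" using d0 S vw D(4) by (auto simp: inj_eq)
    have e1: "?d (\<sigma> v) (\<sigma> w) = 1 \<longleftrightarrow> ?d v w = 1" using D(2) vw by auto
    have "(\<exists>x\<in>?C. ?d (\<sigma> v) x = 1 \<and> ?d x (\<sigma> w) = 1) \<longleftrightarrow> (\<exists>x\<in>?C. ?d (\<sigma> v) (\<sigma> x) = 1 \<and> ?d (\<sigma> x) (\<sigma> w) = 1)"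
      by (subst D(5)[symmetric]) blast
    also have "\<dots> \<longleftrightarrow> (\<exists>x\<in>?C. ?d v x = 1 \<and> ?d x w = 1)" using D(2) vw by auto
    finally have e2: "?d (\<sigma> v) (\<sigma> w) = 2 \<longleftrightarrow> ?d v w = 2" using d2[OF S] d2[OF vw] D(4) by (simp add: inj_eq)
    \<comment> \<open>Only 0, 1, 2, 3 occur as distances, so the first three being preserved settles
      the last.\<close>
    show ?thesis using rng[OF S] rng[OF vw] e0 e1 e2 by auto
  qed
  then show ?thesis unfolding cube_sym_def Aut_def by auto
qed

section \<open>Cube coordinates on the far points\<close>

context frame begin

definition coord :: "'a \<Rightarrow> nat \<Rightarrow> nat" where
  "coord = indvec \<circ> inv_into (Pow {..<n}) P"

lemma bij_coord: "bij_betw coord (far y) (cube_verts n)"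
  unfolding coord_def
  using bij_betw_trans[OF bij_betw_inv_into bij_indvec] inj_P_n P_image by (metis bij_betw_def)

lemma coord_adj: assumes "u \<in> far y" "v \<in> far y"
  shows "induced (far y) E u v \<longleftrightarrow> sqdist n (coord u) (coord v) = 1 \<or> (s = 5 \<and> sqdist 4 (coord u) (coord v) = 4)"
proof -
  obtain I J where IJ: "I \<subseteq> {..<n}" "u = P I" "J \<subseteq> {..<n}" "v = P J" using assms P_image by (metis (no_types, lifting) PowD imageE)
  have co: "coord u = indvec I" "coord v = indvec J"
    unfolding coord_def using IJ inj_P_n by auto
  have "s = 5 \<Longrightarrow> sqdist 4 (indvec I) (indvec J) = 4 \<longleftrightarrow> J = {..<4} - I"
    using sqdist_full[of I 4 J] IJ unfolding n_def by auto
  then show ?thesis unfolding co induced_def using P_adj[OF IJ(1,3)] IJ(2,4) assms sqdist_1[OF IJ(1,3)] by auto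
qed

lemma farAut_perm_iso:
  assumes "s \<noteq> 5" shows "perm_iso (far y) farAut (cube_verts s) (cube_sym s)"
proof -
  have "s \<le> 3" "n = s" using s_cases assms unfolding n_def by auto
  then show ?thesis
    using perm_iso_Aut[OF bij_coord, of "\<lambda>v w. sqdist n v w = 1"] coord_adj assms cube_sym_eq_Aut by auto
qed

lemma farAut_perm_iso_5:
  assumes "s = 5" shows "perm_iso (far y) farAut (cube_verts 4) (Aut (cube_verts 4) cube4_diag)"
proof -
  have n: "n = 4" using assms unfolding n_def by auto
  show ?thesis
    using perm_iso_Aut[OF bij_coord, of cube4_diag] coord_adj assms bij_betwE[OF bij_coord] unfolding n cube4_diag_def by auto
qed

end


section \<open>Switching classes\<close>

lemma seidel_cases: "seidel E i j = 1 \<or> seidel E i j = -1"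
  unfolding seidel_def by auto

lemma seidel_sq: "seidel E i j * seidel E i j = 1"
  unfolding seidel_def by auto

text \<open>Switching at the neighbours of x isolates x. Any sign vector with this effect agrees
  with the chosen one up to the global factor \<open>\<mu> x\<close>, which cancels in products, so
  the description inside \<open>isolate\<close> has exactly one solution.\<close>

lemma derived_associated:
  assumes g: "graph_on X EG" and x: "x \<in> X"
  shows "associated X EG (derived X EG x)"
proof -
  define \<nu> where "\<nu> i = seidel EG x i" for i
  have pm: "\<nu> i = 1 \<or> \<nu> i = -1" for i unfolding \<nu>_def by (rule seidel_cases)
  have sq: "\<nu> i * \<nu> i = 1" for i unfolding \<nu>_def by (rule seidel_sq)
  define E0 where "E0 u v \<longleftrightarrow> u \<in> X \<and> v \<in> X \<and> u \<noteq> v \<and> \<nu> u * \<nu> v * seidel EG u v = -1" for u v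
  have sym: "seidel EG u v = seidel EG v u" for u v
    using g unfolding seidel_def graph_on_def by metis
  have s0: "seidel E0 i j = \<nu> i * \<nu> j * seidel EG i j" if "i \<in> X" "j \<in> X" for i j
  proof (cases "i = j")
    case True then show ?thesis using sq by (simp add: seidel_def)
  next
    case False
    have "\<nu> i * \<nu> j * seidel EG i j = 1 \<or> \<nu> i * \<nu> j * seidel EG i j = -1"
      using pm[of i] pm[of j] seidel_cases[of EG i j] by auto
    then show ?thesis using that False unfolding seidel_def[of E0] E0_def by auto
  qed
  have as: "associated X EG E0"
    unfolding associated_def using s0 pm by blast
  have g0: "graph_on X E0"
    using g unfolding graph_on_def E0_def by (auto simp: sym[of _ _] mult.commute mult.left_commute)
  have iso: "\<not> E0 x v" for v unfolding E0_def using sq[of v] unfolding \<nu>_def by (auto simp: seidel_def)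
  have "isolate X EG x = E0"
    unfolding isolate_def
  proof (rule the_equality)
    show "graph_on X E0 \<and> associated X EG E0 \<and> (\<forall>v. \<not> E0 x v)" using g0 as iso by blast
  next
    fix E' assume h: "graph_on X E' \<and> associated X EG E' \<and> (\<forall>v. \<not> E' x v)"
    then obtain \<mu> where \<mu>: "\<And>i. i \<in> X \<Longrightarrow> \<mu> i = 1 \<or> \<mu> i = (-1 :: int)"
      "\<And>i j. i \<in> X \<Longrightarrow> j \<in> X \<Longrightarrow> seidel E' i j = \<mu> i * \<mu> j * seidel EG i j" unfolding associated_def by blast
    have m: "\<nu> j = \<mu> x * \<mu> j" if "j \<in> X" for j
      using \<mu>(2)[OF x that] h \<mu>(1)[OF x] \<mu>(1)[OF that] unfolding \<nu>_def by (auto simp: seidel_def[of E'])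
    have s': "seidel E' i j = seidel E0 i j" if "i \<in> X" "j \<in> X" for i j
      using s0[OF that] \<mu>(2)[OF that] m[OF that(1)] m[OF that(2)] \<mu>(1)[OF x] by auto
    have "E' i j = E0 i j" if "i \<in> X" "j \<in> X" for i j
      using s'[OF that] h g0 unfolding seidel_def graph_on_def by (auto split: if_splits)
    then show "E' = E0" using h g0 unfolding graph_on_def by blast
  qed
  \<comment> \<open>As x is isolated in \<open>E0\<close>, restricting to the other vertices loses
    no edge, and the restriction can still be compared with \<open>EG\<close> on all of X.\<close>
  then have "derived X EG x = E0"
    unfolding derived_def induced_def using g0 iso unfolding graph_on_def by (intro ext) blast
  then show ?thesis using as by simp
qed

text \<open>The condition of \<open>Ggrp\<close> pulled back along \<sigma>: the image graph
  disappears, and composing permutations multiplies sign vectors.\<close>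

definition swaut :: "'a set \<Rightarrow> ('a \<Rightarrow> 'a \<Rightarrow> bool) \<Rightarrow> ('a \<Rightarrow> 'a) set" where
  "swaut X E = {\<sigma>. \<sigma> permutes X \<and> (\<exists>\<nu> :: 'a \<Rightarrow> int. (\<forall>i\<in>X. \<nu> i = 1 \<or> \<nu> i = -1) \<and>
     (\<forall>i\<in>X. \<forall>j\<in>X. seidel E (\<sigma> i) (\<sigma> j) = \<nu> i * \<nu> j * seidel E i j))}"

lemma Ggrp_eq_swaut: "Ggrp X E = swaut X E"
proof -
  have "associated X E (img_graph \<sigma> E) \<longleftrightarrow> (\<exists>\<nu> :: 'a \<Rightarrow> int. (\<forall>i\<in>X. \<nu> i = 1 \<or> \<nu> i = -1) \<and>
     (\<forall>i\<in>X. \<forall>j\<in>X. seidel E (\<sigma> i) (\<sigma> j) = \<nu> i * \<nu> j * seidel E i j))" (is "?l \<longleftrightarrow> ?r") if p: "\<sigma> permutes X" for \<sigma>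
  proof -
    have im: "seidel (img_graph \<sigma> E) (\<sigma> i) (\<sigma> j) = seidel E i j" for i j
      unfolding seidel_def img_graph_def using permutes_inj[OF p] by (auto simp: inj_eq)
    have mem: "\<sigma> i \<in> X \<longleftrightarrow> i \<in> X" for i by (rule permutes_in_image[OF p])
    have sur: "\<exists>j\<in>X. i = \<sigma> j" if "i \<in> X" for i using permutes_image[OF p] that by blast
    show ?thesis
    proof
      assume ?l
      then obtain \<nu> where \<nu>: "\<And>i. i \<in> X \<Longrightarrow> \<nu> i = 1 \<or> \<nu> i = (-1 :: int)"
        "\<And>i j. i \<in> X \<Longrightarrow> j \<in> X \<Longrightarrow> seidel (img_graph \<sigma> E) i j = \<nu> i * \<nu> j * seidel E i j" unfolding associated_def by blast
      show ?r
      proof (intro exI[of _ "\<nu> \<circ> \<sigma>"] conjI ballI)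
        fix i assume i: "i \<in> X"
        show "(\<nu> \<circ> \<sigma>) i = 1 \<or> (\<nu> \<circ> \<sigma>) i = -1" using \<nu>(1) i mem by simp
        fix j assume j: "j \<in> X"
        show "seidel E (\<sigma> i) (\<sigma> j) = (\<nu> \<circ> \<sigma>) i * (\<nu> \<circ> \<sigma>) j * seidel E i j"
          using \<nu>(2)[of "\<sigma> i" "\<sigma> j"] \<nu>(1)[of "\<sigma> i"] \<nu>(1)[of "\<sigma> j"] i j by (auto simp: im mem)
      qed
    next
      assume ?r
      then obtain \<nu> where \<nu>: "\<And>i. i \<in> X \<Longrightarrow> \<nu> i = 1 \<or> \<nu> i = (-1 :: int)"
        "\<And>i j. i \<in> X \<Longrightarrow> j \<in> X \<Longrightarrow> seidel E (\<sigma> i) (\<sigma> j) = \<nu> i * \<nu> j * seidel E i j" by blast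
      have inv: "Hilbert_Choice.inv \<sigma> (\<sigma> i) = i" for i using p by (simp add: permutes_inverses)
      show ?l unfolding associated_def
      proof (intro exI[of _ "\<nu> \<circ> Hilbert_Choice.inv \<sigma>"] conjI ballI)
        fix i' assume "i' \<in> X"
        then obtain i where i: "i \<in> X" "i' = \<sigma> i" using sur by blast
        show "(\<nu> \<circ> Hilbert_Choice.inv \<sigma>) i' = 1 \<or> (\<nu> \<circ> Hilbert_Choice.inv \<sigma>) i' = -1" using \<nu>(1) i by (simp add: inv)
        fix j' assume "j' \<in> X"
        then obtain j where j: "j \<in> X" "j' = \<sigma> j" using sur by blast
        show "seidel (img_graph \<sigma> E) i' j' = (\<nu> \<circ> Hilbert_Choice.inv \<sigma>) i' * (\<nu> \<circ> Hilbert_Choice.inv \<sigma>) j' * seidel E i' j'"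
          using \<nu>(2)[OF i(1) j(1)] \<nu>(1)[OF i(1)] \<nu>(1)[OF j(1)] i j by (auto simp: im inv)
      qed
    qed
  qed
  then show ?thesis unfolding Ggrp_def swaut_def by blast
qed

lemma swaut_associated_subset: assumes "associated X E E'" shows "swaut X E \<subseteq> swaut X E'"
proof
  fix \<sigma> assume s: "\<sigma> \<in> swaut X E"
  then have p: "\<sigma> permutes X" unfolding swaut_def by blast
  obtain \<nu> where \<nu>: "\<And>i. i \<in> X \<Longrightarrow> \<nu> i = 1 \<or> \<nu> i = (-1 :: int)"
        "\<And>i j. i \<in> X \<Longrightarrow> j \<in> X \<Longrightarrow> seidel E (\<sigma> i) (\<sigma> j) = \<nu> i * \<nu> j * seidel E i j"
    using s unfolding swaut_def by blast
  obtain \<mu> where \<mu>: "\<And>i. i \<in> X \<Longrightarrow> \<mu> i = 1 \<or> \<mu> i = (-1 :: int)"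
        "\<And>i j. i \<in> X \<Longrightarrow> j \<in> X \<Longrightarrow> seidel E' i j = \<mu> i * \<mu> j * seidel E i j"
    using assms unfolding associated_def by blast
  have mem: "\<sigma> i \<in> X \<longleftrightarrow> i \<in> X" for i by (rule permutes_in_image[OF p])
  \<comment> \<open>The switching \<mu> is undone at i and performed again at the image of
    i.\<close>
  define \<rho> where "\<rho> i = \<mu> (\<sigma> i) * \<nu> i * \<mu> i" for i
  have "\<rho> i = 1 \<or> \<rho> i = -1" if "i \<in> X" for i
    unfolding \<rho>_def using \<nu>(1)[OF that] \<mu>(1)[OF that] \<mu>(1)[of "\<sigma> i"] that mem by auto
  moreover have "seidel E' (\<sigma> i) (\<sigma> j) = \<rho> i * \<rho> j * seidel E' i j" if "i \<in> X" "j \<in> X" for i j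
    unfolding \<rho>_def using \<mu>(2)[of "\<sigma> i" "\<sigma> j"] \<nu>(2)[OF that] \<mu>(2)[OF that] \<mu>(1)[OF that(1)] \<mu>(1)[OF that(2)] that mem
    by (elim disjE) (simp_all add: mem)
  ultimately show "\<sigma> \<in> swaut X E'" unfolding swaut_def using p by blast
qed

lemma associated_sym: assumes "associated X E E'" shows "associated X E' E"
proof -
  obtain \<mu> where \<mu>: "\<And>i. i \<in> X \<Longrightarrow> \<mu> i = 1 \<or> \<mu> i = (-1 :: int)"
        "\<And>i j. i \<in> X \<Longrightarrow> j \<in> X \<Longrightarrow> seidel E' i j = \<mu> i * \<mu> j * seidel E i j"
    using assms unfolding associated_def by blast
  have "seidel E i j = \<mu> i * \<mu> j * seidel E' i j" if "i \<in> X" "j \<in> X" for i j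
    using \<mu>(2)[OF that] \<mu>(1)[OF that(1)] \<mu>(1)[OF that(2)] by (elim disjE) simp_all
  then show ?thesis unfolding associated_def using \<mu>(1) by blast
qed

text \<open>The group depends only on the switching class, so the given graph may be exchanged for
  its derived graph with x as an additional isolated vertex.\<close>

lemma Ggrp_derived: assumes "graph_on X EG" "x \<in> X" shows "Ggrp X EG = swaut X (derived X EG x)"
  unfolding Ggrp_eq_swaut using swaut_associated_subset derived_associated[OF assms] associated_sym by blast

lemma swaut_comp: assumes "\<sigma> \<in> swaut X E" "\<tau> \<in> swaut X E" shows "\<sigma> \<circ> \<tau> \<in> swaut X E"
proof -
  have p: "\<sigma> permutes X" "\<tau> permutes X" using assms unfolding swaut_def by auto
  obtain \<nu> where \<nu>: "\<And>i. i \<in> X \<Longrightarrow> \<nu> i = 1 \<or> \<nu> i = (-1 :: int)"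
        "\<And>i j. i \<in> X \<Longrightarrow> j \<in> X \<Longrightarrow> seidel E (\<sigma> i) (\<sigma> j) = \<nu> i * \<nu> j * seidel E i j"
    using assms(1) unfolding swaut_def by blast
  obtain \<mu> where \<mu>: "\<And>i. i \<in> X \<Longrightarrow> \<mu> i = 1 \<or> \<mu> i = (-1 :: int)"
        "\<And>i j. i \<in> X \<Longrightarrow> j \<in> X \<Longrightarrow> seidel E (\<tau> i) (\<tau> j) = \<mu> i * \<mu> j * seidel E i j"
    using assms(2) unfolding swaut_def by blast
  define \<rho> where "\<rho> i = \<nu> (\<tau> i) * \<mu> i" for i
  have mem: "\<tau> i \<in> X \<longleftrightarrow> i \<in> X" for i by (rule permutes_in_image[OF p(2)])
  have "\<rho> i = 1 \<or> \<rho> i = -1" if "i \<in> X" for i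
    unfolding \<rho>_def using \<nu>(1)[of "\<tau> i"] \<mu>(1)[OF that] that mem by auto
  moreover have "seidel E ((\<sigma> \<circ> \<tau>) i) ((\<sigma> \<circ> \<tau>) j) = \<rho> i * \<rho> j * seidel E i j" if "i \<in> X" "j \<in> X" for i j
    unfolding \<rho>_def using \<nu>(2)[of "\<tau> i" "\<tau> j"] \<mu>(2)[OF that] that by (simp add: mem)
  ultimately show ?thesis unfolding swaut_def using permutes_compose[OF p(2,1)] by blast
qed

section \<open>Stabiliser, transvections and order of the switching group\<close>

context srg begin

lemma E_x: "x \<notin> Y \<Longrightarrow> \<not> E x v" "x \<notin> Y \<Longrightarrow> \<not> E v x" using E_in by blast+

lemma seidel_eq_iff: "seidel E i j = seidel E k l \<longleftrightarrow> E i j = E k l"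
  unfolding seidel_def using E_irrefl by auto

text \<open>Since x is isolated and fixed, the pairs of x with another vertex force all signs to
  equal \<open>\<nu> x\<close>. The signs cancel, and adjacency itself is preserved.\<close>

lemma swaut_stabilizer: assumes x: "x \<notin> Y"
  shows "{\<sigma> \<in> swaut (insert x Y) E. \<sigma> x = x} = Aut Y E"
proof (intro equalityI subsetI)
  fix \<sigma> assume "\<sigma> \<in> {\<sigma> \<in> swaut (insert x Y) E. \<sigma> x = x}"
  then have p: "\<sigma> permutes insert x Y" and sx: "\<sigma> x = x" and s: "\<sigma> \<in> swaut (insert x Y) E"
    unfolding swaut_def by auto
  obtain \<nu> where \<nu>: "\<And>i. i \<in> insert x Y \<Longrightarrow> \<nu> i = 1 \<or> \<nu> i = (-1 :: int)"
        "\<And>i j. i \<in> insert x Y \<Longrightarrow> j \<in> insert x Y \<Longrightarrow> seidel E (\<sigma> i) (\<sigma> j) = \<nu> i * \<nu> j * seidel E i j"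
    using s unfolding swaut_def by blast
  have c: "\<nu> x * \<nu> j = 1" if "j \<in> Y" for j
    using \<nu>(2)[of x j] that sx E_x[OF x] by (simp add: seidel_def)
  have "\<nu> i * \<nu> j = 1" if "i \<in> Y" "j \<in> Y" for i j
    using c[OF that(1)] c[OF that(2)] \<nu>(1)[of x] by auto
  then have "seidel E (\<sigma> i) (\<sigma> j) = seidel E i j" if "i \<in> Y" "j \<in> Y" for i j
    using \<nu>(2)[of i j] that by simp
  moreover have "\<sigma> permutes Y"
    by (rule permutes_superset[OF p]) (use sx in auto)
  ultimately show "\<sigma> \<in> Aut Y E" unfolding Aut_def using seidel_eq_iff by blast
next
  fix \<sigma> assume s: "\<sigma> \<in> Aut Y E"
  note D = AutD[OF s]
  have sx: "\<sigma> x = x" using permutes_not_in[OF D(1) x] .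
  have p: "\<sigma> permutes insert x Y" by (rule permutes_subset[OF D(1)]) auto
  have "E (\<sigma> i) (\<sigma> j) = E i j" if "i \<in> insert x Y" "j \<in> insert x Y" for i j
    using that D(2)[of i j] sx E_x[OF x] by auto
  then have "seidel E (\<sigma> i) (\<sigma> j) = 1 * 1 * seidel E i j" if "i \<in> insert x Y" "j \<in> insert x Y" for i j
    using seidel_eq_iff that by simp
  then have "\<sigma> \<in> swaut (insert x Y) E"
    unfolding swaut_def using p by (intro CollectI conjI exI[of _ "\<lambda>_. 1"]) auto
  then show "\<sigma> \<in> {\<sigma> \<in> swaut (insert x Y) E. \<sigma> x = x}" using sx by simp
qed

text \<open>An analogue of a symplectic transvection: it swaps \<open>x\<close> and \<open>u\<close>, swaps the two points other than \<open>u\<close>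
  on each line through \<open>u\<close>, and fixes the points at distance 2 from \<open>u\<close>.\<close>

definition transv :: "'a \<Rightarrow> 'a \<Rightarrow> 'a \<Rightarrow> 'a" where
  "transv x u v = (if u = x then v else if v = x then u else if v = u then x
      else if E u v then third u v else v)"

lemma transv_x: "transv x u x = u" unfolding transv_def by auto

lemma transv_transv: assumes x: "x \<notin> Y" shows "transv x u (transv x u v) = v"
proof (cases "u \<noteq> x \<and> E u v")
  case True
  then have t: "E u (third u v)" "third u (third u v) = v" using third_adj third_third by auto
  then have "third u v \<noteq> u" "third u v \<noteq> x" "v \<noteq> u" "v \<noteq> x" using E_irrefl E_x[OF x] True by auto
  then show ?thesis using t True unfolding transv_def by simp
next
  case False
  then show ?thesis using E_x[OF x] unfolding transv_def by auto
qed

text \<open>The switching set is the neighbourhood of u. Exchanging the two further points of a line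
  through u reverses adjacency to every point far from u, by the quadrangle axiom, and keeps
  adjacency between neighbours of u, just as this switching does.\<close>

lemma transv_swaut: assumes x: "x \<notin> Y" and u: "u \<in> insert x Y"
  shows "transv x u \<in> swaut (insert x Y) E"
proof (cases "u = x")
  case True
  then have "transv x u = id" unfolding transv_def by auto
  then show ?thesis unfolding swaut_def by (auto intro!: permutes_id exI[of _ "\<lambda>_. 1"])
next
  case ux: False
  then have uY: "u \<in> Y" using u by simp
  let ?t = "transv x u"
  have inX: "?t v \<in> insert x Y" if "v \<in> insert x Y" for v
    using that uY third_adj(1)[of u v] E_in[of u "third u v"] unfolding transv_def by auto
  have "bij_betw ?t (insert x Y) (insert x Y)"
    by (rule bij_betw_byWitness[of _ ?t]) (use inX transv_transv[OF x] in auto)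
  moreover have "?t v = v" if "v \<notin> insert x Y" for v using that uY E_in[of u v] unfolding transv_def by auto
  ultimately have p: "?t permutes insert x Y" by (rule bij_imp_permutes)
  have val: "?t x = u" "?t u = x" "\<And>v. E u v \<Longrightarrow> ?t v = third u v" "\<And>v. v \<in> far u \<Longrightarrow> ?t v = v"
    using ux E_x[OF x] E_irrefl farD x unfolding transv_def by auto
  have cls: "v = x \<or> v = u \<or> E u v \<or> v \<in> far u" if "v \<in> insert x Y" for v
    using that unfolding far_def by auto
  have adj: "E (?t i) (?t j) \<longleftrightarrow> ((E u i \<noteq> E u j) \<noteq> E i j)" if ij: "i \<in> insert x Y" "j \<in> insert x Y" "i \<noteq> j" for i j
  proof -
    have nn: "E (third u v) (third u w) \<longleftrightarrow> E v w" if "E u v" "E u w" for v w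
      using that third_eq[of u v w] third_eq[of u "third u v" "third u w"] third_third third_adj E_sym by metis
    have nf: "E (third u v) w \<longleftrightarrow> \<not> E v w" "E w (third u v) \<longleftrightarrow> \<not> E w v" if "E u v" "w \<in> far u" for v w
      using far_line[OF uY that(2,1)] E_sym by blast+
    show ?thesis using cls[OF ij(1)] cls[OF ij(2)] ij(3)
      by (elim disjE; simp add: val nn nf E_x[OF x] E_irrefl farD third_adj E_sym)
  qed
  have "seidel E (?t i) (?t j) = seidel E u i * seidel E u j * seidel E i j"
    if ij: "i \<in> insert x Y" "j \<in> insert x Y" for i j
  proof (cases "i = j")
    case True then show ?thesis using seidel_sq[of E u i] by (simp add: seidel_def)
  next
    case False
    then show ?thesis using adj[OF ij False] E_irrefl unfolding seidel_def by auto
  qed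
  then show ?thesis unfolding swaut_def
    by (intro CollectI conjI exI[of _ "seidel E u"] ballI p seidel_cases)
qed

text \<open>Orbit-stabiliser with explicit coset representatives: for u = \<open>\<sigma> x\<close>
  the involution \<open>transv x u\<close> takes u back to x, so its product with \<sigma> lies in
  the stabiliser.\<close>

lemma card_swaut: assumes x: "x \<notin> Y"
  shows "card (swaut (insert x Y) E) = card (insert x Y) * card (Aut Y E)"
proof -
  have "bij_betw (\<lambda>(u, \<phi>). transv x u \<circ> \<phi>) (insert x Y \<times> Aut Y E) (swaut (insert x Y) E)"
    unfolding bij_betw_def
  proof (intro conjI equalityI subsetI)
    show "inj_on (\<lambda>(u, \<phi>). transv x u \<circ> \<phi>) (insert x Y \<times> Aut Y E)"
    proof (rule inj_onI, clarify)
      fix u \<phi> v \<psi> assume h: "\<phi> \<in> Aut Y E" "\<psi> \<in> Aut Y E" "transv x u \<circ> \<phi> = transv x v \<circ> \<psi>"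
      have "\<phi> x = x" "\<psi> x = x" using h swaut_stabilizer[OF x] by blast+
      then have uv: "u = v" using fun_cong[OF h(3), of x] transv_x by simp
      have "\<phi> w = \<psi> w" for w
        using fun_cong[OF h(3), of w] uv transv_transv[OF x, of u "\<phi> w"] transv_transv[OF x, of u "\<psi> w"] by simp
      then show "u = v \<and> \<phi> = \<psi>" using uv by blast
    qed
  next
    fix \<sigma> assume "\<sigma> \<in> (\<lambda>(u, \<phi>). transv x u \<circ> \<phi>) ` (insert x Y \<times> Aut Y E)"
    then obtain u \<phi> where h: "u \<in> insert x Y" "\<phi> \<in> Aut Y E" "\<sigma> = transv x u \<circ> \<phi>" by auto
    have "\<phi> \<in> swaut (insert x Y) E" using h swaut_stabilizer[OF x] by blast
    then show "\<sigma> \<in> swaut (insert x Y) E" using h transv_swaut[OF x] swaut_comp by blast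
  next
    fix \<sigma> assume s: "\<sigma> \<in> swaut (insert x Y) E"
    define u where "u = \<sigma> x"
    have "\<sigma> permutes insert x Y" using s unfolding swaut_def by blast
    then have u: "u \<in> insert x Y" unfolding u_def using permutes_in_image[of \<sigma> "insert x Y" x] by blast
    have "transv x u \<circ> \<sigma> \<in> swaut (insert x Y) E" using swaut_comp[OF transv_swaut[OF x u] s] .
    moreover have "(transv x u \<circ> \<sigma>) x = x" using transv_transv[OF x, of u x] transv_x unfolding u_def by simp
    ultimately have a: "transv x u \<circ> \<sigma> \<in> Aut Y E" using swaut_stabilizer[OF x] by blast
    have "\<sigma> = transv x u \<circ> (transv x u \<circ> \<sigma>)" using transv_transv[OF x] by (simp add: fun_eq_iff)
    then show "\<sigma> \<in> (\<lambda>(u, \<phi>). transv x u \<circ> \<phi>) ` (insert x Y \<times> Aut Y E)" using u a by (intro image_eqI[of _ _ "(u, transv x u \<circ> \<sigma>)"]) auto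
  qed
  from bij_betw_same_card[OF this] show ?thesis by (simp add: card_cartesian_product)
qed

text \<open>Transvections take u1 to x and x to v1, which leaves a single pair of points of Y to be
  matched by the stabiliser of x.\<close>

lemma doubly_transitive_swaut: assumes x: "x \<notin> Y" and tr: "transitive_on Y (Aut Y E)"
  shows "doubly_transitive_on (insert x Y) (swaut (insert x Y) E)"
  unfolding doubly_transitive_on_def
proof (intro ballI impI)
  fix u1 u2 v1 v2 assume h: "u1 \<in> insert x Y" "u2 \<in> insert x Y" "v1 \<in> insert x Y" "v2 \<in> insert x Y" "u1 \<noteq> u2" "v1 \<noteq> v2"
  have Y: "transv x u v \<in> Y" if "u \<in> insert x Y" "v \<in> insert x Y" "u \<noteq> v" for u v
  proof -
    have "transv x u permutes insert x Y" using transv_swaut[OF x that(1)] unfolding swaut_def by blast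
    then have "transv x u v \<in> insert x Y" using that permutes_in_image[of "transv x u" "insert x Y" v] by blast
    moreover have "transv x u v \<noteq> x" using transv_transv[OF x, of u v] transv_x[of x u] that by metis
    ultimately show ?thesis by simp
  qed
  obtain \<phi> where \<phi>: "\<phi> \<in> Aut Y E" "\<phi> (transv x u1 u2) = transv x v1 v2"
    using tr Y h unfolding transitive_on_def by blast
  then have \<phi>': "\<phi> \<in> swaut (insert x Y) E" "\<phi> x = x" using swaut_stabilizer[OF x] by blast+
  have u1: "transv x u1 u1 = x" using transv_transv[OF x, of u1 x] transv_x by simp
  let ?g = "transv x v1 \<circ> (\<phi> \<circ> transv x u1)"
  have "?g \<in> swaut (insert x Y) E"
    using swaut_comp[OF transv_swaut[OF x h(3)] swaut_comp[OF \<phi>'(1) transv_swaut[OF x h(1)]]] .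
  moreover have "?g u1 = v1" "?g u2 = v2" using u1 \<phi> \<phi>' transv_x transv_transv[OF x] by simp_all
  ultimately show "\<exists>g\<in>swaut (insert x Y) E. g u1 = v1 \<and> g u2 = v2" by blast
qed

end


section \<open>The symplectic space over the field with two elements\<close>

abbreviation zvec :: "nat \<Rightarrow> nat" where "zvec \<equiv> (\<lambda>_. 0)"

definition ee :: "nat \<Rightarrow> nat \<Rightarrow> nat" where "ee i = (\<lambda>j. of_bool (i = j))"

text \<open>An elliptic form; the squares make its polarisation identity hold for all \<open>nat\<close>-valued vectors,
  not only for those with entries 0 and 1.\<close>

definition Q0 :: "(nat \<Rightarrow> nat) \<Rightarrow> nat" where
  "Q0 v = (v 0 * v 1 + v 2 * v 3 + v 4 * v 5 + v 4 * v 4 + v 5 * v 5) mod 2"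

lemma F2_6_iff: "v \<in> F2_6 \<longleftrightarrow> (\<forall>i<6. v i < 2) \<and> (\<forall>i\<ge>6. v i = 0)"
  unfolding F2_6_def cube_verts_def by simp

lemma F2_6_less_2: "v \<in> F2_6 \<Longrightarrow> v i < 2"
  unfolding F2_6_iff by (cases "i < 6") auto

lemma zvec_in [simp]: "zvec \<in> F2_6" unfolding F2_6_iff by simp
lemma ee_in [simp]: "i < 6 \<Longrightarrow> ee i \<in> F2_6" unfolding F2_6_iff ee_def by auto
lemma vadd_in [simp]: "u \<in> F2_6 \<Longrightarrow> v \<in> F2_6 \<Longrightarrow> vadd u v \<in> F2_6" unfolding F2_6_iff vadd_def by auto

lemma vadd_commute: "vadd u v = vadd v u" unfolding vadd_def by (simp add: add.commute)
lemma vadd_assoc: "vadd (vadd u v) w = vadd u (vadd v w)" unfolding vadd_def by (simp add: mod_simps add.assoc)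
lemma vadd_left_commute: "vadd u (vadd v w) = vadd v (vadd u w)" using vadd_assoc vadd_commute by metis
lemma vadd_zvec: "v \<in> F2_6 \<Longrightarrow> vadd v zvec = v" unfolding vadd_def using F2_6_less_2 by (auto simp: fun_eq_iff)
lemma vadd_self: "vadd v v = zvec" unfolding vadd_def by (auto simp: fun_eq_iff)
lemma vadd_cancel: "v \<in> F2_6 \<Longrightarrow> vadd u (vadd u v) = v"
  using vadd_assoc[of u u v] vadd_self[of u] vadd_zvec[of v] vadd_commute[of v zvec] by simp
lemma vadd_eq_zvec: "u \<in> F2_6 \<Longrightarrow> v \<in> F2_6 \<Longrightarrow> vadd u v = zvec \<Longrightarrow> u = v"
  using vadd_cancel[of v u] vadd_zvec[of u] by metis

lemma symp_eq: "symp u v = (u 0 * v 1 + u 1 * v 0 + u 2 * v 3 + u 3 * v 2 + u 4 * v 5 + u 5 * v 4) mod 2"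
  unfolding symp_def by (simp add: numeral_3_eq_3 lessThan_Suc algebra_simps numeral_eq_Suc)

lemma symp_less_2: "symp u v < 2" unfolding symp_def by simp
lemma symp_commute: "symp u v = symp v u" unfolding symp_eq by (simp add: algebra_simps)
lemma symp_self: "symp u u = 0" unfolding symp_eq by (simp add: algebra_simps)
lemma symp_zvec: "symp zvec v = 0" "symp v zvec = 0" unfolding symp_eq by simp_all
lemma symp_vadd_left: "symp (vadd u w) v = (symp u v + symp w v) mod 2"
proof -
  have "[((u 0 + w 0) mod 2) * v 1 + ((u 1 + w 1) mod 2) * v 0 + ((u 2 + w 2) mod 2) * v 3 + ((u 3 + w 3) mod 2) * v 2
      + ((u 4 + w 4) mod 2) * v 5 + ((u 5 + w 5) mod 2) * v 4
    = (u 0 + w 0) * v 1 + (u 1 + w 1) * v 0 + (u 2 + w 2) * v 3 + (u 3 + w 3) * v 2 + (u 4 + w 4) * v 5 + (u 5 + w 5) * v 4] (mod 2)"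
    by (intro cong_add cong_mult cong_refl) (simp_all add: cong_def)
  then have "symp (vadd u w) v = ((u 0 + w 0) * v 1 + (u 1 + w 1) * v 0 + (u 2 + w 2) * v 3 + (u 3 + w 3) * v 2 + (u 4 + w 4) * v 5 + (u 5 + w 5) * v 4) mod 2"
    unfolding symp_eq vadd_def cong_def .
  also have "\<dots> = ((u 0 * v 1 + u 1 * v 0 + u 2 * v 3 + u 3 * v 2 + u 4 * v 5 + u 5 * v 4) + (w 0 * v 1 + w 1 * v 0 + w 2 * v 3 + w 3 * v 2 + w 4 * v 5 + w 5 * v 4)) mod 2"
    by (rule arg_cong[where f="\<lambda>n. n mod 2"]) (simp add: algebra_simps)
  also have "\<dots> = (symp u v + symp w v) mod 2" unfolding symp_eq by (rule mod_add_eq[symmetric])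
  finally show ?thesis .
qed

lemma symp_vadd_right: "symp v (vadd u w) = (symp v u + symp v w) mod 2"
  using symp_vadd_left symp_commute by metis

lemma Q0_less_2: "Q0 v < 2" unfolding Q0_def by simp
lemma Q0_vadd: "Q0 (vadd u v) = (Q0 u + Q0 v + symp u v) mod 2"
proof -
  have "Q0 (vadd u v) = ((u 0 + v 0) * (u 1 + v 1) + (u 2 + v 2) * (u 3 + v 3) + (u 4 + v 4) * (u 5 + v 5)
     + (u 4 + v 4) * (u 4 + v 4) + (u 5 + v 5) * (u 5 + v 5)) mod 2"
    unfolding Q0_def vadd_def cong_def[symmetric]
    by (intro cong_add cong_mult) (simp_all add: cong_def)
  also have "\<dots> = ((u 0 * u 1 + u 2 * u 3 + u 4 * u 5 + u 4 * u 4 + u 5 * u 5) + (v 0 * v 1 + v 2 * v 3 + v 4 * v 5 + v 4 * v 4 + v 5 * v 5)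
     + (u 0 * v 1 + u 1 * v 0 + u 2 * v 3 + u 3 * v 2 + u 4 * v 5 + u 5 * v 4) + 2 * (u 4 * v 4 + u 5 * v 5)) mod 2"
    by (rule arg_cong[where f="\<lambda>n. n mod 2"]) (simp add: algebra_simps)
  also have "\<dots> = (Q0 u + Q0 v + symp u v) mod 2"
  proof -
    have gen: "(A + B + C + 2 * D) mod 2 = (A mod 2 + B mod 2 + C mod 2) mod 2" for A B C D :: nat
    proof -
      have "(A + B + C + 2 * D) mod 2 = ((A + B) mod 2 + C mod 2) mod 2" by (simp only: mod_add_eq mod_mult_self2)
      also have "(A + B) mod 2 = (A mod 2 + B mod 2) mod 2" by (simp only: mod_add_eq)
      also have "((A mod 2 + B mod 2) mod 2 + C mod 2) mod 2 = (A mod 2 + B mod 2 + C mod 2) mod 2" by (rule mod_add_left_eq)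
      finally show ?thesis .
    qed
    show ?thesis unfolding Q0_def symp_eq by (rule gen)
  qed
  finally show ?thesis .
qed
lemma Q0_zvec: "Q0 zvec = 0" unfolding Q0_def by simp

section \<open>Induction along the basis, nondegeneracy and linear functionals\<close>

lemma F2_6_induct [consumes 1, case_names zero add]:
  assumes "v \<in> F2_6" "R zvec" "\<And>v i. v \<in> F2_6 \<Longrightarrow> i < 6 \<Longrightarrow> R v \<Longrightarrow> R (vadd v (ee i))"
  shows "R v"
  using assms(1)
proof (induction "card {i. i < 6 \<and> v i = 1}" arbitrary: v)
  case 0
  then have "v i = 0" for i using F2_6_less_2[of v i] unfolding F2_6_iff by (cases "i < 6") (auto simp: less_2_cases_iff)
  then have "v = zvec" by auto
  then show ?case using assms(2) by simp
next
  case (Suc k)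
  then obtain i where i: "i < 6" "v i = 1" by (metis (mono_tags, lifting) card.empty empty_Collect_eq nat.distinct(1))
  define w where "w = v(i := 0)"
  have w: "w \<in> F2_6" unfolding w_def using Suc(3) unfolding F2_6_iff by auto
  have v: "v = vadd w (ee i)"
    unfolding w_def vadd_def ee_def using i F2_6_less_2[OF Suc(3)] by (auto simp: fun_eq_iff)
  have "{i. i < 6 \<and> v i = 1} = insert i {i. i < 6 \<and> w i = 1}" unfolding w_def using i by auto
  moreover have "i \<notin> {i. i < 6 \<and> w i = 1}" unfolding w_def by simp
  ultimately have "k = card {i. i < 6 \<and> w i = 1}" using Suc(2) by simp
  then show ?case using Suc(1)[OF _ w] assms(3)[OF w i(1)] v by simp
qed

lemma less_6_cases: "i < 6 \<Longrightarrow> i = 0 \<or> i = 1 \<or> i = 2 \<or> i = 3 \<or> i = 4 \<or> i = (5 :: nat)" by linarith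

lemma symp_nondegenerate: assumes "u \<in> F2_6" "\<And>i. i < 6 \<Longrightarrow> symp u (ee i) = 0" shows "u = zvec"
proof
  fix i
  have "u i mod 2 = 0" if "i < 6"
    using less_6_cases[OF that] assms(2)[of 0] assms(2)[of 1] assms(2)[of 2] assms(2)[of 3] assms(2)[of 4] assms(2)[of 5]
    unfolding symp_eq ee_def by auto
  then show "u i = 0" using F2_6_less_2[OF assms(1), of i] assms(1) unfolding F2_6_iff by (cases "i < 6") auto
qed

lemma linear_functional_symp:
  assumes "\<And>v. v \<in> F2_6 \<Longrightarrow> l v < 2" "\<And>u v. u \<in> F2_6 \<Longrightarrow> v \<in> F2_6 \<Longrightarrow> l (vadd u v) = (l u + l v) mod 2"
  obtains c where "c \<in> F2_6" "\<And>v. v \<in> F2_6 \<Longrightarrow> l v = symp c v"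
proof -
  \<comment> \<open>The form pairs coordinate 2 k with 2 k + 1, so each coordinate of c is the value
    of l at the partner basis vector.\<close>
  define c where "c = (\<lambda>i. if i < 6 then l (ee (if even i then i + 1 else i - 1)) else 0)"
  have "(if even i then i + 1 else i - 1) < 6" if "i < 6" for i :: nat using less_6_cases[OF that] by auto
  then have c: "c \<in> F2_6" unfolding F2_6_iff c_def using assms(1) by auto
  have lz: "l zvec = 0" using assms(2)[of zvec zvec] assms(1)[of zvec] vadd_zvec[of zvec] by (auto simp: less_2_cases_iff)
  have e: "l (ee i) = symp c (ee i)" if "i < 6" for i
  proof -
    have ap: "ee i j = of_bool (i = j)" for i j by (simp add: ee_def)
    have "symp c (ee i) = l (ee i) mod 2"
      using less_6_cases[OF that] by (elim disjE) (simp_all add: symp_eq c_def ap)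
    then show ?thesis using assms(1)[of "ee i"] that by simp
  qed
  have "l v = symp c v" if "v \<in> F2_6" for v
    using that by (induction v rule: F2_6_induct) (simp_all add: lz symp_zvec assms(2) symp_vadd_right e)
  then show thesis using that c by blast
qed


section \<open>Models of the four graphs\<close>

fun lsymp :: "bool list \<Rightarrow> bool list \<Rightarrow> bool" where
  "lsymp (a # b # u) (c # d # v) = (((a \<and> d) \<noteq> (b \<and> c)) \<noteq> lsymp u v)"
| "lsymp _ _ = False"

text \<open>Executable counterpart of \<open>Q0\<close>: over the field with two elements,
  \<open>e \<or> f\<close> is the anisotropic form e f + e + f.\<close>

fun lquad :: "bool list \<Rightarrow> bool" where
  "lquad [a, b, c, d, e, f] = (((a \<and> b) \<noteq> (c \<and> d)) \<noteq> (e \<or> f))"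
| "lquad _ = False"

definition ladj :: "bool list \<Rightarrow> bool list \<Rightarrow> bool" where
  "ladj u v \<longleftrightarrow> u \<noteq> v \<and> \<not> lsymp u v"

definition singular_lists :: "bool list list" where
  "singular_lists = filter (\<lambda>u. \<not> lquad u \<and> True \<in> set u) (List.n_lists 6 [False, True])"

text \<open>The points of the quadric, of its intersection with a hyperplane, and so on: each of the
  four graphs is an induced subgraph of the next.\<close>

definition model_verts :: "nat \<Rightarrow> bool list list" where
  "model_verts s = (if s = 5 then singular_lists
     else if s = 3 then filter (\<lambda>u. \<not> u ! 5) singular_lists
     else if s = 2 then filter (\<lambda>u. \<not> u ! 5 \<and> \<not> u ! 4) singular_lists
     else filter (\<lambda>u. \<not> u ! 5 \<and> \<not> u ! 4 \<and> \<not> u ! 3 \<and> \<not> u ! 1) singular_lists)"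

definition srg_check :: "bool list list \<Rightarrow> nat \<Rightarrow> bool" where
  "srg_check L s \<longleftrightarrow> length L = 6 * s - 3 \<and> 0 < s \<and> list_all (\<lambda>u. let N = filter (ladj u) L in
     length N = 2 * s \<and> list_all (\<lambda>v. u = v \<or> length (filter (ladj v) N) = (if ladj u v then 1 else s)) L) L"

lemma check_5: "srg_check (model_verts 5) 5" by code_simp
lemma check_3: "srg_check (model_verts 3) 3" by code_simp
lemma check_2: "srg_check (model_verts 2) 2" by code_simp
lemma check_1: "srg_check (model_verts 1) 1" by code_simp

lemma lsymp_commute: "lsymp u v = lsymp v u"
  by (induction u v rule: lsymp.induct) auto

lemma ladj_sym: "ladj u v \<Longrightarrow> ladj v u"
  unfolding ladj_def using lsymp_commute by auto

lemma distinct_model_verts: "distinct (model_verts s)"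
  unfolding model_verts_def singular_lists_def by (simp add: distinct_n_lists)

lemma srg_check_imp_srg:
  assumes "srg_check L s" "distinct L"
  shows "srg (set L) (\<lambda>u v. u \<in> set L \<and> v \<in> set L \<and> ladj u v) s"
proof
  have len: "length L = 6 * s - 3" and s: "0 < s"
    and N: "\<And>u. u \<in> set L \<Longrightarrow> length (filter (ladj u) L) = 2 * s"
    and NN: "\<And>u v. u \<in> set L \<Longrightarrow> v \<in> set L \<Longrightarrow> u \<noteq> v \<Longrightarrow>
      length (filter (ladj v) (filter (ladj u) L)) = (if ladj u v then 1 else s)"
    using assms(1) unfolding srg_check_def Let_def list_all_iff by blast+
  have c: "card {w. w \<in> set L \<and> R w} = length (filter R L)" for R
    using distinct_card[of "filter R L"] assms(2) by simp
  show "finite (set L)" by simp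
  show "0 < s" by fact
  show "card (set L) = 6 * s - 3" using distinct_card[OF assms(2)] len by simp
  fix u v
  show "\<not> (u \<in> set L \<and> u \<in> set L \<and> ladj u u)" unfolding ladj_def by simp
  show "v \<in> set L \<and> u \<in> set L \<and> ladj v u" if "u \<in> set L \<and> v \<in> set L \<and> ladj u v"
    using that ladj_sym by blast
  show "card {w. u \<in> set L \<and> w \<in> set L \<and> ladj u w} = 2 * s" if "u \<in> set L"
    using that N[OF that] c[of "ladj u"] by simp
  have com: "card {w. (u \<in> set L \<and> w \<in> set L \<and> ladj u w) \<and> v \<in> set L \<and> w \<in> set L \<and> ladj v w} = (if ladj u v then 1 else s)"
    if "u \<in> set L" "v \<in> set L" "u \<noteq> v"
    using that NN[OF that] c[of "\<lambda>w. ladj u w \<and> ladj v w"] by (simp add: conj_ac cong: conj_cong)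
  show "card {w. (u \<in> set L \<and> w \<in> set L \<and> ladj u w) \<and> v \<in> set L \<and> w \<in> set L \<and> ladj v w} = 1"
    if "u \<in> set L \<and> v \<in> set L \<and> ladj u v" using com that unfolding ladj_def by auto
  show "card {w. (u \<in> set L \<and> w \<in> set L \<and> ladj u w) \<and> v \<in> set L \<and> w \<in> set L \<and> ladj v w} = s"
    if "u \<in> set L" "v \<in> set L" "u \<noteq> v" "\<not> (u \<in> set L \<and> v \<in> set L \<and> ladj u v)" using com that by auto
qed blast

text \<open>Carries the evaluated models to sets of natural numbers, via \<open>to_nat\<close>, and
  to vectors, via \<open>vec\<close>.\<close>

lemma srg_image:
  assumes "srg Y E s" and inj: "inj_on f Y"
    and E': "\<And>u v. E' u v \<longleftrightarrow> (\<exists>a\<in>Y. \<exists>b\<in>Y. u = f a \<and> v = f b \<and> E a b)"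
  shows "srg (f ` Y) E' s"
proof -
  interpret srg Y E s by fact
  have adj: "E' (f a) (f b) \<longleftrightarrow> E a b" if "a \<in> Y" "b \<in> Y" for a b
    using that inj E' unfolding inj_on_def by metis
  have in': "\<exists>a\<in>Y. \<exists>b\<in>Y. u = f a \<and> v = f b \<and> E a b" if "E' u v" for u v using E' that by blast
  have nb: "{w. E' (f a) w} = f ` {w. E a w}" if a: "a \<in> Y" for a
  proof (intro equalityI subsetI)
    fix w assume "w \<in> {w. E' (f a) w}"
    then have h: "E' (f a) w" by simp
    obtain b where b: "b \<in> Y" "w = f b" using in'[OF h] by blast
    then show "w \<in> f ` {w. E a w}" using h adj[OF a b(1)] by blast
  next
    fix w assume "w \<in> f ` {w. E a w}"
    then obtain b where b: "E a b" "w = f b" by blast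
    then have "b \<in> Y" using E_in by blast
    then show "w \<in> {w. E' (f a) w}" using adj[OF a] b by simp
  qed
  have inj': "inj_on f {w. E a w}" for a using inj by (rule inj_on_subset) (use E_in in blast)
  have inj'': "inj_on f {w. E a w \<and> E b w}" for a b using inj' by (rule inj_on_subset) blast
  have nb2: "{w. E' (f a) w \<and> E' (f b) w} = f ` {w. E a w \<and> E b w}" if "a \<in> Y" "b \<in> Y" for a b
  proof -
    have "{w. E' (f a) w \<and> E' (f b) w} = f ` {w. E a w} \<inter> f ` {w. E b w}" using nb that by blast
    also have "\<dots> = f ` ({w. E a w} \<inter> {w. E b w})"
      by (rule inj_on_image_Int[OF inj, symmetric]) (use E_in in blast)+
    finally show ?thesis by (simp add: Collect_conj_eq)
  qed
  show ?thesis
  proof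
    show "finite (f ` Y)" using finite_Y by simp
    show "0 < s" by (rule s_pos)
    show "card (f ` Y) = 6 * s - 3" using card_image[OF inj] card_Y by simp
    fix u v
    show "u \<in> f ` Y \<and> v \<in> f ` Y" if "E' u v" using in'[OF that] by blast
    show "\<not> E' u u"
    proof
      assume h: "E' u u"
      then obtain a where "a \<in> Y" "u = f a" using in' by blast
      then show False using h adj E_irrefl by blast
    qed
    show "E' v u" if h: "E' u v"
    proof -
      obtain a b where "a \<in> Y" "b \<in> Y" "u = f a" "v = f b" using in'[OF h] by blast
      then show ?thesis using h adj E_sym by simp
    qed
    show "card {w. E' u w} = 2 * s" if "u \<in> f ` Y"
      using that nb card_image[OF inj'] degree by auto
    show "card {w. E' u w \<and> E' v w} = 1" if h: "E' u v"
    proof -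
      obtain a b where "a \<in> Y" "b \<in> Y" "u = f a" "v = f b" "E a b" using in'[OF h] by blast
      then show ?thesis using nb2 card_image[OF inj''] lambda by simp
    qed
    show "card {w. E' u w \<and> E' v w} = s" if h: "u \<in> f ` Y" "v \<in> f ` Y" "u \<noteq> v" "\<not> E' u v"
    proof -
      obtain a b where ab: "a \<in> Y" "b \<in> Y" "u = f a" "v = f b" using h by blast
      then have "\<not> E a b" "a \<noteq> b" using h adj by auto
      then show ?thesis using ab nb2 card_image[OF inj''] mu by simp
    qed
  qed
qed

lemma model_srg: assumes "s \<in> {1, 2, 3, 5}"
  shows "srg (set (model_verts s)) (\<lambda>u v. u \<in> set (model_verts s) \<and> v \<in> set (model_verts s) \<and> ladj u v) s"
  using assms check_1 check_2 check_3 check_5 by (intro srg_check_imp_srg distinct_model_verts) auto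

lemma ex_extensible_nat: assumes "s \<in> {1, 2, 3, 5}"
  shows "\<exists>(Y :: nat set) E. extensible Y E 1 s (2 * s - 2)"
proof -
  have "srg (to_nat ` set (model_verts s)) (\<lambda>u v. \<exists>a\<in>set (model_verts s). \<exists>b\<in>set (model_verts s).
     u = to_nat a \<and> v = to_nat b \<and> (a \<in> set (model_verts s) \<and> b \<in> set (model_verts s) \<and> ladj a b)) s"
    by (rule srg_image[OF model_srg[OF assms]]) (auto intro: inj_on_subset[OF inj_to_nat])
  then show ?thesis using srg_imp_extensible by blast
qed

section \<open>Boolean lists as vectors\<close>

definition vec :: "bool list \<Rightarrow> nat \<Rightarrow> nat" where
  "vec l = (\<lambda>i. of_bool (i < length l \<and> l ! i))"

lemma bij_vec: "bij_betw vec {l. length l = 6} F2_6"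
  unfolding bij_betw_def
proof (intro conjI equalityI subsetI)
  show "inj_on vec {l. length l = 6}"
  proof (rule inj_onI)
    fix l m assume h: "l \<in> {l. length l = 6}" "m \<in> {l. length l = 6}" "vec l = vec m"
    show "l = m"
    proof (rule nth_equalityI)
      fix i assume "i < length l"
      then show "l ! i = m ! i" using fun_cong[OF h(3), of i] h(1,2) unfolding vec_def by (simp split: if_splits add: of_bool_eq_iff)
    qed (use h in simp)
  qed
next
  fix v assume "v \<in> vec ` {l. length l = 6}"
  then show "v \<in> F2_6" unfolding F2_6_iff vec_def by auto
next
  fix v assume v: "v \<in> F2_6"
  have "v = vec (map (\<lambda>i. v i = 1) [0..<6])"
  proof
    fix i show "v i = vec (map (\<lambda>i. v i = 1) [0..<6]) i"
      using v F2_6_less_2[OF v, of i] unfolding vec_def F2_6_iff by (cases "i < 6") (auto simp: less_2_cases_iff)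
  qed
  then show "v \<in> vec ` {l. length l = 6}" by (intro image_eqI[of _ _ "map (\<lambda>i. v i = 1) [0..<6]"]) auto
qed

lemma finite_F2_6: "finite F2_6" and card_F2_6: "card F2_6 = 64"
proof -
  have "finite {l :: bool list. length l = 6}" "card {l :: bool list. length l = 6} = 64"
    using finite_lists_length_eq[of "UNIV :: bool set" 6] card_lists_length_eq[of "UNIV :: bool set" 6] by simp_all
  then show "finite F2_6" "card F2_6 = 64" using bij_vec bij_betw_finite bij_betw_same_card by metis+
qed

lemma length_6: assumes "length l = 6" obtains a b c d e f where "l = [a, b, c, d, e, f]"
  using assms by (auto simp: numeral_eq_Suc length_Suc_conv)

lemma vec_nth: "vec [a, b, c, d, e, f] 0 = of_bool a" "vec [a, b, c, d, e, f] 1 = of_bool b" "vec [a, b, c, d, e, f] 2 = of_bool c"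
   "vec [a, b, c, d, e, f] 3 = of_bool d" "vec [a, b, c, d, e, f] 4 = of_bool e" "vec [a, b, c, d, e, f] 5 = of_bool f"
  unfolding vec_def by simp_all

lemma Q0_vec: assumes "length l = 6" shows "Q0 (vec l) = of_bool (lquad l)"
proof -
  obtain a b c d e f where l: "l = [a, b, c, d, e, f]" using length_6[OF assms] .
  show ?thesis unfolding l Q0_def vec_nth by (cases a; cases b; cases c; cases d; cases e; cases f) simp_all
qed

lemma symp_vec: assumes "length l = 6" "length m = 6" shows "symp (vec l) (vec m) = of_bool (lsymp l m)"
proof -
  have par: "(of_bool p1 + of_bool p2 + of_bool p3 + of_bool p4 + of_bool p5 + of_bool p6) mod (2 :: nat)
     = of_bool ((p1 \<noteq> p2) \<noteq> ((p3 \<noteq> p4) \<noteq> ((p5 \<noteq> p6) \<noteq> False)))" for p1 p2 p3 p4 p5 p6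
    by (cases p1; cases p2; cases p3; cases p4; cases p5; cases p6) simp_all
  obtain a b c d e f where l: "l = [a, b, c, d, e, f]" using length_6[OF assms(1)] .
  obtain a' b' c' d' e' f' where m: "m = [a', b', c', d', e', f']" using length_6[OF assms(2)] .
  show ?thesis unfolding l m symp_eq vec_nth of_bool_conj[symmetric] par lsymp.simps by simp
qed

section \<open>The elliptic quadric and its orthogonality graph\<close>

definition Sing :: "(nat \<Rightarrow> nat) set" where
  "Sing = {v \<in> F2_6. Q0 v = 0 \<and> v \<noteq> zvec}"

definition orth :: "(nat \<Rightarrow> nat) \<Rightarrow> (nat \<Rightarrow> nat) \<Rightarrow> bool" where
  "orth u v \<longleftrightarrow> u \<in> Sing \<and> v \<in> Sing \<and> u \<noteq> v \<and> symp u v = 0"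

lemma set_model_5: "set (model_verts 5) = {l. length l = 6 \<and> \<not> lquad l \<and> True \<in> set l}"
  unfolding model_verts_def singular_lists_def by (auto simp: set_n_lists)

lemma Sing_eq: "Sing = vec ` set (model_verts 5)"
proof -
  have z: "vec l = zvec \<longleftrightarrow> True \<notin> set l" for l
    unfolding vec_def fun_eq_iff in_set_conv_nth by auto
  have "F2_6 = vec ` {l. length l = 6}" using bij_vec by (simp add: bij_betw_def)
  then have "v \<in> Sing \<longleftrightarrow> (\<exists>l. length l = 6 \<and> v = vec l \<and> Q0 v = 0 \<and> v \<noteq> zvec)" for v
    unfolding Sing_def by blast
  moreover have "length l = 6 \<and> v = vec l \<and> Q0 v = 0 \<and> v \<noteq> zvec \<longleftrightarrow> v = vec l \<and> length l = 6 \<and> \<not> lquad l \<and> True \<in> set l" for v l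
    using z[of l] Q0_vec[of l] by auto
  ultimately show ?thesis unfolding set_model_5 by blast
qed

lemma srg_orth: "srg Sing orth 5"
  unfolding Sing_eq
proof (rule srg_image[OF model_srg])
  have inj: "inj_on vec {l. length l = 6}" using bij_vec by (simp add: bij_betw_def)
  have sub: "set (model_verts 5) \<subseteq> {l. length l = 6}" unfolding set_model_5 by blast
  show "inj_on vec (set (model_verts 5))" using inj sub by (rule inj_on_subset)
  fix u v
  have "orth (vec a) (vec b) \<longleftrightarrow> ladj a b" if "a \<in> set (model_verts 5)" "b \<in> set (model_verts 5)" for a b
  proof -
    have "length a = 6" "length b = 6" using that sub by blast+
    then show ?thesis using that symp_vec[of a b] inj_on_eq_iff[OF inj, of a b] unfolding orth_def Sing_eq ladj_def by simp
  qed
  note oa = this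
  show "orth u v \<longleftrightarrow> (\<exists>a\<in>set (model_verts 5). \<exists>b\<in>set (model_verts 5). u = vec a \<and> v = vec b \<and>
     (a \<in> set (model_verts 5) \<and> b \<in> set (model_verts 5) \<and> ladj a b))" (is "_ = ?r")
  proof
    assume o: "orth u v"
    then have "u \<in> vec ` set (model_verts 5)" "v \<in> vec ` set (model_verts 5)"
      unfolding orth_def Sing_eq by simp_all
    then obtain a b where ab: "a \<in> set (model_verts 5)" "u = vec a" "b \<in> set (model_verts 5)" "v = vec b" by blast
    then have "ladj a b" using o oa by simp
    with ab show ?r by blast
  next
    assume ?r
    then show "orth u v" using oa by blast
  qed
qed simp

text \<open>Read off from the graph: 27 singular points and the zero vector.\<close>

lemma card_Q0_zeros: "card {v \<in> F2_6. Q0 v = 0} = 28"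
proof -
  have "{v \<in> F2_6. Q0 v = 0} = insert zvec Sing" unfolding Sing_def using Q0_zvec by auto
  moreover have "card Sing = 27" using srg.card_Y[OF srg_orth] by simp
  moreover have "finite Sing" using srg.finite_Y[OF srg_orth] .
  ultimately show ?thesis by (simp add: Sing_def)
qed


section \<open>Elliptic quadratic forms\<close>

lemma srg_iso: assumes "srg Y E s" "srg Y' E' s" "s \<noteq> 1"
  obtains \<phi> where "bij_betw \<phi> Y Y'" "\<And>u v. u \<in> Y \<Longrightarrow> v \<in> Y \<Longrightarrow> E' (\<phi> u) (\<phi> v) = E u v"
proof -
  interpret F: srg Y E s by fact
  interpret G: srg Y' E' s by fact
  have s: "1 < s" using F.s_pos assms(3) by simp
  have "card Y \<noteq> 0" "card Y' \<noteq> 0" using F.card_Y G.card_Y s by simp_all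
  then obtain y y' where y: "y \<in> Y" "y' \<in> Y'" by fastforce
  have "card (F.far y) \<noteq> 0" "card (G.far y') \<noteq> 0" using F.card_far G.card_far y s by simp_all
  then obtain z z' where z: "z \<in> F.far y" "z' \<in> G.far y'" by fastforce
  obtain a where a: "frame Y E s y z a" using F.ex_frame[OF y(1) z(1)] .
  obtain a' where a': "frame Y' E' s y' z' a'" using G.ex_frame[OF y(2) z(2)] .
  show thesis using frame_iso[OF a a'] that by metis
qed

section \<open>Quadratic forms labelled by vectors\<close>

definition Qf :: "(nat \<Rightarrow> nat) \<Rightarrow> (nat \<Rightarrow> nat) \<Rightarrow> nat" where
  "Qf c = (\<lambda>v. if v \<in> F2_6 then (Q0 v + symp c v) mod 2 else 0)"

lemma bit_cases: "(n :: nat) < 2 \<Longrightarrow> n = 0 \<or> n = 1" by linarith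

lemmas Q0_bit = bit_cases[OF Q0_less_2] and symp_bit = bit_cases[OF symp_less_2]

lemma symp_ext: assumes "u \<in> F2_6" "v \<in> F2_6" "\<And>w. w \<in> F2_6 \<Longrightarrow> symp u w = symp v w" shows "u = v"
proof -
  have "vadd u v = zvec"
    by (rule symp_nondegenerate) (use assms in \<open>simp_all add: symp_vadd_left\<close>)
  then show ?thesis using vadd_eq_zvec assms by blast
qed

lemma Qf_inj: assumes "c \<in> F2_6" "d \<in> F2_6" "Qf c = Qf d" shows "c = d"
proof (rule symp_ext[OF assms(1,2)])
  fix w assume w: "w \<in> F2_6"
  then have "(Q0 w + symp c w) mod 2 = (Q0 w + symp d w) mod 2" using fun_cong[OF assms(3), of w] unfolding Qf_def by simp
  then show "symp c w = symp d w" using Q0_bit[of w] symp_bit[of c w] symp_bit[of d w] by auto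
qed

lemma Qf_qforms: "Qf c \<in> qforms"
proof -
  have "(Q0 (vadd u v) + symp c (vadd u v)) mod 2 = ((Q0 u + symp c u) mod 2 + (Q0 v + symp c v) mod 2 + symp u v) mod 2" for u v
    unfolding Q0_vadd symp_vadd_right
    using Q0_bit[of u] Q0_bit[of v] symp_bit[of c u] symp_bit[of c v] symp_bit[of u v] by (elim disjE) simp_all
  then show ?thesis unfolding qforms_def Qf_def by simp
qed

text \<open>Two forms with the same polarisation differ by an additive function, and nondegeneracy
  represents it by a vector.\<close>

lemma qforms_Qf: assumes "Q \<in> qforms" obtains c where "c \<in> F2_6" "Q = Qf c"
proof -
  define l where "l v = (Q v + Q0 v) mod 2" for v
  have Q: "\<And>v. v \<in> F2_6 \<Longrightarrow> Q v < 2" "\<And>v. v \<notin> F2_6 \<Longrightarrow> Q v = 0"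
    "\<And>u v. u \<in> F2_6 \<Longrightarrow> v \<in> F2_6 \<Longrightarrow> Q (vadd u v) = (Q u + Q v + symp u v) mod 2"
    using assms unfolding qforms_def by auto
  have l2: "l v < 2" for v unfolding l_def by simp
  have ladd: "l (vadd u v) = (l u + l v) mod 2" if "u \<in> F2_6" "v \<in> F2_6" for u v
    unfolding l_def Q0_vadd Q(3)[OF that]
    using Q0_bit[of u] Q0_bit[of v] bit_cases[OF Q(1)[OF that(1)]] bit_cases[OF Q(1)[OF that(2)]] symp_bit[of u v]
    by (elim disjE) simp_all
  obtain c where c: "c \<in> F2_6" "\<And>v. v \<in> F2_6 \<Longrightarrow> l v = symp c v"
    using linear_functional_symp[of l, OF l2 ladd] by metis
  have "Q v = Qf c v" for v
  proof (cases "v \<in> F2_6")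
    case True
    then show ?thesis using c(2)[OF True] bit_cases[OF Q(1)[OF True]] Q0_bit[of v] unfolding Qf_def l_def by auto
  next
    case False
    then show ?thesis using Q(2) unfolding Qf_def by simp
  qed
  then show thesis using that c by blast
qed

text \<open>Completing the square: Q0 (v + c) + Q0 c = Q0 v + symp c v. Translation by c takes the
  zeros to a level set of \<open>Q0\<close>, of size 28 or 64 - 28 = 36.\<close>

lemma Qf_zeros: assumes c: "c \<in> F2_6" shows "card {v \<in> F2_6. Qf c v = 0} = (if Q0 c = 0 then 28 else 36)"
proof -
  have z: "Qf c v = 0 \<longleftrightarrow> Q0 (vadd v c) = Q0 c" if "v \<in> F2_6" for v
    using that symp_commute[of c v] Q0_bit[of v] Q0_bit[of c] symp_bit[of v c] unfolding Qf_def Q0_vadd by auto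
  have vc: "vadd (vadd v c) c = v" if "v \<in> F2_6" for v
    using vadd_cancel[OF that, of c] vadd_commute by metis
  have "bij_betw (\<lambda>v. vadd v c) {v \<in> F2_6. Qf c v = 0} {w \<in> F2_6. Q0 w = Q0 c}"
  proof (rule bij_betw_byWitness[of _ "\<lambda>v. vadd v c"])
    show "\<forall>v\<in>{v \<in> F2_6. Qf c v = 0}. vadd (vadd v c) c = v" "\<forall>v\<in>{w \<in> F2_6. Q0 w = Q0 c}. vadd (vadd v c) c = v"
      using vc by blast+
    show "(\<lambda>v. vadd v c) ` {v \<in> F2_6. Qf c v = 0} \<subseteq> {w \<in> F2_6. Q0 w = Q0 c}" using z c by auto
    show "(\<lambda>v. vadd v c) ` {w \<in> F2_6. Q0 w = Q0 c} \<subseteq> {v \<in> F2_6. Qf c v = 0}" using z c vc by auto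
  qed
  then have e: "card {v \<in> F2_6. Qf c v = 0} = card {w \<in> F2_6. Q0 w = Q0 c}" by (rule bij_betw_same_card)
  show ?thesis
  proof (cases "Q0 c = 0")
    case True then show ?thesis using e card_Q0_zeros by simp
  next
    case False
    then have "Q0 w = Q0 c \<longleftrightarrow> Q0 w \<noteq> 0" for w using Q0_bit[of c] Q0_bit[of w] by auto
    then have "{w \<in> F2_6. Q0 w = Q0 c} = F2_6 - {w \<in> F2_6. Q0 w = 0}" by auto
    then have "card {w \<in> F2_6. Q0 w = Q0 c} = 64 - 28"
      using card_Diff_subset[of "{w \<in> F2_6. Q0 w = 0}" F2_6] finite_F2_6 card_F2_6 card_Q0_zeros by auto
    then show ?thesis using e False by simp
  qed
qed

lemma ell_forms_eq: "ell_forms = Qf ` {c \<in> F2_6. Q0 c = 0}"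
proof (intro equalityI subsetI)
  fix Q assume Q: "Q \<in> ell_forms"
  then obtain c where c: "c \<in> F2_6" "Q = Qf c" using qforms_Qf unfolding ell_forms_def by blast
  then have "Q0 c = 0" using Qf_zeros[OF c(1)] Q unfolding ell_forms_def by (auto split: if_splits)
  then show "Q \<in> Qf ` {c \<in> F2_6. Q0 c = 0}" using c by blast
next
  fix Q assume "Q \<in> Qf ` {c \<in> F2_6. Q0 c = 0}"
  then obtain c where c: "c \<in> F2_6" "Q0 c = 0" "Q = Qf c" by blast
  then show "Q \<in> ell_forms" unfolding ell_forms_def using Qf_qforms Qf_zeros[OF c(1)] by simp
qed

lemma Sp6_2D: assumes "g \<in> Sp6_2"
  shows "bij_betw g F2_6 F2_6" "\<And>u v. u \<in> F2_6 \<Longrightarrow> v \<in> F2_6 \<Longrightarrow> g (vadd u v) = vadd (g u) (g v)"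
    "\<And>u v. u \<in> F2_6 \<Longrightarrow> v \<in> F2_6 \<Longrightarrow> symp (g u) (g v) = symp u v" "\<And>v. v \<in> F2_6 \<Longrightarrow> g v \<in> F2_6"
    "\<And>u v. u \<in> F2_6 \<Longrightarrow> v \<in> F2_6 \<Longrightarrow> g u = g v \<Longrightarrow> u = v" "g zvec = zvec"
proof -
  show b: "bij_betw g F2_6 F2_6" and a: "\<And>u v. u \<in> F2_6 \<Longrightarrow> v \<in> F2_6 \<Longrightarrow> g (vadd u v) = vadd (g u) (g v)"
    and "\<And>u v. u \<in> F2_6 \<Longrightarrow> v \<in> F2_6 \<Longrightarrow> symp (g u) (g v) = symp u v"
    using assms unfolding Sp6_2_def by auto
  show i: "\<And>v. v \<in> F2_6 \<Longrightarrow> g v \<in> F2_6" using bij_betwE[OF b] by blast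
  show "\<And>u v. u \<in> F2_6 \<Longrightarrow> v \<in> F2_6 \<Longrightarrow> g u = g v \<Longrightarrow> u = v" using inj_onD[OF bij_betw_imp_inj_on[OF b]] by blast
  show "g zvec = zvec" using a[of zvec zvec] vadd_self[of zvec] vadd_self[of "g zvec"] by simp
qed

lemma Sp6_2_comp: assumes "g \<in> Sp6_2" "g' \<in> Sp6_2" shows "g \<circ> g' \<in> Sp6_2"
  unfolding Sp6_2_def
  using bij_betw_trans[OF Sp6_2D(1)[OF assms(2)] Sp6_2D(1)[OF assms(1)]]
  by (simp add: Sp6_2D(2,3,4)[OF assms(1)] Sp6_2D(2,3,4)[OF assms(2)])

text \<open>States, without inverting g, that g carries \<open>Q0\<close> to \<open>Qf c\<close>.
  The affine map d -> c + g d then describes the action of g on the labels of all forms.\<close>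

definition moves_Q0 :: "((nat \<Rightarrow> nat) \<Rightarrow> nat \<Rightarrow> nat) \<Rightarrow> (nat \<Rightarrow> nat) \<Rightarrow> bool" where
  "moves_Q0 g c \<longleftrightarrow> (\<forall>v\<in>F2_6. Q0 v = (Q0 (g v) + symp c (g v)) mod 2)"

lemma qact_Qf: assumes g: "g \<in> Sp6_2" and m: "moves_Q0 g c" and d: "d \<in> F2_6"
  shows "qact g (Qf d) = Qf (vadd c (g d))"
proof
  fix v
  show "qact g (Qf d) v = Qf (vadd c (g d)) v"
  proof (cases "v \<in> F2_6")
    case True
    define w where "w = inv_into F2_6 g v"
    have w: "w \<in> F2_6" "g w = v"
      using bij_betw_inv_into_right[OF Sp6_2D(1)[OF g] True] bij_betwE[OF bij_betw_inv_into[OF Sp6_2D(1)[OF g]]] True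
      unfolding w_def by auto
    have "Q0 w = (Q0 v + symp c v) mod 2" using m w unfolding moves_Q0_def by auto
    moreover have "symp d w = symp (g d) v" using Sp6_2D(3)[OF g d w(1)] w by simp
    ultimately show ?thesis
      unfolding qact_def Qf_def w_def[symmetric] symp_vadd_left using True w
      using Q0_bit[of v] symp_bit[of c v] symp_bit[of "g d" v] by (elim disjE) simp_all
  qed (simp add: qact_def Qf_def)
qed

text \<open>The transported form differs from \<open>Q0\<close> by an additive function, hence by
  some \<open>symp c\<close>. As g is bijective it still has 28 zeros, and this forces
  \<open>Q0 c = 0\<close>.\<close>

lemma ex_moves_Q0: assumes g: "g \<in> Sp6_2"
  obtains c where "c \<in> F2_6" "Q0 c = 0" "moves_Q0 g c"
proof -
  define k where "k = inv_into F2_6 g"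
  note D = Sp6_2D[OF g]
  have k: "k v \<in> F2_6" "g (k v) = v" if "v \<in> F2_6" for v
    using bij_betw_inv_into_right[OF D(1) that] bij_betwE[OF bij_betw_inv_into[OF D(1)]] that unfolding k_def by auto
  have kg: "k (g v) = v" if "v \<in> F2_6" for v using D(5)[OF k(1) that] k(2) D(4) that by blast
  have kadd: "k (vadd u v) = vadd (k u) (k v)" if "u \<in> F2_6" "v \<in> F2_6" for u v
    by (rule D(5)) (use k that D(2) in auto)
  have ks: "symp (k u) (k v) = symp u v" if "u \<in> F2_6" "v \<in> F2_6" for u v
    using D(3)[of "k u" "k v"] k that by simp
  define l where "l v = (Q0 (k v) + Q0 v) mod 2" for v
  have l2: "l v < 2" for v unfolding l_def by simp
  have ladd: "l (vadd u v) = (l u + l v) mod 2" if "u \<in> F2_6" "v \<in> F2_6" for u v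
    unfolding l_def kadd[OF that] Q0_vadd ks[OF that]
    using Q0_bit[of u] Q0_bit[of v] Q0_bit[of "k u"] Q0_bit[of "k v"] symp_bit[of u v] by (elim disjE) simp_all
  obtain c where c: "c \<in> F2_6" "\<And>v. v \<in> F2_6 \<Longrightarrow> l v = symp c v"
    using linear_functional_symp[of l, OF l2 ladd] by metis
  have m: "moves_Q0 g c" unfolding moves_Q0_def
  proof
    fix v assume v: "v \<in> F2_6"
    show "Q0 v = (Q0 (g v) + symp c (g v)) mod 2"
      unfolding c(2)[OF D(4)[OF v], symmetric] l_def kg[OF v] using Q0_bit[of v] Q0_bit[of "g v"] by (elim disjE) simp_all
  qed
  have "bij_betw g {v \<in> F2_6. Q0 v = 0} {v \<in> F2_6. Qf c v = 0}"
  proof (rule bij_betw_byWitness[of _ k])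
    have q: "Qf c (g v) = Q0 v" if "v \<in> F2_6" for v 
      using m[unfolded moves_Q0_def, rule_format, OF that, symmetric] D(4)[OF that] by (simp add: Qf_def)
    show "\<forall>v\<in>{v \<in> F2_6. Q0 v = 0}. k (g v) = v" using kg by blast
    show "\<forall>v\<in>{v \<in> F2_6. Qf c v = 0}. g (k v) = v" using k by blast
    show "g ` {v \<in> F2_6. Q0 v = 0} \<subseteq> {v \<in> F2_6. Qf c v = 0}" using q D(4) by auto
    show "k ` {v \<in> F2_6. Qf c v = 0} \<subseteq> {v \<in> F2_6. Q0 v = 0}"
    proof clarify
      fix v assume v: "v \<in> F2_6" "Qf c v = 0"
      show "k v \<in> F2_6 \<and> Q0 (k v) = 0" using q[OF k(1)[OF v(1)]] k[OF v(1)] v by simp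
    qed
  qed
  from bij_betw_same_card[OF this] have "card {v \<in> F2_6. Qf c v = 0} = 28" using card_Q0_zeros by simp
  then have "Q0 c = 0" using Qf_zeros[OF c(1)] by (simp split: if_splits)
  then show thesis using that c m by blast
qed

section \<open>Symplectic transvections\<close>

definition tv :: "(nat \<Rightarrow> nat) \<Rightarrow> (nat \<Rightarrow> nat) \<Rightarrow> nat \<Rightarrow> nat" where
  "tv c v = (if symp c v = 0 then v else vadd v c)"

lemma symp_tv: "symp c (tv c v) = symp c v"
  using symp_less_2[of c v] by (cases "symp c v = 0") (simp_all add: tv_def symp_vadd_right symp_self)

lemma tv_tv: assumes "v \<in> F2_6" shows "tv c (tv c v) = v"
  using symp_tv[of c v] vadd_cancel[OF assms, of c] vadd_commute unfolding tv_def by metis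

lemma tv_Sp: assumes c: "c \<in> F2_6" shows "tv c \<in> Sp6_2"
proof -
  have i: "tv c v \<in> F2_6" if "v \<in> F2_6" for v unfolding tv_def using c that by simp
  have "bij_betw (tv c) F2_6 F2_6" by (rule bij_betw_byWitness[of _ "tv c"]) (use tv_tv i in auto)
  moreover have "tv c (vadd u v) = vadd (tv c u) (tv c v)" if "u \<in> F2_6" "v \<in> F2_6" for u v
  proof -
    have "vadd (vadd u c) (vadd v c) = vadd u v"
      using vadd_cancel[of "vadd u v" c] that by (simp add: vadd_assoc vadd_commute vadd_left_commute)
    moreover have "vadd (vadd u v) c = vadd (vadd u c) v" "vadd (vadd u v) c = vadd u (vadd v c)"
      by (simp_all add: vadd_assoc vadd_commute vadd_left_commute)
    ultimately show ?thesis unfolding tv_def symp_vadd_right using symp_bit[of c u] symp_bit[of c v] by auto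
  qed
  moreover have "symp (tv c u) (tv c v) = symp u v" for u v
    unfolding tv_def using symp_bit[of c u] symp_bit[of c v] symp_bit[of u v] symp_commute[of u c] symp_commute[of v c]
    by (auto simp: symp_vadd_left symp_vadd_right symp_self)
  ultimately show ?thesis unfolding Sp6_2_def by blast
qed

text \<open>The vector c is added exactly when the bit \<open>symp c v\<close> is 1, and for a zero
  c of \<open>Q0\<close> this changes the form by that bit. So \<open>tv c\<close> takes
  \<open>Q0\<close> to \<open>Qf c\<close>.\<close>

lemma Q0_tv: assumes "Q0 c = 0" shows "Q0 (tv c v) = (Q0 v + symp c v) mod 2"
  unfolding tv_def using assms symp_bit[of c v] symp_commute[of v c] Q0_less_2[of v] by (auto simp: Q0_vadd)

lemma moves_Q0_tv_comp: assumes "Q0 c = 0" "\<And>v. v \<in> F2_6 \<Longrightarrow> Q0 (g v) = Q0 v"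
  shows "moves_Q0 (tv c \<circ> g) c"
  unfolding moves_Q0_def
proof
  fix v assume "v \<in> F2_6"
  then show "Q0 v = (Q0 ((tv c \<circ> g) v) + symp c ((tv c \<circ> g) v)) mod 2"
    using assms Q0_tv[OF assms(1), of "g v"] symp_tv[of c "g v"] Q0_bit[of v] symp_bit[of c "g v"] by auto
qed


section \<open>Linearity of graph automorphisms of the quadric\<close>

lemma orth_iff: "u \<in> Sing \<Longrightarrow> v \<in> Sing \<Longrightarrow> u \<noteq> v \<Longrightarrow> orth u v \<longleftrightarrow> symp u v = 0"
  unfolding orth_def by simp

lemma SingD: "u \<in> Sing \<Longrightarrow> u \<in> F2_6" "u \<in> Sing \<Longrightarrow> Q0 u = 0" "u \<in> Sing \<Longrightarrow> u \<noteq> zvec"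
  unfolding Sing_def by auto

text \<open>The lines of the graph are the totally singular lines of the quadric.\<close>

lemma third_orth: assumes "orth u v" shows "srg.third orth u v = vadd u v"
proof (rule srg.third_eq[OF srg_orth, OF assms])
  have uv: "u \<in> Sing" "v \<in> Sing" "u \<noteq> v" "symp u v = 0" using assms unfolding orth_def by auto
  have F: "u \<in> F2_6" "v \<in> F2_6" using uv SingD by auto
  have "vadd u v \<noteq> zvec" using vadd_eq_zvec[OF F] uv by blast
  moreover have "Q0 (vadd u v) = 0" using uv SingD(2)[OF uv(1)] SingD(2)[OF uv(2)] by (simp add: Q0_vadd)
  ultimately have S: "vadd u v \<in> Sing" unfolding Sing_def using F by simp
  have "u \<noteq> vadd u v"
  proof
    assume "u = vadd u v"
    then have "vadd u u = vadd u (vadd u v)" by simp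
    then show False using vadd_self[of u] vadd_cancel[OF F(2)] SingD(3)[OF uv(2)] by simp
  qed
  moreover have "v \<noteq> vadd u v"
  proof
    assume "v = vadd u v"
    then have "vadd v v = vadd v (vadd v u)" using vadd_commute by metis
    then show False using vadd_self[of v] vadd_cancel[OF F(1)] SingD(3)[OF uv(1)] by simp
  qed
  ultimately show "orth u (vadd u v)" "orth v (vadd u v)"
    unfolding orth_def using S uv symp_commute[of v u] by (simp_all add: symp_vadd_right symp_self)
qed

abbreviation "e23 \<equiv> vadd (ee 2) (ee 3)"

text \<open>The five singular vectors orthogonal to the hyperbolic pair \<open>ee 0\<close>,
  \<open>ee 1\<close>. Since \<open>Q0\<close> is 1 on \<open>e23\<close>, adding it makes the
  nonzero vectors of the anisotropic plane singular. The first four entries and the hyperbolic pair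
  form a basis.\<close>

definition frame_pts :: "(nat \<Rightarrow> nat) list" where
  "frame_pts = [ee 2, ee 3, vadd e23 (ee 4), vadd e23 (ee 5), vadd (vadd e23 (ee 4)) (ee 5)]"

lemma ee_apply: "ee i j = of_bool (i = j)" unfolding ee_def ..
lemma vadd_apply: "vadd u v j = (u j + v j) mod 2" unfolding vadd_def ..

lemma in_Sing: assumes "v \<in> F2_6" "Q0 v = 0" "v i \<noteq> 0" shows "v \<in> Sing"
  unfolding Sing_def using assms by auto

lemma ee_Sing: assumes "i < 4" shows "ee i \<in> Sing"
proof (rule in_Sing[where i=i])
  show "ee i \<in> F2_6" using assms by simp
  show "Q0 (ee i) = 0" using assms unfolding Q0_def ee_apply by simp
  show "ee i i \<noteq> 0" unfolding ee_apply by simp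
qed

lemma frame_pts_adj: "\<forall>v\<in>set frame_pts. v \<in> Sing \<and> orth (ee 0) v \<and> orth (ee 1) v"
proof
  fix v assume v: "v \<in> set frame_pts"
  have F: "v \<in> F2_6" using v unfolding frame_pts_def by auto
  have q: "Q0 v = 0" using v unfolding frame_pts_def Q0_def by (auto simp: ee_apply vadd_apply)
  have c: "v 0 = 0" "v 1 = 0" "v 2 \<noteq> 0 \<or> v 3 \<noteq> 0" using v unfolding frame_pts_def by (auto simp: ee_apply vadd_apply)
  then have S: "v \<in> Sing" using in_Sing[OF F q] by blast
  have s: "symp (ee 0) v = 0" "symp (ee 1) v = 0" unfolding symp_eq ee_apply using c by simp_all
  have "ee 0 \<noteq> v" "ee 1 \<noteq> v" using c ee_apply[of 0 0] ee_apply[of 1 1] by auto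
  then show "v \<in> Sing \<and> orth (ee 0) v \<and> orth (ee 1) v" unfolding orth_def using S s ee_Sing[of 0] ee_Sing[of 1] by simp
qed

lemma distinct_frame_pts: "distinct frame_pts"
proof -
  have "distinct (map (\<lambda>v. (v 2, v 3, v 4, v 5)) frame_pts)"
    unfolding frame_pts_def by (simp add: ee_apply vadd_apply)
  then show ?thesis by (simp add: distinct_map)
qed

lemma orth_frame: "frame Sing orth 5 (ee 0) (ee 1) ((!) frame_pts)"
proof -
  interpret srg Sing orth 5 by (rule srg_orth)
  have y: "ee 0 \<in> Sing" and zS: "ee 1 \<in> Sing" using ee_Sing by auto
  have "ee 0 0 \<noteq> ee 1 0" by (simp add: ee_apply)
  then have "ee 0 \<noteq> ee 1" by metis
  moreover have "symp (ee 0) (ee 1) = 1" unfolding symp_eq by (simp add: ee_apply)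
  ultimately have z: "ee 1 \<in> far (ee 0)" unfolding far_def orth_def using zS by auto
  have "set frame_pts = {w. orth (ee 0) w \<and> orth (ee 1) w}"
    using frame_pts_adj distinct_card[OF distinct_frame_pts] card_common[OF y z]
    by (intro card_subset_eq finite_nbrs) (auto simp: frame_pts_def)
  then have "frame_pts \<in> permutations_of_set {w. orth (ee 0) w \<and> orth (ee 1) w}"
    unfolding permutations_of_set_def using distinct_frame_pts by simp
  then show ?thesis by (rule frame_of[OF y z])
qed

text \<open>A graph automorphism of the quadric is linear: the unique linear map agreeing with it on a
  basis contained in a frame is symplectic because orthogonality is adjacency, so rigidity of frames
  applies.\<close>

lemma orth_automorphism_linear:
  assumes adj: "\<And>u v. u \<in> Sing \<Longrightarrow> v \<in> Sing \<Longrightarrow> orth (\<theta> u) (\<theta> v) = orth u v"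
    and \<theta>S: "\<And>u. u \<in> Sing \<Longrightarrow> \<theta> u \<in> Sing" and inj: "inj_on \<theta> Sing"
  shows "\<exists>g\<in>Sp6_2. (\<forall>v\<in>F2_6. Q0 (g v) = Q0 v) \<and> (\<forall>u\<in>Sing. g u = \<theta> u)"
proof -
  interpret F: frame Sing orth 5 "ee 0" "ee 1" "(!) frame_pts" by (rule orth_frame)
  have sT: "symp (\<theta> p) (\<theta> q) = symp p q" if "p \<in> Sing" "q \<in> Sing" for p q
  proof (cases "p = q")
    case True then show ?thesis by (simp add: symp_self)
  next
    case False
    then have "\<theta> p \<noteq> \<theta> q" using inj_onD[OF inj] that by blast
    then have "symp (\<theta> p) (\<theta> q) = 0 \<longleftrightarrow> symp p q = 0"
      using adj[OF that] orth_iff[OF that False] orth_iff[OF \<theta>S[OF that(1)] \<theta>S[OF that(2)]] by blast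
    then show ?thesis using symp_bit[of p q] symp_bit[of "\<theta> p" "\<theta> q"] by auto
  qed
  \<comment> \<open>The basis vectors \<open>ee 4\<close> and \<open>ee 5\<close> are not singular,
    so their images have to be recovered from the singular vectors \<open>t 4\<close> and
    \<open>t 5\<close>.\<close>
  define t where "t i = vadd e23 (ee i)" for i
  define T where "T i = vadd (vadd (\<theta> (ee 2)) (\<theta> (ee 3))) (\<theta> (t i))" for i
  define w where "w i = (if i < 4 then \<theta> (ee i) else T i)" for i
  have tS: "t 4 \<in> Sing" "t 5 \<in> Sing" using frame_pts_adj unfolding frame_pts_def t_def by auto
  have et: "ee i = vadd e23 (t i)" if "i < 6" for i unfolding t_def using vadd_cancel[of "ee i" e23] that by simp
  have eS: "ee i \<in> Sing" if "i < 4" for i using ee_Sing that .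
  have c45: "i < 4 \<or> (\<not> i < 4 \<and> t i \<in> Sing)" if "i < 6" for i using less_6_cases[OF that] tS by auto
  have \<theta>F: "\<theta> p \<in> F2_6" if "p \<in> Sing" for p using \<theta>S that SingD by blast
  have wF: "w i \<in> F2_6" if "i < 6" for i
    using c45[OF that] \<theta>F eS unfolding w_def T_def by auto
  have s1: "symp (w i) (\<theta> p) = symp (ee i) p" if i: "i < 6" and p: "p \<in> Sing" for i p
    using c45[OF i]
  proof
    assume "i < 4" then show ?thesis unfolding w_def using sT eS p by simp
  next
    assume h: "\<not> i < 4 \<and> t i \<in> Sing"
    then have "w i = T i" unfolding w_def by simp
    then have "symp (w i) (\<theta> p) = symp (vadd e23 (t i)) p"
      using sT[OF _ p] eS h by (simp add: T_def symp_vadd_left)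
    then show ?thesis using et[OF i] by simp
  qed
  have s2: "symp (w i) (w j) = symp (ee i) (ee j)" if i: "i < 6" and j: "j < 6" for i j
    using c45[OF j]
  proof
    assume "j < 4" then show ?thesis using s1[OF i eS] unfolding w_def[of j] by simp
  next
    assume h: "\<not> j < 4 \<and> t j \<in> Sing"
    then have "w j = T j" unfolding w_def by simp
    then have "symp (w i) (w j) = symp (ee i) (vadd e23 (t j))"
      using s1[OF i] eS h by (simp add: T_def symp_vadd_right)
    then show ?thesis using et[OF j] by simp
  qed
  have q: "Q0 (w i) = Q0 (ee i)" if i: "i < 6" for i
    using c45[OF i]
  proof
    assume "i < 4" then show ?thesis unfolding w_def using eS \<theta>S SingD(2) by simp
  next
    assume h: "\<not> i < 4 \<and> t i \<in> Sing"
    then have "w i = T i" unfolding w_def by simp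
    then have "Q0 (w i) = Q0 (vadd e23 (t i))"
      using sT eS \<theta>S SingD(2) h by (simp add: T_def Q0_vadd symp_vadd_left)
    then show ?thesis using et[OF i] by simp
  qed
  define g where "g v = (\<lambda>j. (\<Sum>i<6. v i * w i j) mod 2)" for v :: "nat \<Rightarrow> nat"
  have gF: "g v \<in> F2_6" for v
    unfolding F2_6_iff g_def using wF unfolding F2_6_iff by simp
  have gadd: "g (vadd u v) = vadd (g u) (g v)" for u v
  proof
    fix j
    have "[(\<Sum>i<6. ((u i + v i) mod 2) * w i j) = (\<Sum>i<6. (u i + v i) * w i j)] (mod 2)"
      by (intro cong_sum cong_mult cong_refl) (simp add: cong_def)
    then have "g (vadd u v) j = (\<Sum>i<6. (u i + v i) * w i j) mod 2" unfolding g_def vadd_def cong_def .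
    also have "\<dots> = ((\<Sum>i<6. u i * w i j) + (\<Sum>i<6. v i * w i j)) mod 2" by (simp add: algebra_simps sum.distrib)
    also have "\<dots> = vadd (g u) (g v) j" unfolding g_def vadd_def by (rule mod_add_eq[symmetric])
    finally show "g (vadd u v) j = vadd (g u) (g v) j" .
  qed
  have gz: "g zvec = zvec" unfolding g_def by simp
  have ge: "g (ee i) = w i" if "i < 6" for i
  proof
    fix j
    have "(\<Sum>k<6. ee i k * w k j) = (\<Sum>k<6. if k = i then w k j else 0)" unfolding ee_apply by (intro sum.cong) auto
    also have "\<dots> = w i j" using that by simp
    finally show "g (ee i) j = w i j" unfolding g_def using F2_6_less_2[OF wF[OF that], of j] by simp
  qed
  have gs1: "symp (g u) (w j) = symp u (ee j)" if "u \<in> F2_6" "j < 6" for u j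
    using that(1) by (induction u rule: F2_6_induct) (simp_all add: gz symp_zvec gadd ge symp_vadd_left s2 that(2))
  have gs: "symp (g u) (g v) = symp u v" if "u \<in> F2_6" "v \<in> F2_6" for u v
    using that(2) by (induction v rule: F2_6_induct) (simp_all add: gz symp_zvec gadd ge symp_vadd_right gs1 that(1))
  have gQ: "Q0 (g v) = Q0 v" if "v \<in> F2_6" for v
    using that by (induction v rule: F2_6_induct) (simp_all add: gz gadd ge Q0_vadd q gs1)
  have ginj: "u = v" if "u \<in> F2_6" "v \<in> F2_6" "g u = g v" for u v
  proof (rule symp_ext[OF that(1,2)])
    fix x assume "x \<in> F2_6"
    then show "symp u x = symp v x" using gs[OF that(1), of x] gs[OF that(2), of x] that(3) by simp
  qed
  have "inj_on g F2_6" using ginj by (rule inj_onI)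
  moreover have "g ` F2_6 = F2_6"
    by (rule endo_inj_surj[OF finite_F2_6]) (use gF calculation in auto)
  ultimately have gSp: "g \<in> Sp6_2" unfolding Sp6_2_def bij_betw_def using gadd gs by simp
  have gS: "g u \<in> Sing" if "u \<in> Sing" for u
  proof -
    have "g u \<noteq> zvec" using ginj[of u zvec] gz SingD[OF that] by auto
    then show ?thesis unfolding Sing_def using gF gQ SingD[OF that] by simp
  qed
  have gorth: "orth (g u) (g v)" if "orth u v" for u v
  proof -
    have uv: "u \<in> Sing" "v \<in> Sing" "u \<noteq> v" "symp u v = 0" using that unfolding orth_def by auto
    then have "g u \<noteq> g v" using ginj SingD by blast
    then show ?thesis unfolding orth_def using uv gS gs SingD by simp
  qed
  have \<theta>orth: "orth (\<theta> u) (\<theta> v)" if "orth u v" for u v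
    using adj[of u v] that unfolding orth_def[of u v] by blast
  have g4: "g (ee i) = \<theta> (ee i)" if "i < 4" for i using ge[of i] that unfolding w_def by simp
  have gt: "g (t i) = \<theta> (t i)" if "t i \<in> Sing" "i < 6" "\<not> i < 4" for i
  proof -
    have "g (t i) = vadd (vadd (\<theta> (ee 2)) (\<theta> (ee 3))) (T i)"
      unfolding t_def gadd using g4[of 2] g4[of 3] ge[OF that(2)] that(3) unfolding w_def by simp
    then show ?thesis unfolding T_def using vadd_cancel[OF \<theta>F[OF that(1)]] by simp
  qed
  let ?P = "\<lambda>i. frame_pts ! i"
  have Pn: "?P 0 = ee 2" "?P 1 = ee 3" "?P 2 = t 4" "?P 3 = t 5" unfolding frame_pts_def t_def by simp_all
  have PS: "?P i \<in> Sing" "orth (ee 0) (?P i)" "orth (ee 1) (?P i)" if "i < 5" for i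
  proof -
    have "?P i \<in> set frame_pts" by (rule nth_mem) (use that in \<open>simp add: frame_pts_def\<close>)
    then show "?P i \<in> Sing" "orth (ee 0) (?P i)" "orth (ee 1) (?P i)" using frame_pts_adj by auto
  qed
  have ag: "g (?P i) = \<theta> (?P i)" if "i < 4" for i
  proof -
    have "i = 0 \<or> i = 1 \<or> i = 2 \<or> i = 3" using that by linarith
    then show ?thesis using Pn g4[of 2] g4[of 3] gt[of 4] gt[of 5] tS by auto
  qed
  \<comment> \<open>The last frame point lies outside the chosen basis. Its image under g is a
    common neighbour of \<open>\<theta> (ee 0)\<close> and \<open>\<theta> (ee 1)\<close>; there are
    only five of these, and the other four are already taken.\<close>
  have ag4: "g (?P 4) = \<theta> (?P 4)"
  proof -
    have y: "g (ee 0) = \<theta> (ee 0)" "g (ee 1) = \<theta> (ee 1)" using g4 by simp_all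
    let ?N = "{v. orth (\<theta> (ee 0)) v \<and> orth (\<theta> (ee 1)) v}"
    have injP: "inj_on (\<lambda>i. \<theta> (?P i)) {..<5}"
    proof (rule inj_onI)
      fix i j assume ij: "i \<in> {..<5}" "j \<in> {..<5}" "\<theta> (?P i) = \<theta> (?P j)"
      then have "?P i = ?P j" using inj_onD[OF inj] PS(1) by blast
      then show "i = j" using F.a_eq_iff ij by simp
    qed
    have e01: "\<theta> (ee 0) \<in> Sing" "\<theta> (ee 1) \<in> Sing" "\<theta> (ee 0) \<noteq> \<theta> (ee 1)" "\<not> orth (\<theta> (ee 0)) (\<theta> (ee 1))"
      using \<theta>S eS inj_onD[OF inj, of "ee 0" "ee 1"] adj[of "ee 0" "ee 1"] F.farD[OF F.z_far] by auto
    have "(\<lambda>i. \<theta> (?P i)) ` {..<5} = ?N"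
    proof (rule card_subset_eq)
      show "(\<lambda>i. \<theta> (?P i)) ` {..<5} \<subseteq> ?N" using \<theta>orth PS by auto
      show "card ((\<lambda>i. \<theta> (?P i)) ` {..<5}) = card ?N" using card_image[OF injP] F.mu[OF e01] by simp
    qed (rule F.finite_nbrs)
    moreover have "g (?P 4) \<in> ?N" using gorth[OF PS(2)[of 4]] gorth[OF PS(3)[of 4]] y by simp
    ultimately obtain i where i: "i < 5" "g (?P 4) = \<theta> (?P i)" by auto
    have "i = 4"
    proof (rule ccontr)
      assume "i \<noteq> 4"
      then have "i < 4" using i by simp
      then have "g (?P 4) = g (?P i)" using ag i by simp
      then have "?P 4 = ?P i" using ginj SingD(1) PS(1) i by simp
      then show False using F.a_eq_iff[of 4 i] i \<open>i \<noteq> 4\<close> by simp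
    qed
    then show ?thesis using i by simp
  qed
  have "g u = \<theta> u" if u: "u \<in> Sing" for u
  proof (rule F.rigid[OF srg_orth _ _ _ _ _ u])
    show "g (ee 0) = \<theta> (ee 0)" "g (ee 1) = \<theta> (ee 1)" using g4 by simp_all
    show "g (?P i) = \<theta> (?P i)" if "i < 5" for i using ag[of i] ag4 that by (cases "i = 4") auto
  qed (use gorth \<theta>orth in blast)+
  then show ?thesis using gSp gQ by blast
qed


section \<open>The degree 28 representation\<close>

definition sgn2 :: "nat \<Rightarrow> int" where "sgn2 n = (if n = 0 then 1 else -1)"

lemma sgn2_add: "a < 2 \<Longrightarrow> b < 2 \<Longrightarrow> sgn2 ((a + b) mod 2) = sgn2 a * sgn2 b"
  unfolding sgn2_def by (auto simp: less_2_cases_iff)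

lemma sgn2_cases: "sgn2 n = 1 \<or> sgn2 n = -1" unfolding sgn2_def by simp

locale quadric_labelling = srg Y E 5 for Y :: "'a set" and E +
  fixes x :: 'a and h :: "'a \<Rightarrow> nat \<Rightarrow> nat"
  assumes x: "x \<notin> Y" and bij_h: "bij_betw h Y Sing"
    and h_adj: "u \<in> Y \<Longrightarrow> v \<in> Y \<Longrightarrow> orth (h u) (h v) = E u v"
begin

abbreviation "X \<equiv> insert x Y"
abbreviation "Isot \<equiv> {c \<in> F2_6. Q0 c = 0}"

definition H :: "'a \<Rightarrow> nat \<Rightarrow> nat" where "H i = (if i = x then zvec else h i)"

lemma H_x: "H x = zvec" unfolding H_def by simp

lemma H_Y: "i \<in> Y \<Longrightarrow> H i = h i" "i \<in> Y \<Longrightarrow> H i \<in> Sing"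
  unfolding H_def using x bij_betwE[OF bij_h] by auto

lemma bij_H: "bij_betw H X Isot"
proof -
  have I: "Isot = insert zvec Sing" unfolding Sing_def using Q0_zvec by auto
  have "bij_betw H Y Sing" using bij_h H_Y(1) by (simp cong: bij_betw_cong)
  then show ?thesis unfolding I
    using notIn_Un_bij_betw[of x Y H Sing] x H_x by (simp add: Sing_def)
qed

lemma H_in: assumes "i \<in> X" shows "H i \<in> F2_6" "Q0 (H i) = 0"
  using bij_betwE[OF bij_H] assms by auto

lemma H_eq_iff: "i \<in> X \<Longrightarrow> j \<in> X \<Longrightarrow> H i = H j \<longleftrightarrow> i = j"
  using inj_on_eq_iff[OF bij_betw_imp_inj_on[OF bij_H]] by blast

text \<open>The zero label of x is orthogonal to all labels although x is isolated. Switching at x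
  alone repairs this.\<close>

definition \<delta> :: "'a \<Rightarrow> int" where "\<delta> i = (if i = x then -1 else 1)"

lemma seidel_H: assumes ij: "i \<in> X" "j \<in> X" "i \<noteq> j"
  shows "seidel E i j = - (sgn2 (symp (H i) (H j)) * \<delta> i * \<delta> j)"
proof (cases "i = x \<or> j = x")
  case True
  then have "\<not> E i j" "symp (H i) (H j) = 0" using E_x[OF x] symp_zvec H_x by auto
  then show ?thesis using True ij unfolding seidel_def \<delta>_def sgn2_def by auto
next
  case False
  then have Y: "i \<in> Y" "j \<in> Y" using ij by auto
  have "H i \<noteq> H j" using H_eq_iff ij by blast
  then have "E i j \<longleftrightarrow> symp (H i) (H j) = 0"
    using h_adj[OF Y] orth_iff[OF H_Y(2)[OF Y(1)] H_Y(2)[OF Y(2)]] H_Y(1)[OF Y(1)] H_Y(1)[OF Y(2)] by simp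
  then show ?thesis using False ij unfolding seidel_def \<delta>_def sgn2_def by auto
qed

text \<open>Expanding symp (k + a) (k + b) gives symp a b and two terms that depend on one vertex
  each. These two are absorbed by a switching.\<close>

lemma affine_swaut: assumes p: "\<sigma> permutes X" and g: "g \<in> Sp6_2" and k: "k \<in> F2_6"
  and \<sigma>: "\<And>i. i \<in> X \<Longrightarrow> H (\<sigma> i) = vadd k (g (H i))"
  shows "\<sigma> \<in> swaut X E"
proof -
  define \<nu> where "\<nu> i = \<delta> (\<sigma> i) * \<delta> i * sgn2 (symp k (g (H i)))" for i
  have dpm: "\<delta> i = 1 \<or> \<delta> i = -1" for i unfolding \<delta>_def by simp
  have pm: "\<nu> i = 1 \<or> \<nu> i = -1" for i
    unfolding \<nu>_def using dpm[of i] dpm[of "\<sigma> i"] sgn2_cases[of "symp k (g (H i))"] by (elim disjE) simp_all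
  have sei: "seidel E (\<sigma> i) (\<sigma> j) = \<nu> i * \<nu> j * seidel E i j" if ij: "i \<in> X" "j \<in> X" for i j
  proof (cases "i = j")
    case True
    then show ?thesis using pm[of i] by (auto simp: seidel_def)
  next
    case False
    have s: "\<sigma> i \<in> X" "\<sigma> j \<in> X" "\<sigma> i \<noteq> \<sigma> j"
      using permutes_in_image[OF p, of i] permutes_in_image[OF p, of j] ij permutes_inj[OF p] False by (blast, blast, metis injD)
    let ?a = "g (H i)" and ?b = "g (H j)"
    have ab: "symp ?a ?b = symp (H i) (H j)" using Sp6_2D(3)[OF g] H_in(1) ij by blast
    have "symp (vadd k ?a) (vadd k ?b) = ((symp k ?b + symp k ?a) mod 2 + symp ?a ?b) mod 2"
      unfolding symp_vadd_left symp_vadd_right symp_self symp_commute[of ?a k]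
      using symp_bit[of k ?a] symp_bit[of k ?b] symp_bit[of ?a ?b] by (elim disjE) simp_all
    then have "sgn2 (symp (H (\<sigma> i)) (H (\<sigma> j))) = sgn2 (symp k ?b) * sgn2 (symp k ?a) * sgn2 (symp (H i) (H j))"
      unfolding \<sigma>[OF ij(1)] \<sigma>[OF ij(2)] ab by (simp add: sgn2_add symp_less_2)
    then show ?thesis
      unfolding seidel_H[OF s] seidel_H[OF ij False] \<nu>_def
      using dpm[of i] dpm[of j] by (elim disjE) simp_all
  qed
  show ?thesis unfolding swaut_def
    by (intro CollectI conjI exI[of _ \<nu>] ballI p pm sei)
qed

definition f :: "'a \<Rightarrow> (nat \<Rightarrow> nat) \<Rightarrow> nat" where "f i = Qf (H i)"

lemma bij_f: "bij_betw f X ell_forms"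
proof -
  have "bij_betw Qf Isot ell_forms" unfolding bij_betw_def ell_forms_eq
    using Qf_inj by (auto intro!: inj_onI)
  from bij_betw_trans[OF bij_H this] show ?thesis unfolding f_def comp_def .
qed

definition conjugate :: "('a \<Rightarrow> 'a) \<Rightarrow> ((nat \<Rightarrow> nat) \<Rightarrow> nat) \<Rightarrow> (nat \<Rightarrow> nat) \<Rightarrow> nat" where
  "conjugate \<sigma> = (\<lambda>z. if z \<in> ell_forms then f (\<sigma> (inv_into X f z)) else z)"

lemma conjugate_affine: assumes g: "g \<in> Sp6_2" and m: "moves_Q0 g c"
  and \<sigma>: "\<And>i. i \<in> X \<Longrightarrow> H (\<sigma> i) = vadd c (g (H i))"
  shows "conjugate \<sigma> = (\<lambda>Q. if Q \<in> ell_forms then qact g Q else Q)"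
proof
  fix Q
  show "conjugate \<sigma> Q = (if Q \<in> ell_forms then qact g Q else Q)"
  proof (cases "Q \<in> ell_forms")
    case True
    then obtain i where i: "i \<in> X" "Q = f i" using bij_betw_imp_surj_on[OF bij_f] by blast
    have "inv_into X f Q = i" using bij_betw_inv_into_left[OF bij_f i(1)] i(2) by simp
    then have "conjugate \<sigma> Q = Qf (vadd c (g (H i)))" unfolding conjugate_def using True \<sigma>[OF i(1)] by (simp add: f_def)
    also have "\<dots> = qact g Q" using qact_Qf[OF g m H_in(1)[OF i(1)]] i(2) by (simp add: f_def)
    finally show ?thesis using True by simp
  qed (simp add: conjugate_def)
qed

lemma Sp_subset: assumes g: "g \<in> Sp6_2"
  shows "\<exists>\<sigma>\<in>swaut X E. (\<lambda>Q. if Q \<in> ell_forms then qact g Q else Q) = conjugate \<sigma>"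
proof -
  obtain c where c: "c \<in> F2_6" "Q0 c = 0" "moves_Q0 g c" using ex_moves_Q0[OF g] .
  note D = Sp6_2D[OF g]
  define \<sigma> where "\<sigma> i = (if i \<in> X then inv_into X H (vadd c (g (H i))) else i)" for i
  \<comment> \<open>Q0 (c + g d) = Q0 c + Q0 (g d) + symp c (g d) = Q0 d, so the affine map respects
    the zeros of \<open>Q0\<close>.\<close>
  have I: "vadd c (g d) \<in> Isot" if "d \<in> Isot" for d
  proof -
    have d: "d \<in> F2_6" "Q0 d = 0" using that by auto
    have "(Q0 (g d) + symp c (g d)) mod 2 = 0" using c(3)[unfolded moves_Q0_def, rule_format, OF d(1)] d(2) by simp
    then have "Q0 (vadd c (g d)) = 0" unfolding Q0_vadd using c(2) by simp
    then show ?thesis using c(1) D(4)[OF d(1)] by simp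
  qed
  have s: "\<sigma> i \<in> X" "H (\<sigma> i) = vadd c (g (H i))" if i: "i \<in> X" for i
  proof -
    have "vadd c (g (H i)) \<in> Isot" using I[of "H i"] H_in[OF i] by blast
    then show "\<sigma> i \<in> X" "H (\<sigma> i) = vadd c (g (H i))"
      unfolding \<sigma>_def using i bij_betw_inv_into_right[OF bij_H] bij_betwE[OF bij_betw_inv_into[OF bij_H]] by auto
  qed
  have inj: "inj_on \<sigma> X"
  proof (rule inj_onI)
    fix i j assume ij: "i \<in> X" "j \<in> X" "\<sigma> i = \<sigma> j"
    then have "vadd c (g (H i)) = vadd c (g (H j))" using s by metis
    then have "g (H i) = g (H j)" using vadd_cancel D(4) H_in(1) ij(1,2) by metis
    then show "i = j" using D(5) H_in(1) H_eq_iff ij(1,2) by blast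
  qed
  have "\<sigma> ` X = X" by (rule endo_inj_surj) (use finite_Y s inj in auto)
  then have p: "\<sigma> permutes X"
    using inj by (intro bij_imp_permutes) (auto simp: bij_betw_def \<sigma>_def)
  have "\<sigma> \<in> swaut X E" by (rule affine_swaut[OF p g c(1)]) (rule s(2))
  moreover have "conjugate \<sigma> = (\<lambda>Q. if Q \<in> ell_forms then qact g Q else Q)"
    by (rule conjugate_affine[OF g c(3)]) (rule s(2))
  ultimately show ?thesis by metis
qed

text \<open>On labels orthogonal to \<open>H u\<close> only the translation acts, which exchanges x
  with u and produces third points. On the other labels the transvection adds \<open>H u\<close>
  too, and the two additions cancel.\<close>

lemma H_transv: assumes u: "u \<in> X" and j: "j \<in> X"
  shows "H (transv x u j) = vadd (H u) (tv (H u) (H j))"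
proof (cases "u = x")
  case True
  have "vadd zvec (H j) = H j" using vadd_zvec[OF H_in(1)[OF j]] vadd_commute[of zvec "H j"] by simp
  then show ?thesis using True unfolding transv_def tv_def by (simp add: H_x symp_zvec)
next
  case ux: False
  then have uY: "u \<in> Y" using u by simp
  note uF = H_in[OF u] and jF = H_in[OF j]
  consider "j = x" | "j = u" | "E u j" | "j \<noteq> x" "j \<noteq> u" "\<not> E u j" by blast
  then show ?thesis
  proof cases
    case 1
    then show ?thesis using ux vadd_zvec[OF uF(1)] unfolding transv_def tv_def by (simp add: H_x symp_zvec)
  next
    case 2
    then show ?thesis using ux vadd_self unfolding transv_def tv_def by (simp add: H_x symp_self)
  next
    case 3
    then have jY: "j \<in> Y" "j \<noteq> x" "j \<noteq> u" using E_in x E_irrefl by blast+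
    have o: "orth (h u) (h j)" using h_adj[OF uY jY(1)] 3 by simp
    have t: "third u j \<in> Y" using third_adj(1)[OF 3] E_in by blast
    have "h (third u j) = srg.third orth (h u) (h j)"
    proof (rule hom_third[OF srg_orth _ 3])
      fix v w assume "E v w"
      then show "orth (h v) (h w)" using h_adj[of v w] E_in[of v w] by simp
    qed
    also have "\<dots> = vadd (h u) (h j)" by (rule third_orth[OF o])
    finally have "H (third u j) = vadd (H u) (H j)" using H_Y(1) uY jY t by simp
    moreover have "symp (H u) (H j) = 0" using o H_Y(1) uY jY unfolding orth_def by simp
    ultimately show ?thesis using ux jY 3 unfolding transv_def tv_def by simp
  next
    case 4
    then have jY: "j \<in> Y" using j by simp
    have "H u \<noteq> H j" using H_eq_iff[OF u j] 4 by simp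
    then have "symp (H u) (H j) \<noteq> 0"
      using h_adj[OF uY jY] 4 orth_iff[OF H_Y(2)[OF uY] H_Y(2)[OF jY]] H_Y(1)[OF uY] H_Y(1)[OF jY] by simp
    moreover have "vadd (H u) (vadd (H j) (H u)) = H j" using vadd_cancel[OF jF(1), of "H u"] vadd_commute by metis
    ultimately show ?thesis using ux 4 unfolding transv_def tv_def by simp
  qed
qed

lemma Aut_linear: assumes \<phi>: "\<phi> \<in> Aut Y E"
  shows "\<exists>g\<in>Sp6_2. (\<forall>v\<in>F2_6. Q0 (g v) = Q0 v) \<and> (\<forall>i\<in>X. H (\<phi> i) = g (H i))"
proof -
  note D = AutD[OF \<phi>]
  define k where "k = inv_into Y h"
  have k: "k u \<in> Y" "h (k u) = u" if "u \<in> Sing" for u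
    using bij_betw_inv_into_right[OF bij_h that] bij_betwE[OF bij_betw_inv_into[OF bij_h]] that unfolding k_def by auto
  have kh: "k (h i) = i" if "i \<in> Y" for i unfolding k_def using bij_betw_inv_into_left[OF bij_h that] .
  define \<theta> where "\<theta> u = h (\<phi> (k u))" for u
  have hi: "h i = h j \<longleftrightarrow> i = j" if "i \<in> Y" "j \<in> Y" for i j
    using inj_on_eq_iff[OF bij_betw_imp_inj_on[OF bij_h]] that by blast
  have 1: "orth (\<theta> u) (\<theta> v) = orth u v" if "u \<in> Sing" "v \<in> Sing" for u v
    using h_adj[OF D(3)[OF k(1)[OF that(1)]] D(3)[OF k(1)[OF that(2)]]] D(2)[OF k(1)[OF that(1)] k(1)[OF that(2)]]
      h_adj[OF k(1)[OF that(1)] k(1)[OF that(2)]] k(2)[OF that(1)] k(2)[OF that(2)] unfolding \<theta>_def by simp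
  have 2: "\<theta> u \<in> Sing" if "u \<in> Sing" for u
    unfolding \<theta>_def using bij_betwE[OF bij_h] D(3)[OF k(1)[OF that]] by blast
  have 3: "inj_on \<theta> Sing"
  proof (rule inj_onI)
    fix u v assume uv: "u \<in> Sing" "v \<in> Sing" "\<theta> u = \<theta> v"
    then have "\<phi> (k u) = \<phi> (k v)" unfolding \<theta>_def using hi D(3) k(1) by blast
    then have "k u = k v" using injD[OF D(4)] by blast
    then have "h (k u) = h (k v)" by (rule arg_cong)
    then show "u = v" unfolding k(2)[OF uv(1)] k(2)[OF uv(2)] .
  qed
  obtain g where g: "g \<in> Sp6_2" "\<And>v. v \<in> F2_6 \<Longrightarrow> Q0 (g v) = Q0 v" "\<And>u. u \<in> Sing \<Longrightarrow> g u = \<theta> u"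
    using orth_automorphism_linear[of \<theta>, OF 1 2 3] by blast
  have "H (\<phi> i) = g (H i)" if "i \<in> X" for i
  proof (cases "i = x")
    case True
    then show ?thesis using permutes_not_in[OF D(1) x] Sp6_2D(6)[OF g(1)] by (simp add: H_x)
  next
    case False
    then have i: "i \<in> Y" using that by simp
    then show ?thesis using H_Y(1)[OF i] H_Y(1)[OF D(3)[OF i]] g(3)[OF H_Y(2)[OF i]] kh[OF i] unfolding \<theta>_def by simp
  qed
  then show ?thesis using g(1,2) by blast
qed

text \<open>Up to a graph transvection \<sigma> is an automorphism of Y, hence a linear isometry g
  of \<open>Q0\<close>. Restoring the transvection gives an affine map whose linear part
  \<open>tv (H u) \<circ> g\<close> moves \<open>Q0\<close> to the form labelled by its own
  translation part.\<close>

lemma swaut_subset: assumes s: "\<sigma> \<in> swaut X E"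
  shows "\<exists>g\<in>Sp6_2. conjugate \<sigma> = (\<lambda>Q. if Q \<in> ell_forms then qact g Q else Q)"
proof -
  define u where "u = \<sigma> x"
  have p: "\<sigma> permutes X" using s unfolding swaut_def by blast
  then have u: "u \<in> X" unfolding u_def using permutes_in_image[of \<sigma> X x] by blast
  let ?\<phi> = "transv x u \<circ> \<sigma>"
  have "?\<phi> \<in> swaut X E" using swaut_comp[OF transv_swaut[OF x u] s] .
  moreover have "?\<phi> x = x" using transv_transv[OF x, of u x] transv_x unfolding u_def by simp
  ultimately have a: "?\<phi> \<in> Aut Y E" using swaut_stabilizer[OF x] by blast
  obtain g where g: "g \<in> Sp6_2" "\<And>v. v \<in> F2_6 \<Longrightarrow> Q0 (g v) = Q0 v" "\<And>i. i \<in> X \<Longrightarrow> H (?\<phi> i) = g (H i)"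
    using Aut_linear[OF a] by blast
  let ?g = "tv (H u) \<circ> g"
  have gS: "?g \<in> Sp6_2" using Sp6_2_comp[OF tv_Sp[OF H_in(1)[OF u]] g(1)] .
  have m: "moves_Q0 ?g (H u)" by (rule moves_Q0_tv_comp[OF H_in(2)[OF u] g(2)])
  have "H (\<sigma> i) = vadd (H u) (?g (H i))" if i: "i \<in> X" for i
  proof -
    have "transv x u permutes X" using transv_swaut[OF x u] unfolding swaut_def by blast
    then have "?\<phi> i \<in> X" using permutes_in_image[OF p, of i] permutes_in_image[of "transv x u" X "\<sigma> i"] i by simp
    then show ?thesis using H_transv[OF u, of "?\<phi> i"] transv_transv[OF x, of u "\<sigma> i"] g(3)[OF i] by simp
  qed
  from conjugate_affine[OF gS m this] show ?thesis using gS by blast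
qed

lemma perm_iso_S62: "perm_iso X (swaut X E) ell_forms S62_deg28"
proof -
  have "S62_deg28 = conjugate ` swaut X E"
    unfolding S62_deg28_def
  proof (intro equalityI subsetI)
    fix q assume "q \<in> (\<lambda>g Q. if Q \<in> ell_forms then qact g Q else Q) ` Sp6_2"
    then show "q \<in> conjugate ` swaut X E" using Sp_subset by blast
  next
    fix q assume "q \<in> conjugate ` swaut X E"
    then show "q \<in> (\<lambda>g Q. if Q \<in> ell_forms then qact g Q else Q) ` Sp6_2" using swaut_subset by blast
  qed
  then show ?thesis unfolding perm_iso_def conjugate_def using bij_f by blast
qed

end

lemma srg_5_perm_iso_S62: assumes "srg Y E 5" "x \<notin> Y"
  shows "perm_iso (insert x Y) (swaut (insert x Y) E) ell_forms S62_deg28"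
proof -
  obtain h where h: "bij_betw h Y Sing" "\<And>u v. u \<in> Y \<Longrightarrow> v \<in> Y \<Longrightarrow> orth (h u) (h v) = E u v"
    using srg_iso[OF assms(1) srg_orth] by auto
  interpret srg Y E 5 by fact
  interpret quadric_labelling Y E x h
    by unfold_locales (use assms h in auto)
  show ?thesis by (rule perm_iso_S62)
qed


section \<open>The classification\<close>

lemma perm_iso_imp_iso: assumes "perm_iso X A Z B" "\<And>a. a \<in> A \<Longrightarrow> a permutes X"
  shows "perm_grp A \<cong> perm_grp B"
proof -
  obtain f where f: "bij_betw f X Z" and B: "B = (\<lambda>a z. if z \<in> Z then f (a (inv_into X f z)) else z) ` A"
    using assms(1) unfolding perm_iso_def by blast
  define c where "c a = (\<lambda>z. if z \<in> Z then f (a (inv_into X f z)) else z)" for a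
  have Bc: "B = c ` A" unfolding B c_def ..
  have gf: "inv_into X f (f v) = v" if "v \<in> X" for v using bij_betw_inv_into_left[OF f that] .
  have fZ: "f v \<in> Z" if "v \<in> X" for v using bij_betwE[OF f] that by blast
  have gX: "inv_into X f z \<in> X" if "z \<in> Z" for z using bij_betwE[OF bij_betw_inv_into[OF f]] that by blast
  have aX: "a v \<in> X" if "a \<in> A" "v \<in> X" for a v using permutes_in_image[OF assms(2)[OF that(1)]] that(2) by blast
  have "c (a \<circ> b) = c a \<circ> c b" if "a \<in> A" "b \<in> A" for a b
  proof
    fix z show "c (a \<circ> b) z = (c a \<circ> c b) z"
      unfolding c_def using gX[of z] aX[OF that(2) gX] fZ gf by (cases "z \<in> Z") simp_all
  qed
  moreover have "inj_on c A"
  proof (rule inj_onI, rule ext)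
    fix a b v assume h: "a \<in> A" "b \<in> A" "c a = c b"
    show "a v = b v"
    proof (cases "v \<in> X")
      case True
      then have "f (a v) = f (b v)" using fun_cong[OF h(3), of "f v"] fZ gf unfolding c_def by simp
      then show ?thesis using inj_onD[OF bij_betw_imp_inj_on[OF f]] aX h True by blast
    next
      case False
      then show ?thesis using permutes_not_in[OF assms(2)] h by metis
    qed
  qed
  ultimately have "c \<in> iso (perm_grp A) (perm_grp B)"
    unfolding iso_def hom_def perm_grp_def bij_betw_def Bc by auto
  then show ?thesis unfolding is_iso_def by blast
qed

lemma permutes_iso_sym_group: assumes "finite A" shows "perm_grp {p. p permutes A} \<cong> sym_group (card A)"
proof -
  obtain f where f: "bij_betw f {1..card A} A" using ex_bij_betw_nat_finite_1[OF assms] by blast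
  \<comment> \<open>For the constant relation every permutation is an automorphism, so conjugation
    of full symmetric groups is a special case.\<close>
  have "perm_iso A (Aut A (\<lambda>_ _. True)) {1..card A} (Aut {1..card A} (\<lambda>_ _. True))"
    by (rule perm_iso_Aut[OF bij_betw_inv_into[OF f]]) simp
  moreover have "Aut V (\<lambda>_ _. True) = {p. p permutes V}" for V :: "'c set" unfolding Aut_def by simp
  moreover have "Aut V (\<lambda>_ _. True) = {p. p permutes V}" for V :: "nat set" unfolding Aut_def by simp
  ultimately have "perm_iso A {p. p permutes A} {1..card A} {p. p permutes {1..card A}}" by (simp add: Aut_def)
  then have "perm_grp {p. p permutes A} \<cong> perm_grp {p. p permutes {1..card A}}"
    by (rule perm_iso_imp_iso) simp
  moreover have "perm_grp {p. p permutes {1..card A}} = sym_group (card A)"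
    unfolding perm_grp_def sym_group_def ..
  ultimately show ?thesis by simp
qed

lemma srg_1_complete: assumes "srg Y E 1" shows "u \<in> Y \<Longrightarrow> v \<in> Y \<Longrightarrow> E u v \<longleftrightarrow> u \<noteq> v" "card Y = 3"
proof -
  interpret srg Y E 1 by fact
  show "card Y = 3" using card_Y by simp
  show "E u v \<longleftrightarrow> u \<noteq> v" if uv: "u \<in> Y" "v \<in> Y"
  proof -
    have "far u = {}" using card_far[OF uv(1)] finite_far[of u] by simp
    then show ?thesis using uv E_irrefl unfolding far_def by blast
  qed
qed

lemma srg_cases: assumes "srg Y E s" obtains "s = 1" | "s \<in> {2, 3, 5}" "\<And>y. y \<in> Y \<Longrightarrow> \<exists>z a. frame Y E s y z a" "Y \<noteq> {}"
proof (cases "s = 1")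
  case False
  interpret srg Y E s by fact
  have s: "1 < s" using False s_pos by simp
  have fr: "\<exists>z a. frame Y E s y z a" if "y \<in> Y" for y
  proof -
    have "far y \<noteq> {}" using card_far[OF that] s by auto
    then show ?thesis using ex_frame[OF that] by blast
  qed
  have "Y \<noteq> {}" using card_Y s by auto
  then obtain y z a where "frame Y E s y z a" using fr by blast
  then have "s \<in> {2, 3, 5}" by (rule frame.s_cases)
  with \<open>Y \<noteq> {}\<close> show thesis using that fr by blast
qed (use that in blast)

lemma extensible_graph_iso: assumes "extensible Y E 1 s sb" "extensible Y' E' 1 s sb"
  shows "graph_iso Y E Y' E'"
proof -
  note S = extensible_imp_srg(1)[OF assms(1)] extensible_imp_srg(1)[OF assms(2)]
  show ?thesis
  proof (cases "s = 1")
    case True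
    note A = srg_1_complete[OF S(1)[unfolded True]] and B = srg_1_complete[OF S(2)[unfolded True]]
    have "finite Y" "finite Y'" using A(2) B(2) by (auto intro: card_ge_0_finite)
    then obtain f where f: "bij_betw f Y Y'" using finite_same_card_bij A(2) B(2) by metis
    have "E' (f u) (f v) = E u v" if "u \<in> Y" "v \<in> Y" for u v
      using A(1)[OF that] B(1)[of "f u" "f v"] bij_betwE[OF f] inj_on_eq_iff[OF bij_betw_imp_inj_on[OF f]] that by simp
    then show ?thesis unfolding graph_iso_def using f by blast
  next
    case False
    obtain f where "bij_betw f Y Y'" "\<And>u v. u \<in> Y \<Longrightarrow> v \<in> Y \<Longrightarrow> E' (f u) (f v) = E u v"
      using srg_iso[OF S False] by blast
    then show ?thesis unfolding graph_iso_def by blast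
  qed
qed

text \<open>The graph is complete, so all 6 permutations of Y are automorphisms; the switching group
  then has order 4 * 6 = 24 and exhausts the permutations of four points.\<close>

lemma srg_1_groups: assumes "srg Y E 1" "x \<notin> Y"
  shows "perm_grp (Aut Y E) \<cong> sym_group 3" "perm_grp (swaut (insert x Y) E) \<cong> sym_group 4"
proof -
  interpret srg Y E 1 by fact
  note A = srg_1_complete[OF assms(1)]
  have aut: "Aut Y E = {p. p permutes Y}"
  proof (intro equalityI subsetI)
    fix p assume "p \<in> {p. p permutes Y}"
    then have p: "p permutes Y" by simp
    have "E (p u) (p v) = E u v" if "u \<in> Y" "v \<in> Y" for u v
      using A(1)[OF that] A(1)[of "p u" "p v"] permutes_in_image[OF p] inj_eq[OF permutes_inj[OF p]] that by simp
    then show "p \<in> Aut Y E" unfolding Aut_def using p by simp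
  qed (simp add: Aut_def)
  show "perm_grp (Aut Y E) \<cong> sym_group 3"
    using permutes_iso_sym_group[OF finite_Y] unfolding aut A(2) .
  have cX: "card (insert x Y) = 4" using assms(2) finite_Y A(2) by simp
  have finX: "finite (insert x Y)" using finite_Y by simp
  have "card (Aut Y E) = 6" unfolding aut using card_permutations[OF A(2) finite_Y] by (simp add: fact_numeral)
  then have "card (swaut (insert x Y) E) = 24" using card_swaut[OF assms(2)] cX by simp
  moreover have "card {p. p permutes insert x Y} = 24" using card_permutations[OF cX finX] by (simp add: fact_numeral)
  ultimately have "swaut (insert x Y) E = {p. p permutes insert x Y}"
    using finite_permutations[OF finX] by (intro card_subset_eq) (auto simp: swaut_def)
  then show "perm_grp (swaut (insert x Y) E) \<cong> sym_group 4"
    using permutes_iso_sym_group[OF finX] cX by simp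
qed

text \<open>For s = 2, 3, 5 the products evaluate to 72, 720, 51840, and to 720, 11520, 1451520 for
  the switching groups.\<close>

lemma srg_groups: assumes "srg Y E s" "s \<noteq> 1" "x \<notin> Y"
  shows "transitive_on Y (Aut Y E)" "card (Aut Y E) = (6 * s - 3) * ((4 * s - 4) * fact s)"
    "doubly_transitive_on (insert x Y) (swaut (insert x Y) E)"
    "card (swaut (insert x Y) E) = (6 * s - 2) * ((6 * s - 3) * ((4 * s - 4) * fact s))"
    "card (insert x Y) = 6 * s - 2"
proof -
  interpret srg Y E s by fact
  obtain y z a where "frame Y E s y z a" using srg_cases[OF assms(1)] assms(2) by (metis ex_in_conv)
  then interpret F: frame Y E s y z a .
  show tr: "transitive_on Y (Aut Y E)" by (rule F.transitive_Aut)
  show ca: "card (Aut Y E) = (6 * s - 3) * ((4 * s - 4) * fact s)" using F.card_Aut card_Y by simp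
  show "doubly_transitive_on (insert x Y) (swaut (insert x Y) E)" by (rule doubly_transitive_swaut[OF assms(3) tr])
  show cX: "card (insert x Y) = 6 * s - 2" using assms(3) finite_Y card_Y s_pos by simp
  show "card (swaut (insert x Y) E) = (6 * s - 2) * ((6 * s - 3) * ((4 * s - 4) * fact s))"
    using card_swaut[OF assms(3)] cX ca by simp
qed

lemma srg_far_groups: assumes "srg Y E s" "s \<noteq> 1" "y \<in> Y" and N: "N = srg.far Y E y"
  shows "card (Aut N (induced N E)) = (4 * s - 4) * fact s"
    "s \<noteq> 5 \<Longrightarrow> perm_iso N (Aut N (induced N E)) (cube_verts s) (cube_sym s)"
    "s = 5 \<Longrightarrow> perm_iso N (Aut N (induced N E)) (cube_verts 4) (Aut (cube_verts 4) cube4_diag)"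
proof -
  interpret srg Y E s by fact
  obtain z a where "frame Y E s y z a" using srg_cases[OF assms(1)] assms(2,3) by metis
  then interpret F: frame Y E s y z a .
  show "card (Aut N (induced N E)) = (4 * s - 4) * fact s" unfolding N by (rule F.card_farAut)
  show "perm_iso N (Aut N (induced N E)) (cube_verts s) (cube_sym s)" if "s \<noteq> 5" unfolding N by (rule F.farAut_perm_iso[OF that])
  show "perm_iso N (Aut N (induced N E)) (cube_verts 4) (Aut (cube_verts 4) cube4_diag)" if "s = 5"
    unfolding N by (rule F.farAut_perm_iso_5[OF that])
qed

theorem theorem3:
  shows
  "(\<forall>(Y :: 'a set) E s sb. extensible Y E 1 s sb \<longrightarrow>
       (s, sb) \<in> {(1, 0), (2, 2), (3, 4), (5, 8)}) \<and>
   (\<forall>(s, sb) \<in> {(1, 0), (2, 2), (3, 4), (5, 8)}.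
       \<exists>(Y :: nat set) E. extensible Y E 1 s sb) \<and>
   (\<forall>(Y :: 'a set) E (Y' :: 'b set) E' s sb.
       extensible Y E 1 s sb \<and> extensible Y' E' 1 s sb \<longrightarrow> graph_iso Y E Y' E') \<and>
   (\<forall>(Y :: 'a set) E s sb x EG.
       extensible Y E 1 s sb \<and> x \<notin> Y \<and> graph_on (insert x Y) EG \<and>
       derived (insert x Y) EG x = E \<longrightarrow>
       (let X = insert x Y; Y2 = nbhd2 Y E; A2 = (\<lambda>y. Aut (Y2 y) (induced (Y2 y) E)) in
        ((s, sb) = (1, 0) \<longrightarrow>
           card Y = 3 \<and> card X = 4 \<and> (\<forall>u \<in> Y. \<forall>v \<in> Y. u \<noteq> v \<longrightarrow> E u v) \<and>
           perm_grp (Aut Y E) \<cong> sym_group 3 \<and> perm_grp (Ggrp X EG) \<cong> sym_group 4) \<and>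
        ((s, sb) = (2, 2) \<longrightarrow>
           card Y = 9 \<and> card X = 10 \<and>
           (\<forall>y \<in> Y. perm_iso (Y2 y) (A2 y) (cube_verts 2) (cube_sym 2) \<and> card (A2 y) = 8) \<and>
           transitive_on Y (Aut Y E) \<and> card (Aut Y E) = 72 \<and>
           doubly_transitive_on X (Ggrp X EG) \<and> card (Ggrp X EG) = 720) \<and>
        ((s, sb) = (3, 4) \<longrightarrow>
           card Y = 15 \<and> card X = 16 \<and>
           (\<forall>y \<in> Y. perm_iso (Y2 y) (A2 y) (cube_verts 3) (cube_sym 3) \<and> card (A2 y) = 48) \<and>
           transitive_on Y (Aut Y E) \<and> card (Aut Y E) = 720 \<and>
           doubly_transitive_on X (Ggrp X EG) \<and> card (Ggrp X EG) = 11520) \<and>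
        ((s, sb) = (5, 8) \<longrightarrow>
           card Y = 27 \<and> card X = 28 \<and>
           (\<forall>y \<in> Y. perm_iso (Y2 y) (A2 y) (cube_verts 4) (Aut (cube_verts 4) cube4_diag) \<and>
                    card (A2 y) = 2^4 * fact 5 \<and> card (A2 y) = 1920) \<and>
           transitive_on Y (Aut Y E) \<and> card (Aut Y E) = 51840 \<and>
           doubly_transitive_on X (Ggrp X EG) \<and> card (Ggrp X EG) = 1451520 \<and>
           perm_iso X (Ggrp X EG) ell_forms S62_deg28)))"
proof (rule conjI, goal_cases)
  case 1
  show ?case
  proof (intro allI impI)
    fix Y :: "'a set" and E s sb assume "extensible Y E 1 s sb"
    note S = extensible_imp_srg[OF this]
    from S(1) show "(s, sb) \<in> {(1, 0), (2, 2), (3, 4), (5, 8)}"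
    proof (cases rule: srg_cases)
      case 1 then show ?thesis using S(2) by simp
    next
      case 2 then show ?thesis using S(2) by auto
    qed
  qed
next
  case 2
  show ?case
  proof (rule conjI, goal_cases)
    case 1
    show ?case using ex_extensible_nat[of 1] ex_extensible_nat[of 2] ex_extensible_nat[of 3] ex_extensible_nat[of 5] by simp
  next
    case 2
    show ?case
    proof (rule conjI, goal_cases)
      case 1
      show ?case by (intro allI impI) (elim conjE, rule extensible_graph_iso)
    next
      case 2
      show ?case
      proof (intro allI impI, elim conjE, goal_cases)
        case (1 Y E s sb x EG)
        note S = extensible_imp_srg[OF 1(1)]
        have G: "Ggrp (insert x Y) EG = swaut (insert x Y) E"
          using Ggrp_derived[OF 1(3), of x] 1(4) by simp
        have cY: "card Y = 6 * s - 3" by (rule srg.card_Y[OF S(1)])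
        have cX: "card (insert x Y) = 6 * s - 2"
          using srg.finite_Y[OF S(1)] srg.s_pos[OF S(1)] 1(2) cY by simp
        note G1 = srg_groups[OF S(1) _ 1(2)]
        note F1 = srg_far_groups[OF S(1) _ _ S(3)[symmetric]]
        show ?case
          unfolding Let_def G
        proof (intro conjI impI, goal_cases)
          case (3)
          then show ?case using srg_1_complete(1)[of Y E] S(1) by simp
        next
          case 4
          then show ?case using srg_1_groups[of Y E x] S(1) 1(2) by simp
        next
          case 5
          then show ?case using srg_1_groups[of Y E x] S(1) 1(2) by simp
        qed (use cY cX G1 F1 srg_5_perm_iso_S62[of Y E x] S(1) 1(2) in \<open>simp_all add: fact_numeral\<close>)
      qed
    qed
  qed
qed

end
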